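(* Let $\mathbf{H}_n=(x_{jk})_{1\le j,k\le n}$, $n\ge 1$, be random quaternion self-dual Hermitian matrices, where $x_{jk}=a_{jk}\mathbf{e}+b_{jk}\mathbf{i}+c_{jk}\mathbf{j}+d_{jk}\mathbf{k}$ with $x_{kj}=\bar{x}_{jk}$ and $x_{jj}=a_{jj}\mathbf{e}$, and where the entries on the diagonal are iid, the entries above the diagonal are iid quaternion random variables, and all entries on and above the diagonal are independent. Regard $\mathbf{H}_n$ as a $2n\times 2n$ complex Hermitian matrix and put $\mathbf{Q}_n=\frac{1}{\sqrt n}\mathbf{H}_n$. Let $\xi_1,\xi_2\in\mathbb{R}$. Then, almost surely as $n\to\infty$, the largest eigenvalue of $\mathbf{Q}_n$ tends to $\xi_1$ and the smallest eigenvalue of $\mathbf{Q}_n$ tends to $\xi_2$ if and only if all of the following conditions hold: (i) $\mathrm{E}\|x_{11}\|^2=\mathrm{E}(a_{11})^2<\infty$; (ii) $\mathrm{E}a_{12}=\mathrm{E}b_{12}=\mathrm{E}c_{12}=\mathrm{E}d_{12}=0$; (iii) $\mathrm{E}\|x_{12}\|^2=\sigma^2$, and $\xi_1=2\sigma$, $\xi_2=-2\sigma$, where $\sigma\ge 0$; (iv) $\mathrm{E}\|x_{12}\|^4<\infty$.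
   Context: Quaternions are represented as $2\times2$ complex matrices: with $i=\sqrt{-1}$, $\mathbf{e}=\begin{pmatrix}1&0\\0&1\end{pmatrix}$, $\mathbf{i}=\begin{pmatrix}i&0\\0&-i\end{pmatrix}$, $\mathbf{j}=\begin{pmatrix}0&1\\-1&0\end{pmatrix}$, $\mathbf{k}=\begin{pmatrix}0&i\\i&0\end{pmatrix}$. A quaternion is $q=a\mathbf{e}+b\mathbf{i}+c\mathbf{j}+d\mathbf{k}$ with $a,b,c,d\in\mathbb{R}$; its conjugate is $\bar q=a\mathbf{e}-b\mathbf{i}-c\mathbf{j}-d\mathbf{k}$ (the conjugate transpose of the $2\times 2$ matrix) and its norm is $\|q\|=\sqrt{a^2+b^2+c^2+d^2}$. An $n\times n$ quaternion self-dual Hermitian matrix $\mathbf{H}_n=(x_{jk})$ has quaternion entries with $x_{jk}=\bar x_{kj}$; in particular $x_{jj}=a_{jj}\mathbf{e}$ with $a_{jj}$ real. Replacing each entry by its $2\times2$ complex matrix makes $\mathbf{H}_n$ a $2n\times2n$ complex Hermitian matrix, and eigenvalues are taken in the ordinary sense for this matrix. For all $n$ the matrices are formed from one infinite array $(x_{jk})_{j,k\ge1}$ on a common probability space: $\mathbf{H}_n$ is its upper-left $n\times n$ corner. The law of the diagonal entries $x_{jj}$ may differ from that of the off-diagonal entries $x_{jk}$, $j<k$. *)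

theory Defs
  imports "HOL-Probability.Probability" "Jordan_Normal_Form.Spectral_Radius"
begin

text \<open>A quaternion $a\mathbf{e}+b\mathbf{i}+c\mathbf{j}+d\mathbf{k}$ is given by its coordinates
  \<open>(a, b, c, d)\<close>, so that its Borel structure is that of the library's product topology;
  \<open>quat_mat\<close> is its representation as a $2\times 2$ complex matrix.\<close>

type_synonym quat = "real \<times> real \<times> real \<times> real"

definition quat_e :: "complex mat" where
  "quat_e = mat_of_rows_list 2 [[1, 0], [0, 1]]"

definition quat_i :: "complex mat" where
  "quat_i = mat_of_rows_list 2 [[\<i>, 0], [0, - \<i>]]"

definition quat_j :: "complex mat" where
  "quat_j = mat_of_rows_list 2 [[0, 1], [- 1, 0]]"

definition quat_k :: "complex mat" where
  "quat_k = mat_of_rows_list 2 [[0, \<i>], [\<i>, 0]]"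

definition quat_mat :: "quat \<Rightarrow> complex mat" where
  "quat_mat = (\<lambda>(a, b, c, d).
     complex_of_real a \<cdot>\<^sub>m quat_e + complex_of_real b \<cdot>\<^sub>m quat_i +
     complex_of_real c \<cdot>\<^sub>m quat_j + complex_of_real d \<cdot>\<^sub>m quat_k)"

definition quat_cnj :: "quat \<Rightarrow> quat" where
  "quat_cnj = (\<lambda>(a, b, c, d). (a, - b, - c, - d))"

definition quat_norm :: "quat \<Rightarrow> real" where
  "quat_norm = (\<lambda>(a, b, c, d). sqrt (a\<^sup>2 + b\<^sup>2 + c\<^sup>2 + d\<^sup>2))"

text \<open>The upper-left $n\times n$ corner of a quaternion array indexed from 1, written as a
  $2n\times 2n$ complex matrix. Matrix positions are 0-based, so position \<open>(r, s)\<close> lies in the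
  block of entry \<open>(r div 2 + 1, s div 2 + 1)\<close>.\<close>

definition quat_corner :: "(nat \<Rightarrow> nat \<Rightarrow> quat) \<Rightarrow> nat \<Rightarrow> complex mat" where
  "quat_corner X n = mat (2 * n) (2 * n)
     (\<lambda>(r, s). quat_mat (X (r div 2 + 1) (s div 2 + 1)) $$ (r mod 2, s mod 2))"

definition scaled_corner :: "(nat \<Rightarrow> nat \<Rightarrow> quat) \<Rightarrow> nat \<Rightarrow> complex mat" where
  "scaled_corner X n = complex_of_real (1 / sqrt (real n)) \<cdot>\<^sub>m quat_corner X n"

text \<open>These are used for Hermitian matrices, whose spectrum is real: there \<open>Re\<close> only converts
  the type of the eigenvalues. On the empty matrix the value is unspecified.\<close>

definition max_eigenvalue :: "complex mat \<Rightarrow> real" where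
  "max_eigenvalue A = Max (Re ` spectrum A)"

definition min_eigenvalue :: "complex mat \<Rightarrow> real" where
  "min_eigenvalue A = Min (Re ` spectrum A)"

end

theory Submission imports Defs "HOL-Real_Asymp.Real_Asymp"
begin

text \<open>The largest eigenvalue is the maximum of the Rayleigh quotient over quaternion vectors.

  Given the moment conditions, the off-diagonal entries are truncated at $n^{7/16}$ and centred; by
  the Borel--Cantelli lemma and a row sum bound the discarded part has norm $o(\sqrt n)$ almost
  surely. The trace of a power of the truncated matrix is a sum over closed walks. Walks that
  traverse some edge once have expectation 0, the tree-like ones give the moments of the semicircle
  law, and all others are controlled by a weight that bounds the sum over all walks of length $m$ by
  $(2+o(1))^m$ even for $m \sim \log n$; this gives $\limsup \lambda_{\max} \le 2\sigma$ by Markov's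
  inequality. For the lower bound, the moments $(\mathbf{Q}_n^k)_{11}$ converge, along $n = i^{64}$, to
  those of the adjacency operator of the half line, so the Chebyshev combination of the Krylov
  vectors $\mathbf{Q}_n^i e_1$ that corresponds to $\delta_0+\dots+\delta_{L-1}$ has Rayleigh quotient
  close to $2\sigma(1-1/L)$. Since $\lambda_{\max}(\mathbf{H}_n)$ is monotone in $n$, the sparse
  subsequence suffices.

  Conversely, bounded eigenvalues force $\|x_{jk}\| = O(\sqrt k)$ for $j \le k$ almost surely, which by
  the second Borel--Cantelli lemma gives the moment conditions; a nonzero mean would create an
  eigenvalue of order $n$.\<close>

section \<open>Quaternions\<close>

text \<open>Non-commutativity is harmless for the walk sums: a retraced edge contributes a
  quaternion times its conjugate, which is real and hence central, so tree-like walks are evaluated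
  as for scalar entries; of all other walks only norms are used, and these are multiplicative. The
  limit therefore depends on the second moment of the norm alone. The trace adds up about
  \<open>n\<close> eigenvalues, so Markov's inequality becomes summable only for powers of order log
  n. For such long walks a bound on their number by a function of the length is too crude; the
  potential replaces it, because it charges ambiguous returns to the rare steps that created them.
  The variance of a diagonal entry of a power is found without studying pairs of walks: its square
  is again a sum over single walks, pinned to the root at half time. This is why walks carry
  time-dependent vertex sets and half-line weights a set \<open>T\<close> of pinned times. Pinning
  factorises the half-line weights, so the leading terms of the variance cancel.\<close>

fun qmul :: "quat \<Rightarrow> quat \<Rightarrow> quat" (infixl \<open>\<diamond>\<close> 70) where
  "(a, b, c, d) \<diamond> (a', b', c', d') =
     (a * a' - b * b' - c * c' - d * d', a * b' + b * a' + c * d' - d * c',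
      a * c' - b * d' + c * a' + d * b', a * d' + b * c' - c * b' + d * a')"

definition qone :: quat where "qone = (1, 0, 0, 0)"

lemma quat_norm_eq: "quat_norm q = norm q"
  by (cases q) (simp add: quat_norm_def norm_Pair real_sqrt_pow2 add.assoc)

lemma norm_quat_sq: "(norm (a, b, c, d))\<^sup>2 = a\<^sup>2 + b\<^sup>2 + c\<^sup>2 + (d::real)\<^sup>2"
  by (simp add: norm_Pair)

lemma qmul_assoc: "p \<diamond> q \<diamond> r = p \<diamond> (q \<diamond> r)"
  by (cases p; cases q; cases r) (simp add: algebra_simps)

text \<open>Euler's four-square identity. Because it is an equality, the norm of a product along a
  walk factors exactly over the edges, whatever the order of the factors.\<close>

lemma norm_qmul: "norm (p \<diamond> q) = norm p * norm q"
proof -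
  have "(norm (p \<diamond> q))\<^sup>2 = (norm p * norm q)\<^sup>2"
    by (cases p; cases q) (simp add: norm_quat_sq power_mult_distrib, simp add: power2_eq_square algebra_simps)
  then show ?thesis by (simp add: power2_eq_iff_nonneg)
qed

lemma bounded_bilinear_qmul: "bounded_bilinear (\<diamond>)"
proof
  show "\<exists>K. \<forall>a b. norm (a \<diamond> b) \<le> norm a * norm b * K"
    by (intro exI[of _ 1]) (simp add: norm_qmul)
qed (auto simp: algebra_simps split: prod.splits)

interpretation qmul: bounded_bilinear "(\<diamond>)" by (rule bounded_bilinear_qmul)

lemma qone_left [simp]: "qone \<diamond> q = q" and qone_right [simp]: "q \<diamond> qone = q"
  by (cases q; simp add: qone_def)+

lemma norm_qone [simp]: "norm qone = 1"
  by (simp add: qone_def norm_Pair)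

lemma norm_quat_cnj [simp]: "norm (quat_cnj q) = norm q"
  by (cases q) (simp add: quat_cnj_def norm_Pair)

lemma quat_cnj_cnj [simp]: "quat_cnj (quat_cnj q) = q"
  by (cases q) (simp add: quat_cnj_def)

lemma quat_cnj_0 [simp]: "quat_cnj 0 = 0"
  by (simp add: quat_cnj_def zero_prod_def)

lemma quat_cnj_one [simp]: "quat_cnj qone = qone"
  by (simp add: quat_cnj_def qone_def)

lemma quat_cnj_qmul: "quat_cnj (p \<diamond> q) = quat_cnj q \<diamond> quat_cnj p"
  by (cases p; cases q) (simp add: quat_cnj_def algebra_simps)

lemma bounded_linear_quat_cnj: "bounded_linear quat_cnj"
proof (rule bounded_linear_intro[where K = 1])
qed (auto simp: quat_cnj_def norm_Pair split: prod.splits)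

lemmas linear_quat_cnj = bounded_linear.linear[OF bounded_linear_quat_cnj]

lemmas quat_cnj_diff = linear_diff[OF linear_quat_cnj]
  and quat_cnj_sum = linear_sum[OF linear_quat_cnj]
  and quat_cnj_scaleR = linear_scale[OF linear_quat_cnj]

lemma qmul_cnj: "q \<diamond> quat_cnj q = (norm q)\<^sup>2 *\<^sub>R qone"
  by (cases q) (simp add: quat_cnj_def qone_def norm_quat_sq, simp add: power2_eq_square)

lemma cnj_qmul: "quat_cnj q \<diamond> q = (norm q)\<^sup>2 *\<^sub>R qone"
  by (cases q) (simp add: quat_cnj_def qone_def norm_quat_sq, simp add: power2_eq_square)

lemma inner_qmul_left: "inner p (q \<diamond> r) = inner (quat_cnj q \<diamond> p) r"
  by (cases p; cases q; cases r) (simp add: quat_cnj_def algebra_simps)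

lemma borel_measurable_qmul [measurable (raw)]:
  assumes [measurable]: "f \<in> borel_measurable M" "g \<in> borel_measurable M"
  shows "(\<lambda>w. f w \<diamond> g w) \<in> borel_measurable M"
proof -
  have "continuous_on UNIV (\<lambda>x. fst x \<diamond> snd x)"
    by (intro qmul.continuous_on continuous_intros)
  then show ?thesis
    using borel_measurable_continuous_Pair[OF assms, of "(\<diamond>)"] by (simp add: case_prod_beta)
qed

lemma borel_measurable_quat_cnj [measurable]: "quat_cnj \<in> borel_measurable borel"
  by (intro borel_measurable_continuous_onI linear_continuous_on bounded_linear_quat_cnj)

lemma quat_mat_alt:
  "quat_mat (a, b, c, d) = mat 2 2 (\<lambda>(r, s).
     if r = 0 then (if s = 0 then Complex a b else Complex c d)
     else (if s = 0 then Complex (- c) d else Complex a (- b)))"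
proof (rule eq_matI)
  fix i j assume "i < dim_row (mat 2 2 (\<lambda>(r, s).
     if r = 0 then (if s = 0 then Complex a b else Complex c d)
     else (if s = 0 then Complex (- c) d else Complex a (- b))))"
     "j < dim_col (mat 2 2 (\<lambda>(r, s).
     if r = 0 then (if s = 0 then Complex a b else Complex c d)
     else (if s = 0 then Complex (- c) d else Complex a (- b))))"
  then have "i = 0 \<or> i = 1" "j = 0 \<or> j = 1" by auto
  then show "quat_mat (a, b, c, d) $$ (i, j) = mat 2 2 (\<lambda>(r, s).
     if r = 0 then (if s = 0 then Complex a b else Complex c d)
     else (if s = 0 then Complex (- c) d else Complex a (- b))) $$ (i, j)"
    by (auto simp: quat_mat_def quat_e_def quat_i_def quat_j_def quat_k_def mat_of_rows_list_def complex_eq_iff)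
qed (simp_all add: quat_mat_def quat_k_def mat_of_rows_list_def)

section \<open>Eigenvalues and the Rayleigh quotient\<close>

definition mvec :: "(nat \<Rightarrow> nat \<Rightarrow> quat) \<Rightarrow> nat \<Rightarrow> (nat \<Rightarrow> quat) \<Rightarrow> nat \<Rightarrow> quat" where
  "mvec X n w j = (\<Sum>k\<in>{1..n}. X j k \<diamond> w k)"

text \<open>The real part of \<open>u* X w\<close>. On the diagonal \<open>u = w\<close> this is the
  Hermitian form whose quotient by \<open>nsq\<close> is the Rayleigh quotient.\<close>

definition ray :: "(nat \<Rightarrow> nat \<Rightarrow> quat) \<Rightarrow> nat \<Rightarrow> (nat \<Rightarrow> quat) \<Rightarrow> (nat \<Rightarrow> quat) \<Rightarrow> real" where
  "ray X n u w = (\<Sum>j\<in>{1..n}. inner (u j) (mvec X n w j))"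

definition nsq :: "nat \<Rightarrow> (nat \<Rightarrow> quat) \<Rightarrow> real" where
  "nsq n w = (\<Sum>j\<in>{1..n}. (norm (w j))\<^sup>2)"

definition herm :: "(nat \<Rightarrow> nat \<Rightarrow> quat) \<Rightarrow> nat \<Rightarrow> bool" where
  "herm X n \<longleftrightarrow> (\<forall>j\<in>{1..n}. \<forall>k\<in>{1..n}. X k j = quat_cnj (X j k))"

lemma nsq_nonneg: "0 \<le> nsq n w"
  by (simp add: nsq_def sum_nonneg)

lemma nsq_eq_0_iff: "nsq n w = 0 \<longleftrightarrow> (\<forall>j\<in>{1..n}. w j = 0)"
  by (simp add: nsq_def sum_nonneg_eq_0_iff)

lemma mvec_add: "mvec X n (\<lambda>j. u j + w j) j = mvec X n u j + mvec X n w j"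
  by (simp add: mvec_def qmul.add_right sum.distrib)

lemma mvec_scaleR: "mvec X n (\<lambda>j. c *\<^sub>R w j) j = c *\<^sub>R mvec X n w j"
  by (simp add: mvec_def qmul.scaleR_right scaleR_right.sum)

lemma ray_add_left: "ray X n (\<lambda>j. u j + v j) w = ray X n u w + ray X n v w"
  by (simp add: ray_def inner_add_left sum.distrib)

lemma ray_add_right: "ray X n w (\<lambda>j. u j + v j) = ray X n w u + ray X n w v"
  by (simp add: ray_def mvec_add inner_add_right sum.distrib)

lemma ray_scale_left: "ray X n (\<lambda>j. c *\<^sub>R u j) w = c * ray X n u w"
  by (simp add: ray_def sum_distrib_left)

lemma ray_scale_right: "ray X n u (\<lambda>j. c *\<^sub>R w j) = c * ray X n u w"
  by (simp add: ray_def mvec_scaleR sum_distrib_left)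

lemma nsq_scale: "nsq n (\<lambda>j. c *\<^sub>R w j) = c\<^sup>2 * nsq n w"
  by (simp add: nsq_def power_mult_distrib sum_distrib_left)

lemma nsq_add: "nsq n (\<lambda>j. u j + w j) = nsq n u + 2 * (\<Sum>j\<in>{1..n}. inner (u j) (w j)) + nsq n w"
  unfolding nsq_def sum_distrib_left sum.distrib[symmetric]
  by (intro sum.cong refl) (simp add: power2_norm_eq_inner inner_add inner_commute algebra_simps)

lemma ray_sym:
  assumes "herm X n"
  shows "ray X n u w = ray X n w u"
proof -
  have "ray X n u w = (\<Sum>j\<in>{1..n}. \<Sum>k\<in>{1..n}. inner (u j) (X j k \<diamond> w k))"
    by (simp add: ray_def mvec_def inner_sum_right)
  also have "\<dots> = (\<Sum>j\<in>{1..n}. \<Sum>k\<in>{1..n}. inner (w k) (X k j \<diamond> u j))"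
  proof (intro sum.cong refl)
    fix j k assume "j \<in> {1..n}" "k \<in> {1..n}"
    then have x: "X k j = quat_cnj (X j k)" using assms unfolding herm_def by blast
    show "inner (u j) (X j k \<diamond> w k) = inner (w k) (X k j \<diamond> u j)"
      unfolding x inner_qmul_left[of "u j"] by (rule inner_commute)
  qed
  also have "\<dots> = (\<Sum>k\<in>{1..n}. \<Sum>j\<in>{1..n}. inner (w k) (X k j \<diamond> u j))"
    by (rule sum.swap)
  finally show ?thesis by (simp add: ray_def mvec_def inner_sum_right)
qed

lemma ray_scaleR_mat: "ray (\<lambda>j k. c *\<^sub>R X j k) n u w = c * ray X n u w"
  by (simp add: ray_def mvec_def qmul.scaleR_left scaleR_right.sum[symmetric] sum_distrib_left)

lemma ray_add_mat: "ray (\<lambda>j k. X j k + Y j k) n u w = ray X n u w + ray Y n u w"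
  by (simp add: ray_def mvec_def qmul.add_left sum.distrib inner_add_right)

text \<open>Polarisation. It transfers a bound on the quadratic form to single off-diagonal entries
  and to sums over off-diagonal blocks, which is where the necessity of the conditions is read
  off.\<close>

lemma ray_bilinear_bound:
  assumes X: "herm X n" and bd: "\<And>w. \<bar>ray X n w w\<bar> \<le> C * nsq n w"
  shows "\<bar>ray X n u w\<bar> \<le> C * (nsq n u + nsq n w) / 2"
proof -
  let ?p = "\<lambda>j. u j + w j" and ?m = "\<lambda>j. u j + (-1) *\<^sub>R w j"
  have "ray X n ?p ?p - ray X n ?m ?m = 4 * ray X n u w"
    unfolding ray_add_left ray_add_right ray_scale_left ray_scale_right
    by (simp add: ray_sym[OF X, of w u])
  moreover have "nsq n ?p + nsq n ?m = 2 * (nsq n u + nsq n w)"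
    unfolding nsq_add nsq_scale by (simp add: sum_negf)
  moreover have "\<bar>ray X n ?p ?p\<bar> \<le> C * nsq n ?p" "\<bar>ray X n ?m ?m\<bar> \<le> C * nsq n ?m"
    by (rule bd)+
  moreover have "C * nsq n ?p + C * nsq n ?m = 2 * (C * (nsq n u + nsq n w))"
    unfolding distrib_left[symmetric] calculation(2) by simp
  ultimately show ?thesis by linarith
qed

text \<open>A complex vector of length $2n$ is read as a quaternion vector through the first
  columns of the blocks.\<close>

fun qcol :: "quat \<Rightarrow> nat \<Rightarrow> complex" where
  "qcol (a, b, c, d) e = (if e = 0 then Complex a b else Complex (- c) d)"

text \<open>Complex scalars act on quaternion vectors from the right, so that they commute with the
  matrix entries, which act from the left.\<close>

definition qcomplex :: "complex \<Rightarrow> quat" where "qcomplex z = (Re z, Im z, 0, 0)"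

lemma qcol_inj: "qcol p 0 = qcol q 0 \<Longrightarrow> qcol p 1 = qcol q 1 \<Longrightarrow> p = q"
  by (cases p; cases q) simp

lemma qcol_0: "qcol 0 e = 0"
  by (simp add: zero_prod_def complex_eq_iff)

lemma qcol_add: "qcol (p + q) e = qcol p e + qcol q e"
  by (cases p; cases q) (simp add: complex_eq_iff)

lemma qcol_sum: "qcol (\<Sum>k\<in>A. f k) e = (\<Sum>k\<in>A. qcol (f k) e)"
  by (induction A rule: infinite_finite_induct) (simp_all add: qcol_0 qcol_add)

lemma qcol_qcomplex: "qcol (q \<diamond> qcomplex z) e = z * qcol q e"
  by (cases q) (auto simp: qcomplex_def complex_eq_iff algebra_simps)

text \<open>The first column of a product of two blocks. This ties the coordinate product to the
  matrices that define a quaternion.\<close>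

lemma qcol_qmul:
  "e < 2 \<Longrightarrow> qcol (p \<diamond> q) e = quat_mat p $$ (e, 0) * qcol q 0 + quat_mat p $$ (e, 1) * qcol q 1"
  by (cases p; cases q; cases e) (auto simp: quat_mat_alt complex_eq_iff algebra_simps)

lemma qcol_exists: "\<exists>q. qcol q 0 = y \<and> qcol q 1 = z"
  by (intro exI[of _ "(Re y, Im y, - Re z, Im z)"]) (simp add: complex_eq_iff)

lemma sum_lessThan_double: "(\<Sum>s<2 * n. f s) = (\<Sum>k<n. f (2 * k) + f (2 * k + 1))"
  for f :: "nat \<Rightarrow> 'a::comm_monoid_add"
  by (induction n) (simp_all add: add.assoc)

section \<open>Complex vectors of length 2n as quaternion vectors of length n\<close>

definition cvec :: "nat \<Rightarrow> (nat \<Rightarrow> quat) \<Rightarrow> complex vec" where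
  "cvec n w = vec (2 * n) (\<lambda>s. qcol (w (s div 2 + 1)) (s mod 2))"

lemma quat_corner_mult_cvec: "quat_corner X n *\<^sub>v cvec n w = cvec n (mvec X n w)"
proof (rule eq_vecI)
  fix r assume "r < dim_vec (cvec n (mvec X n w))"
  then have r: "r < 2 * n" by (simp add: cvec_def)
  let ?A = "\<lambda>k e. quat_mat (X (r div 2 + 1) (k + 1)) $$ (r mod 2, e)"
  have "(quat_corner X n *\<^sub>v cvec n w) $ r
      = (\<Sum>s<2 * n. ?A (s div 2) (s mod 2) * qcol (w (s div 2 + 1)) (s mod 2))"
    using r by (simp add: quat_corner_def cvec_def scalar_prod_def lessThan_atLeast0)
  also have "\<dots> = (\<Sum>k<n. qcol (X (r div 2 + 1) (k + 1) \<diamond> w (k + 1)) (r mod 2))"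
    unfolding sum_lessThan_double by (intro sum.cong refl) (simp add: qcol_qmul)
  also have "\<dots> = qcol (mvec X n w (r div 2 + 1)) (r mod 2)"
    unfolding mvec_def qcol_sum
    by (rule sum.reindex_bij_witness[of _ "\<lambda>k. k - 1" "\<lambda>k. k + 1"]) auto
  finally show "(quat_corner X n *\<^sub>v cvec n w) $ r = cvec n (mvec X n w) $ r"
    using r by (simp add: cvec_def)
qed (simp add: quat_corner_def cvec_def)

lemma cvec_eq_iff: "cvec n u = cvec n w \<longleftrightarrow> (\<forall>j\<in>{1..n}. u j = w j)"
proof
  assume eq: "cvec n u = cvec n w"
  show "\<forall>j\<in>{1..n}. u j = w j"
  proof
    fix j assume j: "j \<in> {1..n}"
    then have "2 * (j - 1) < 2 * n" "2 * (j - 1) + 1 < 2 * n" by auto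
    then have q: "cvec n v $ (2 * (j - 1)) = qcol (v j) 0"
      "cvec n v $ (2 * (j - 1) + 1) = qcol (v j) 1" for v
      using j by (auto simp: cvec_def)
    show "u j = w j" by (rule qcol_inj; simp only: q[symmetric] eq)
  qed
qed (auto simp: cvec_def intro!: eq_vecI)

lemma cvec_surj:
  assumes "v \<in> carrier_vec (2 * n)"
  obtains w where "v = cvec n w"
proof -
  have "\<exists>w. \<forall>j. qcol (w j) 0 = v $ (2 * (j - 1)) \<and> qcol (w j) 1 = v $ (2 * (j - 1) + 1)"
    by (intro choice allI qcol_exists)
  then obtain w where w: "qcol (w j) 0 = v $ (2 * (j - 1))" "qcol (w j) 1 = v $ (2 * (j - 1) + 1)" for j
    by blast
  have "v = cvec n w"
  proof (rule eq_vecI)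
    fix s assume "s < dim_vec (cvec n w)"
    then have c: "cvec n w $ s = qcol (w (s div 2 + 1)) (s mod 2)" by (simp add: cvec_def)
    show "v $ s = cvec n w $ s"
    proof (cases "s mod 2 = 0")
      case True
      then have "2 * (s div 2) = s" by presburger
      with True show ?thesis unfolding c True w by simp
    next
      case False
      then have m: "s mod 2 = 1" by presburger
      then have "2 * (s div 2) + 1 = s" by presburger
      then show ?thesis unfolding c m w by simp
    qed
  qed (use assms in \<open>simp add: cvec_def\<close>)
  then show ?thesis by (rule that)
qed

text \<open>The correspondence \<open>cvec\<close> is a bijection on coordinates
  \<open>{1..n}\<close> that intertwines both the matrix action and the scalars, so eigenvectors
  become right eigenvectors over the quaternions.\<close>

lemma eigenvalue_quat_corner_iff:
  "eigenvalue (quat_corner X n) \<mu> \<longleftrightarrow>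
    (\<exists>w. nsq n w \<noteq> 0 \<and> (\<forall>j\<in>{1..n}. mvec X n w j = w j \<diamond> qcomplex \<mu>))"
proof -
  have z: "cvec n (\<lambda>_. 0) = 0\<^sub>v (2 * n)"
    by (auto simp: cvec_def qcol_0 intro!: eq_vecI)
  have s: "\<mu> \<cdot>\<^sub>v cvec n w = cvec n (\<lambda>j. w j \<diamond> qcomplex \<mu>)" for w
    by (auto simp: cvec_def qcol_qcomplex intro!: eq_vecI)
  have c: "cvec n w \<in> carrier_vec (2 * n)" for w by (simp add: cvec_def)
  have "eigenvalue (quat_corner X n) \<mu> \<longleftrightarrow> (\<exists>v. v \<in> carrier_vec (2 * n) \<and> v \<noteq> 0\<^sub>v (2 * n) \<and>
      quat_corner X n *\<^sub>v v = \<mu> \<cdot>\<^sub>v v)"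
    by (simp add: eigenvalue_def eigenvector_def quat_corner_def)
  also have "\<dots> \<longleftrightarrow> (\<exists>w. cvec n w \<noteq> cvec n (\<lambda>_. 0) \<and> quat_corner X n *\<^sub>v cvec n w = \<mu> \<cdot>\<^sub>v cvec n w)"
    unfolding z by (metis c cvec_surj)
  also have "\<dots> \<longleftrightarrow> (\<exists>w. nsq n w \<noteq> 0 \<and> (\<forall>j\<in>{1..n}. mvec X n w j = w j \<diamond> qcomplex \<mu>))"
    unfolding quat_corner_mult_cvec s cvec_eq_iff nsq_eq_0_iff ..
  finally show ?thesis .
qed

text \<open>The imaginary part of the scalar turns \<open>q\<close> into an orthogonal quaternion.
  Hence the Rayleigh quotient of a right eigenvector is the real part of its eigenvalue.\<close>

lemma inner_qmul_qcomplex: "inner q (q \<diamond> qcomplex z) = Re z * (norm q)\<^sup>2"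
  by (cases q) (simp add: qcomplex_def norm_quat_sq, simp add: power2_eq_square algebra_simps)

section \<open>Maximisers of the Rayleigh quotient\<close>

lemma ray_max_attained:
  assumes n: "n \<ge> 1"
  obtains w where "nsq n w = 1" "\<And>u. ray X n u u \<le> ray X n w w * nsq n u"
proof -
  \<comment> \<open>Vectors are functions on all of \<open>nat\<close>. Fixing them to be 0 off
    \<open>{1..n}\<close> puts the unit sphere into a product of compact sets, where it is
    closed.\<close>
  define K where "K = Pi\<^sub>E UNIV (\<lambda>i. if i \<in> {1..n} then cball (0::quat) 1 else {0})"
  define S where "S = K \<inter> {w. nsq n w = 1}"
  have "compactin (product_topology (\<lambda>_. euclidean) UNIV) K"
    unfolding K_def by (subst compactin_PiE) auto
  then have "compact K" by (simp add: euclidean_product_topology)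
  moreover have co: "continuous_on UNIV (\<lambda>w::nat \<Rightarrow> quat. w i)" for i
    by (rule continuous_on_product_coordinates)
  have cn: "continuous_on UNIV (\<lambda>w. nsq n w)"
    unfolding nsq_def by (intro continuous_intros co)
  have cr: "continuous_on UNIV (\<lambda>w. ray X n w w)"
    unfolding ray_def mvec_def by (intro continuous_intros qmul.continuous_on co)
  have "closed {w. nsq n w = 1}"
    using continuous_closed_vimage[of "{1}" "nsq n"] cn
    by (simp add: vimage_def continuous_on_eq_continuous_at)
  ultimately have "compact S" unfolding S_def by (rule compact_Int_closed)
  moreover have norm1: "norm (w j) \<le> 1" if "nsq n w = 1" "j \<in> {1..n}" for w j
  proof -
    have "(norm (w j))\<^sup>2 \<le> nsq n w"
      unfolding nsq_def using that(2) by (intro member_le_sum) auto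
    then show ?thesis using that(1) by (simp add: power2_le_iff_abs_le[where y = 1, simplified] abs_square_le_1)
  qed
  have "(\<lambda>j. if j = 1 then qone else 0) \<in> S"
    using n by (auto simp: S_def K_def nsq_def if_distrib if_distribR cong: if_cong)
  ultimately obtain w where w: "w \<in> S" "\<And>u. u \<in> S \<Longrightarrow> ray X n u u \<le> ray X n w w"
    using continuous_attains_sup[of S "\<lambda>w. ray X n w w"] continuous_on_subset[OF cr] by blast
  have "ray X n u u \<le> ray X n w w * nsq n u" for u
  proof (cases "nsq n u = 0")
    case True
    then have "ray X n u u = 0" by (simp add: nsq_eq_0_iff ray_def)
    with True show ?thesis by simp
  next
    case False
    define c where "c = 1 / sqrt (nsq n u)"
    have pos: "nsq n u > 0" using False nsq_nonneg[of n u] by linarith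
    have c2: "c\<^sup>2 = 1 / nsq n u" using pos by (simp add: c_def power_divide)
    define v where "v = (\<lambda>j. if j \<in> {1..n} then c *\<^sub>R u j else 0)"
    have "nsq n v = nsq n (\<lambda>j. c *\<^sub>R u j)" by (simp add: nsq_def v_def)
    then have nv: "nsq n v = 1" using pos by (simp add: nsq_scale c2)
    have "ray X n v v = ray X n (\<lambda>j. c *\<^sub>R u j) (\<lambda>j. c *\<^sub>R u j)"
      by (simp add: ray_def mvec_def v_def)
    then have rv: "ray X n v v = ray X n u u / nsq n u"
      using c2 by (simp add: ray_scale_left ray_scale_right flip: mult.assoc power2_eq_square)
    have "v \<in> S" using nv norm1[OF nv] by (auto simp: S_def K_def v_def)
    from w(2)[OF this] show ?thesis using pos by (simp add: rv field_simps)
  qed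
  then show ?thesis using w(1) that by (auto simp: S_def)
qed

text \<open>First variation along the residual \<open>u\<close>: moving \<open>w\<close> by
  \<open>t\<close> times \<open>u\<close> changes \<open>ray - L * nsq\<close> by
  \<open>2 * t * nsq n u\<close> to first order. At a maximiser this gain must be absorbed by a term
  of order \<open>t\<^sup>2\<close>, which for small \<open>t\<close> forces the residual to
  vanish.\<close>

lemma ray_maximiser_eigenvector:
  assumes X: "herm X n" and w: "nsq n w = 1" "\<And>u. ray X n u u \<le> ray X n w w * nsq n u"
    and j: "j \<in> {1..n}"
  shows "mvec X n w j = ray X n w w *\<^sub>R w j"
proof -
  define L where "L = ray X n w w"
  define u where "u = (\<lambda>j. mvec X n w j - L *\<^sub>R w j)"
  have ip: "ray X n u w - L * (\<Sum>j\<in>{1..n}. inner (u j) (w j)) = nsq n u"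
    unfolding ray_def nsq_def sum_distrib_left sum_subtractf[symmetric]
    by (intro sum.cong refl) (simp add: u_def power2_norm_eq_inner inner_diff_right)
  have key: "2 * t * nsq n u \<le> t\<^sup>2 * (L * nsq n u - ray X n u u)" for t
  proof -
    let ?v = "\<lambda>j. w j + t *\<^sub>R u j"
    have 1: "ray X n ?v ?v = L + 2 * t * ray X n u w + t\<^sup>2 * ray X n u u"
      unfolding ray_add_left ray_add_right ray_scale_left ray_scale_right
      by (simp add: ray_sym[OF X, of w u] L_def power2_eq_square algebra_simps)
    have 2: "nsq n ?v = 1 + 2 * t * (\<Sum>j\<in>{1..n}. inner (u j) (w j)) + t\<^sup>2 * nsq n u"
      unfolding nsq_add nsq_scale using w(1)
      by (simp add: sum_distrib_left inner_commute mult.assoc)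
    have 3: "ray X n ?v ?v \<le> L * nsq n ?v" using w(2) unfolding L_def .
    have "2 * t * (ray X n u w - L * (\<Sum>j\<in>{1..n}. inner (u j) (w j))) \<le> t\<^sup>2 * (L * nsq n u - ray X n u u)"
      using 3 unfolding 1 2 by (simp add: algebra_simps)
    then show ?thesis unfolding ip .
  qed
  have "nsq n u = 0"
  proof (rule ccontr)
    assume "nsq n u \<noteq> 0"
    then have pos: "nsq n u > 0" using nsq_nonneg[of n u] by linarith
    define D where "D = \<bar>L * nsq n u - ray X n u u\<bar> + 1"
    have D: "D \<ge> 1" by (simp add: D_def)
    \<comment> \<open>With this \<open>t\<close> the quadratic term is at most
      \<open>t * nsq n u\<close>, half of the linear one.\<close>
    define t where "t = nsq n u / D"
    have t: "t > 0" using pos D by (simp add: t_def)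
    have "2 * t * nsq n u \<le> t\<^sup>2 * D"
      by (rule order.trans[OF key]) (auto simp: D_def intro!: mult_left_mono)
    then have "2 * nsq n u \<le> t * D" using t by (simp add: power2_eq_square)
    then show False using pos D by (simp add: t_def)
  qed
  then show ?thesis using j by (simp add: nsq_eq_0_iff u_def L_def)
qed

text \<open>The maximum of the Rayleigh quotient is an eigenvalue by the first variation, and the
  real part of any eigenvalue is the quotient of its eigenvector.\<close>

lemma max_eigenvalue_quat_corner:
  assumes X: "herm X n" and n: "n \<ge> 1"
  shows "ray X n u u \<le> max_eigenvalue (quat_corner X n) * nsq n u"
    and "\<exists>w. nsq n w = 1 \<and> ray X n w w = max_eigenvalue (quat_corner X n) \<and>
      (\<forall>j\<in>{1..n}. mvec X n w j = max_eigenvalue (quat_corner X n) *\<^sub>R w j)"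
proof -
  obtain w where w: "nsq n w = 1" "\<And>u. ray X n u u \<le> ray X n w w * nsq n u"
    using ray_max_attained[OF n] by blast
  let ?L = "ray X n w w"
  have ev: "\<forall>j\<in>{1..n}. mvec X n w j = ?L *\<^sub>R w j"
    using ray_maximiser_eigenvector[OF X w] by blast
  have sc: "q \<diamond> qcomplex (of_real c) = c *\<^sub>R q" for q c
    by (cases q) (simp add: qcomplex_def)
  have "eigenvalue (quat_corner X n) (of_real ?L)"
    unfolding eigenvalue_quat_corner_iff using w(1) ev by (intro exI[of _ w]) (simp add: sc)
  then have mem: "?L \<in> Re ` spectrum (quat_corner X n)"
    by (force simp: spectrum_def)
  have le: "Re \<mu> \<le> ?L" if "eigenvalue (quat_corner X n) \<mu>" for \<mu>
  proof -
    from that obtain v where v: "nsq n v \<noteq> 0" "\<forall>j\<in>{1..n}. mvec X n v j = v j \<diamond> qcomplex \<mu>"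
      unfolding eigenvalue_quat_corner_iff by blast
    have "ray X n v v = Re \<mu> * nsq n v"
      using v(2) by (simp add: ray_def nsq_def inner_qmul_qcomplex sum_distrib_left)
    with w(2)[of v] v(1) nsq_nonneg[of n v] show ?thesis by simp
  qed
  have fin: "finite (spectrum (quat_corner X n))"
    by (rule card_finite_spectrum(1)[of _ "2 * n"]) (simp add: quat_corner_def)
  have "max_eigenvalue (quat_corner X n) = ?L"
    unfolding max_eigenvalue_def using mem le fin by (intro Max_eqI) (auto simp: spectrum_def)
  then show "ray X n u u \<le> max_eigenvalue (quat_corner X n) * nsq n u"
    and "\<exists>w. nsq n w = 1 \<and> ray X n w w = max_eigenvalue (quat_corner X n) \<and>
      (\<forall>j\<in>{1..n}. mvec X n w j = max_eigenvalue (quat_corner X n) *\<^sub>R w j)"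
    using w ev by auto
qed

text \<open>Allows all later estimates to speak of the largest eigenvalue only, with a sign in front
  of the array.\<close>

lemma min_eigenvalue_quat_corner:
  assumes X: "herm X n" and n: "n \<ge> 1"
  shows "min_eigenvalue (quat_corner X n) = - max_eigenvalue (quat_corner (\<lambda>j k. - X j k) n)"
proof -
  have mv: "mvec (\<lambda>j k. - X j k) n w j = - mvec X n w j" for w j
    by (simp add: mvec_def qmul.minus_left sum_negf)
  have mc: "q \<diamond> qcomplex (- \<mu>) = - (q \<diamond> qcomplex \<mu>)" for q \<mu>
    by (cases q) (simp add: qcomplex_def)
  have "eigenvalue (quat_corner (\<lambda>j k. - X j k) n) \<mu> \<longleftrightarrow> eigenvalue (quat_corner X n) (- \<mu>)" for \<mu>
    unfolding eigenvalue_quat_corner_iff mv mc by (metis minus_minus)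
  then have "spectrum (quat_corner (\<lambda>j k. - X j k) n) = uminus ` spectrum (quat_corner X n)"
    by (force simp: spectrum_def image_iff)
  then have "Re ` spectrum (quat_corner (\<lambda>j k. - X j k) n) = uminus ` Re ` spectrum (quat_corner X n)"
    by (simp add: image_image)
  moreover have c: "quat_corner X n \<in> carrier_mat (2 * n) (2 * n)" by (simp add: quat_corner_def)
  have "finite (spectrum (quat_corner X n))" "spectrum (quat_corner X n) \<noteq> {}"
    using card_finite_spectrum(1)[OF c] spectrum_non_empty[OF c] n by auto
  ultimately show ?thesis
    unfolding max_eigenvalue_def min_eigenvalue_def
    by (subst Max_eqI[of _ "- Min (Re ` spectrum (quat_corner X n))"]) (auto simp: image_image)
qed

lemma scaled_corner_eq: "scaled_corner X n = quat_corner (\<lambda>j k. (1 / sqrt (real n)) *\<^sub>R X j k) n"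
proof -
  have "complex_of_real c * quat_mat q $$ (r, s) = quat_mat (c *\<^sub>R q) $$ (r, s)" if "r < 2" "s < 2" for c q r s
    using that by (cases q) (auto simp: quat_mat_alt complex_eq_iff)
  note q = this
  show ?thesis
    unfolding scaled_corner_def quat_corner_def
    by (intro eq_matI) (simp_all only: dim_row_mat dim_col_mat index_smult_mat index_mat split_conv q mod_less_divisor zero_less_numeral)
qed

section \<open>Weights of walks\<close>

text \<open>An undirected edge is encoded as the sorted pair, so that edges directly index the
  independent entries above the diagonal.\<close>

definition edge :: "nat \<Rightarrow> nat \<Rightarrow> nat \<times> nat" where
  "edge u v = (min u v, max u v)"

lemma edge_commute: "edge u v = edge v u"
  by (simp add: edge_def min.commute max.commute)

lemma edge_eq_iff: "edge a b = edge c d \<longleftrightarrow> (a = c \<and> b = d) \<or> (a = d \<and> b = c)"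
  by (auto simp: edge_def min_def max_def split: if_splits)

text \<open>Walks are stored with the current vertex at the head and the starting vertex last.\<close>

fun cnt :: "nat list \<Rightarrow> nat \<times> nat \<Rightarrow> nat" where
  "cnt (v # u # h) e = of_bool (edge u v = e) + cnt (u # h) e"
| "cnt _ e = 0"

fun loopfree :: "nat list \<Rightarrow> bool" where
  "loopfree (v # u # h) \<longleftrightarrow> u \<noteq> v \<and> loopfree (u # h)"
| "loopfree _ \<longleftrightarrow> True"

text \<open>Steps of a walk are counted as new (to an unvisited vertex), cyclic (to a visited vertex along a
  new edge) and third (along an edge already traversed at least twice); the remaining steps retrace
  an edge for the second time.\<close>

fun newc :: "nat list \<Rightarrow> nat" where
  "newc (v # u # h) = of_bool (v \<notin> set (u # h)) + newc (u # h)"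
| "newc _ = 0"

fun cycc :: "nat list \<Rightarrow> nat" where
  "cycc (v # u # h) = of_bool (v \<in> set (u # h) \<and> cnt (u # h) (edge u v) = 0) + cycc (u # h)"
| "cycc _ = 0"

fun thirdc :: "nat list \<Rightarrow> nat" where
  "thirdc (v # u # h) = of_bool (cnt (u # h) (edge u v) \<ge> 2) + thirdc (u # h)"
| "thirdc _ = 0"

text \<open>An edge traversed exactly once is open: it still waits for a return. This degree counts
  the choices for a return step from \<open>v\<close>; with one open edge the return is
  forced.\<close>

definition odeg :: "nat list \<Rightarrow> nat \<Rightarrow> nat" where
  "odeg h v = card {u. cnt h (edge u v) = 1}"

text \<open>The potential counts the surplus of edges traversed exactly once. On the current vertex
  one such edge is normal (the way back), on any other vertex two are.\<close>

definition psi :: "nat list \<Rightarrow> nat" where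
  "psi h = (\<Sum>v\<in>set h. odeg h v - (if v = hd h then 1 else 2))"

lemma cnt_pos_mem: "cnt h (edge u v) > 0 \<Longrightarrow> u \<in> set h \<and> v \<in> set h"
  by (induction h "edge u v" rule: cnt.induct) (auto simp: edge_eq_iff split: if_splits)

lemma cnt_notin: "v \<notin> set h \<Longrightarrow> cnt h (edge u v) = 0"
  using cnt_pos_mem[of h u v] by auto

lemma finite_cnt_eq_1: "finite {u. cnt h (edge u v) = 1}"
proof (rule finite_subset[of _ "set h"])
  show "{u. cnt h (edge u v) = 1} \<subseteq> set h"
  proof
    fix u assume "u \<in> {u. cnt h (edge u v) = 1}"
    then have "cnt h (edge u v) > 0" by simp
    then show "u \<in> set h" by (blast dest: cnt_pos_mem)
  qed
qed simp

lemma odeg_Cons_other: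
  assumes "w \<noteq> u" "w \<noteq> v"
  shows "odeg (v # u # h) w = odeg (u # h) w"
proof -
  have "edge u v \<noteq> edge x w" for x using assms by (auto simp: edge_eq_iff)
  then show ?thesis by (simp add: odeg_def)
qed

lemma odeg_Cons_end:
  assumes "u \<noteq> v" "w = u \<or> w = v"
  shows "odeg (v # u # h) w =
    (if cnt (u # h) (edge u v) = 0 then odeg (u # h) w + 1
     else if cnt (u # h) (edge u v) = 1 then odeg (u # h) w - 1 else odeg (u # h) w)"
    and "cnt (u # h) (edge u v) = 1 \<Longrightarrow> odeg (u # h) w \<ge> 1"
proof -
  define x where "x = (if w = u then v else u)"
  have x: "edge u v = edge y w \<longleftrightarrow> y = x" for y
    using assms by (auto simp: edge_eq_iff x_def)
  let ?A = "{y. cnt (u # h) (edge y w) = 1}"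
  have cx: "cnt (u # h) (edge x w) = cnt (u # h) (edge u v)" using x by metis
  have "{y. cnt (v # u # h) (edge y w) = 1} =
    (if cnt (u # h) (edge u v) = 0 then insert x ?A
     else if cnt (u # h) (edge u v) = 1 then ?A - {x} else ?A)"
    by (auto simp: x cx)
  moreover have "finite ?A" by (rule finite_cnt_eq_1)
  ultimately show "odeg (v # u # h) w =
    (if cnt (u # h) (edge u v) = 0 then odeg (u # h) w + 1
     else if cnt (u # h) (edge u v) = 1 then odeg (u # h) w - 1 else odeg (u # h) w)"
    by (auto simp: odeg_def cx card_insert_if)
  assume "cnt (u # h) (edge u v) = 1"
  then have "x \<in> ?A" by (simp add: cx)
  with \<open>finite ?A\<close> show "odeg (u # h) w \<ge> 1"
    by (auto simp: odeg_def Suc_le_eq card_gt_0_iff)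
qed

lemma psi_split:
  assumes "u \<noteq> v" "v \<in> set (u # h)" and hd: "hd g = c" and s: "set g = set (u # h)"
  shows "psi g = (odeg g u - (if u = c then 1 else 2)) + (odeg g v - (if v = c then 1 else 2))
    + (\<Sum>w\<in>set (u # h) - {u, v}. odeg g w - (if w = c then 1 else 2))"
  using assms unfolding psi_def
  by (subst sum.remove[of _ u], simp, simp, subst sum.remove[of _ v])
     (auto simp: Diff_insert2[symmetric] insert_commute)

text \<open>Only the terms at \<open>u\<close> and \<open>v\<close> change: leaving \<open>u\<close>
  raises its allowance from 1 to 2, arriving lowers that of \<open>v\<close> from 2 to 1. If the
  edge is opened, the extra edge at \<open>u\<close> balances its allowance, and the term of a
  visited \<open>v\<close> grows by at most 2. A return leaves the term of \<open>v\<close> as it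
  was and lowers that of \<open>u\<close> unless the return was forced. A third step changes no
  degree and raises only the term of \<open>v\<close>, by at most 1.\<close>

lemma psi_Cons:
  assumes uv: "u \<noteq> v"
  shows "psi (v # u # h) + of_bool (cnt (u # h) (edge u v) = 1 \<and> odeg (u # h) u \<noteq> 1)
    \<le> psi (u # h) + 2 * of_bool (v \<in> set (u # h) \<and> cnt (u # h) (edge u v) = 0)
        + of_bool (cnt (u # h) (edge u v) \<ge> 2)"
proof (cases "v \<in> set (u # h)")
  case True
  let ?R = "\<Sum>w\<in>set (u # h) - {u, v}. odeg (u # h) w - 2"
  have "psi (u # h) = (odeg (u # h) u - 1) + (odeg (u # h) v - 2) + ?R"
    using psi_split[OF uv True, of "u # h" u] uv by (auto intro!: sum.cong)
  moreover have "psi (v # u # h) = (odeg (v # u # h) u - 2) + (odeg (v # u # h) v - 1) + ?R"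
    using psi_split[OF uv True, of "v # u # h" v] True uv
    by (auto simp: odeg_Cons_other insert_absorb intro!: sum.cong)
  moreover have "(du' - 2) + (dv' - 1) + of_bool (c = 1 \<and> du \<noteq> 1)
      \<le> (du - 1) + (dv - 2) + 2 * of_bool (c = 0) + of_bool (c \<ge> 2)"
    if "du' = (if c = 0 then du + 1 else if c = 1 then du - 1 else du)"
      "dv' = (if c = 0 then dv + 1 else if c = 1 then dv - 1 else dv)"
      "c = 1 \<Longrightarrow> du \<ge> 1" "c = 1 \<Longrightarrow> dv \<ge> 1" for c du dv du' dv' :: nat
  proof -
    from that(3) have "c \<noteq> 1 \<or> du \<ge> 1" by blast
    then consider "c = 0" | "c = 1" "du = 1" | "c = 1" "du \<ge> 2" | "c \<ge> 2" by linarith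
    then show ?thesis using that(1,2,4) by cases auto
  qed
  from this[OF odeg_Cons_end(1)[OF uv, of u h] odeg_Cons_end(1)[OF uv, of v h]
      odeg_Cons_end(2)[OF uv, of u h] odeg_Cons_end(2)[OF uv, of v h]]
  have "(odeg (v # u # h) u - 2) + (odeg (v # u # h) v - 1)
      + of_bool (cnt (u # h) (edge u v) = 1 \<and> odeg (u # h) u \<noteq> 1)
    \<le> (odeg (u # h) u - 1) + (odeg (u # h) v - 2) + 2 * of_bool (cnt (u # h) (edge u v) = 0)
      + of_bool (cnt (u # h) (edge u v) \<ge> 2)"
    by simp
  ultimately show ?thesis using True by simp
next
  case False
  then have c: "cnt (u # h) (edge u v) = 0" by (rule cnt_notin)
  have "{x. cnt (u # h) (edge x v) = 1} = {}" using cnt_notin[OF False] by auto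
  then have ov: "odeg (u # h) v = 0" by (simp add: odeg_def)
  have "psi (v # u # h) = (odeg (v # u # h) v - 1) + (\<Sum>w\<in>set (u # h). odeg (v # u # h) w - (if w = v then 1 else 2))"
    unfolding psi_def using False by simp
  also have "(\<Sum>w\<in>set (u # h). odeg (v # u # h) w - (if w = v then 1 else 2)) = psi (u # h)"
    unfolding psi_def
  proof (intro sum.cong refl)
    fix w assume "w \<in> set (u # h)"
    then show "odeg (v # u # h) w - (if w = v then 1 else 2) =
        odeg (u # h) w - (if w = hd (u # h) then 1 else 2)"
      using False c odeg_Cons_end(1)[OF uv, of u h] odeg_Cons_other[of w u v h] by auto
  qed
  also have "odeg (v # u # h) v = 1" using odeg_Cons_end(1)[OF uv, of v h] c ov by simp
  finally show ?thesis using c by simp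
qed

text \<open>Multiplying by \<open>t ^ psi h\<close> makes the sum over the next step small: a return with a choice
  lowers the potential and so costs a factor $1/t$, whereas the cyclic and third steps, which raise
  the potential by at most 2 and 1, carry the small factors $\beta$ and $\kappa$. Only new steps
  and forced returns remain, each of total weight at most 1.\<close>

definition wt :: "real \<Rightarrow> real \<Rightarrow> real \<Rightarrow> real \<Rightarrow> nat list \<Rightarrow> nat \<Rightarrow> real" where
  "wt N \<beta> \<kappa> t h v =
    (if v = hd h then 0 else if v \<notin> set h then 1 / N
     else if cnt h (edge (hd h) v) = 0 then \<beta> * t\<^sup>2
     else if cnt h (edge (hd h) v) = 1 then (if odeg h (hd h) = 1 then 1 else 1 / t)
     else \<kappa> * t)"

fun WT :: "real \<Rightarrow> real \<Rightarrow> real \<Rightarrow> real \<Rightarrow> nat list \<Rightarrow> real" where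
  "WT N \<beta> \<kappa> t (v # u # h) = WT N \<beta> \<kappa> t (u # h) * wt N \<beta> \<kappa> t (u # h) v"
| "WT N \<beta> \<kappa> t _ = 1"

lemma wt_nonneg: "N > 0 \<Longrightarrow> \<beta> \<ge> 0 \<Longrightarrow> \<kappa> \<ge> 0 \<Longrightarrow> t \<ge> 1 \<Longrightarrow> 0 \<le> wt N \<beta> \<kappa> t h v"
  by (simp add: wt_def)

lemma WT_nonneg: "N > 0 \<Longrightarrow> \<beta> \<ge> 0 \<Longrightarrow> \<kappa> \<ge> 0 \<Longrightarrow> t \<ge> 1 \<Longrightarrow> 0 \<le> WT N \<beta> \<kappa> t h"
  by (induction N \<beta> \<kappa> t h rule: WT.induct) (auto simp: wt_nonneg)

text \<open>Telescoping: the power of \<open>t\<close> in each case of \<open>wt\<close> is the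
  largest change of the potential that \<open>psi_Cons\<close> allows for that kind of step, and the
  potential starts at 0.\<close>

lemma WT_lower:
  assumes "N > 0" "\<beta> \<ge> 0" "\<kappa> \<ge> 0" "t \<ge> 1" "loopfree h"
  shows "(1 / N) ^ newc h * \<beta> ^ cycc h * \<kappa> ^ thirdc h * t ^ psi h \<le> WT N \<beta> \<kappa> t h"
  using assms
proof (induction N \<beta> \<kappa> t h rule: WT.induct)
  case (1 N \<beta> \<kappa> t v u h)
  let ?g = "u # h"
  let ?L = "\<lambda>g. (1 / N) ^ newc g * \<beta> ^ cycc g * \<kappa> ^ thirdc g"
  have uv: "u \<noteq> v" and IH: "?L ?g * t ^ psi ?g \<le> WT N \<beta> \<kappa> t ?g" using 1 by auto
  have L0: "0 \<le> ?L ?g" using 1 by simp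
  have key: "?L (v # ?g) * t ^ psi (v # ?g) \<le> ?L ?g * t ^ psi ?g * wt N \<beta> \<kappa> t ?g v"
  proof -
    note p = psi_Cons[OF uv, of h]
    have mono: "t ^ a \<le> t ^ b" if "a \<le> b" for a b using that \<open>t \<ge> 1\<close> by (rule power_increasing)
    consider (new) "v \<notin> set ?g" | (cyc) "v \<in> set ?g" "cnt ?g (edge u v) = 0"
      | (ret) "v \<in> set ?g" "cnt ?g (edge u v) = 1" "odeg ?g u = 1"
      | (amb) "v \<in> set ?g" "cnt ?g (edge u v) = 1" "odeg ?g u \<noteq> 1"
      | (thr) "v \<in> set ?g" "cnt ?g (edge u v) \<ge> 2"
      by linarith
    then show ?thesis
    proof cases
      case new
      then have "psi (v # ?g) \<le> psi ?g" using p cnt_notin[OF new, of u] by simp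
      from mono[OF this] L0 1 new cnt_notin[OF new, of u] show ?thesis
        by (auto simp: wt_def mult_left_mono divide_right_mono)
    next
      case cyc
      then have "psi (v # ?g) \<le> psi ?g + 2" using p by simp
      from mono[OF this] have "t ^ psi (v # ?g) \<le> t ^ psi ?g * t\<^sup>2" by (simp add: power_add power2_eq_square mult_ac)
      then have "?L ?g * \<beta> * t ^ psi (v # ?g) \<le> ?L ?g * \<beta> * (t ^ psi ?g * t\<^sup>2)"
        using L0 1 by (intro mult_left_mono) auto
      then show ?thesis using cyc uv by (auto simp: wt_def algebra_simps)
    next
      case ret
      then have "psi (v # ?g) \<le> psi ?g" using p by simp
      from mono[OF this] L0 ret uv show ?thesis by (auto simp: wt_def mult_left_mono)
    next
      case amb
      then have "Suc (psi (v # ?g)) \<le> psi ?g" using p by simp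
      from mono[OF this] have "t ^ psi (v # ?g) \<le> t ^ psi ?g / t"
        using 1 by (simp add: field_simps)
      from mult_left_mono[OF this L0] amb uv show ?thesis by (auto simp: wt_def)
    next
      case thr
      then have "psi (v # ?g) \<le> psi ?g + 1" using p by simp
      from mono[OF this] have "t ^ psi (v # ?g) \<le> t ^ psi ?g * t" by (simp add: mult.commute)
      then have "?L ?g * \<kappa> * t ^ psi (v # ?g) \<le> ?L ?g * \<kappa> * (t ^ psi ?g * t)"
        using L0 1 by (intro mult_left_mono) auto
      then show ?thesis using thr uv by (auto simp: wt_def algebra_simps)
    qed
  qed
  also have "\<dots> \<le> WT N \<beta> \<kappa> t ?g * wt N \<beta> \<kappa> t ?g v"
    using IH 1 by (intro mult_right_mono wt_nonneg) auto
  finally show ?case by simp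
qed (simp_all add: psi_def odeg_def)

text \<open>There are two sources of mass 1: at most \<open>N\<close> new vertices of weight
  \<open>1 / N\<close>, and a single forced return. All exceptional weights sit on the at most
  \<open>m\<close> visited vertices.\<close>

lemma sum_wt_le:
  assumes "N > 0" "\<beta> \<ge> 0" "\<kappa> \<ge> 0" "t \<ge> 1" "finite V" "real (card V) \<le> N" "length h \<le> m"
  shows "(\<Sum>v\<in>V. wt N \<beta> \<kappa> t h v) \<le> 2 + real m * (\<beta> * t\<^sup>2 + 1 / t + \<kappa> * t)"
proof -
  let ?D = "\<beta> * t\<^sup>2 + 1 / t + \<kappa> * t"
  let ?P = "\<lambda>v. cnt h (edge (hd h) v) = 1 \<and> odeg h (hd h) = 1"
  have D0: "0 \<le> ?D" using assms by simp
  have "(\<Sum>v\<in>V. wt N \<beta> \<kappa> t h v) \<le> (\<Sum>v\<in>V. 1 / N + of_bool (v \<in> set h) * ?D + of_bool (?P v))"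
  proof (rule sum_mono)
    fix v
    have "\<beta> * t\<^sup>2 \<le> ?D" "1 / t \<le> ?D" "\<kappa> * t \<le> ?D" "0 \<le> 1 / N" using assms by auto
    then show "wt N \<beta> \<kappa> t h v \<le> 1 / N + of_bool (v \<in> set h) * ?D + of_bool (?P v)"
      using D0 by (auto simp: wt_def)
  qed
  also have "\<dots> = real (card V) / N + real (card (V \<inter> set h)) * ?D + real (card {v \<in> V. ?P v})"
    using assms(5) by (simp add: sum.distrib sum_distrib_right[symmetric] Int_def)
  also have "\<dots> \<le> 1 + real m * ?D + 1"
  proof (intro add_mono mult_right_mono D0)
    show "real (card V) / N \<le> 1" using assms by simp
    have "card (V \<inter> set h) \<le> card (set h)" by (intro card_mono) auto
    also have "\<dots> \<le> length h" by (rule card_length)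
    finally show "real (card (V \<inter> set h)) \<le> real m" using assms by linarith
    show "real (card {v \<in> V. ?P v}) \<le> 1"
    proof (cases "odeg h (hd h) = 1")
      case True
      have "card {v \<in> V. ?P v} \<le> odeg h (hd h)"
        unfolding odeg_def by (intro card_mono finite_cnt_eq_1) (auto simp: edge_commute)
      with True show ?thesis by simp
    qed simp
  qed
  finally show ?thesis by simp
qed

text \<open>The vertex at time \<open>i\<close> ranges over \<open>V i\<close>. Time-dependent sets
  make it possible to pin a walk to its root at chosen times.\<close>

fun walks :: "(nat \<Rightarrow> nat set) \<Rightarrow> nat \<Rightarrow> nat \<Rightarrow> nat list set" where
  "walks V r 0 = {[r]}"
| "walks V r (Suc m) = (\<lambda>(h, v). v # h) ` (walks V r m \<times> V (Suc m))"

lemma sum_walks_Suc: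
  "(\<Sum>h\<in>walks V r (Suc m). f h) = (\<Sum>h\<in>walks V r m. \<Sum>v\<in>V (Suc m). f (v # h))"
  by (simp add: sum.reindex inj_on_def sum.cartesian_product case_prod_beta)

lemma finite_walks: "(\<And>i. finite (V i)) \<Longrightarrow> finite (walks V r m)"
  by (induction m) auto

lemma walks_basic:
  assumes "h \<in> walks V r m"
  shows "length h = m + 1" "h \<noteq> []" "last h = r" "r \<in> set h"
proof -
  have "length h = m + 1 \<and> last h = r \<and> h \<noteq> []"
    using assms by (induction m arbitrary: h) fastforce+
  then show "length h = m + 1" "last h = r" "h \<noteq> []" by auto
  then show "r \<in> set h" using last_in_set by blast
qed

lemma walks_subset:
  assumes "h \<in> walks V r m" "\<And>i. V i \<subseteq> A" "r \<in> A"
  shows "set h \<subseteq> A"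
  using assms(1)
proof (induction m arbitrary: h)
  case (Suc m)
  then obtain g v where "h = v # g" "g \<in> walks V r m" "v \<in> V (Suc m)" by auto
  with Suc.IH assms(2) show ?case by auto
qed (use assms(3) in simp)

lemma sum_WT_le:
  assumes p: "N > 0" "\<beta> \<ge> 0" "\<kappa> \<ge> 0" "t \<ge> 1"
    and V: "\<And>i. finite (V i)" "\<And>i. real (card (V i)) \<le> N" and "k \<le> m"
  shows "(\<Sum>h\<in>walks V r k. WT N \<beta> \<kappa> t h) \<le> (2 + real m * (\<beta> * t\<^sup>2 + 1 / t + \<kappa> * t)) ^ k"
  using \<open>k \<le> m\<close>
proof (induction k)
  case (Suc k)
  let ?B = "2 + real m * (\<beta> * t\<^sup>2 + 1 / t + \<kappa> * t)"
  have B: "0 \<le> ?B" using p by simp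
  have "(\<Sum>h\<in>walks V r (Suc k). WT N \<beta> \<kappa> t h)
      = (\<Sum>h\<in>walks V r k. WT N \<beta> \<kappa> t h * (\<Sum>v\<in>V (Suc k). wt N \<beta> \<kappa> t h v))"
    unfolding sum_walks_Suc sum_distrib_left
  proof (intro sum.cong refl)
    fix h v assume "h \<in> walks V r k"
    then obtain u g where "h = u # g" using walks_basic(2) by (cases h) auto
    then show "WT N \<beta> \<kappa> t (v # h) = WT N \<beta> \<kappa> t h * wt N \<beta> \<kappa> t h v" by simp
  qed
  also have "\<dots> \<le> (\<Sum>h\<in>walks V r k. WT N \<beta> \<kappa> t h * ?B)"
    using p V Suc.prems by (intro sum_mono mult_left_mono sum_wt_le WT_nonneg) (auto simp: walks_basic)
  also have "\<dots> \<le> ?B ^ k * ?B"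
    unfolding sum_distrib_right[symmetric] using Suc B by (intro mult_right_mono) auto
  finally show ?case by (simp add: mult.commute)
qed simp

text \<open>The potential serves only to make the sum over the next step small; at the end it is
  discarded, since \<open>t \<ge> 1\<close>.\<close>

lemma sum_walks_le:
  assumes p: "N > 0" "\<beta> \<ge> 0" "\<kappa> \<ge> 0" "t \<ge> 1"
    and V: "\<And>i. finite (V i)" "\<And>i. real (card (V i)) \<le> N"
  shows "(\<Sum>h | h \<in> walks V r m \<and> loopfree h. (1 / N) ^ newc h * \<beta> ^ cycc h * \<kappa> ^ thirdc h)
    \<le> (2 + real m * (\<beta> * t\<^sup>2 + 1 / t + \<kappa> * t)) ^ m"
proof -
  have "(\<Sum>h | h \<in> walks V r m \<and> loopfree h. (1 / N) ^ newc h * \<beta> ^ cycc h * \<kappa> ^ thirdc h)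
      \<le> (\<Sum>h | h \<in> walks V r m \<and> loopfree h. WT N \<beta> \<kappa> t h)"
  proof (rule sum_mono)
    fix h assume h: "h \<in> {h. h \<in> walks V r m \<and> loopfree h}"
    have "1 \<le> t ^ psi h" using p by simp
    then have "(1 / N) ^ newc h * \<beta> ^ cycc h * \<kappa> ^ thirdc h * 1
        \<le> (1 / N) ^ newc h * \<beta> ^ cycc h * \<kappa> ^ thirdc h * t ^ psi h"
      using p by (intro mult_left_mono) auto
    also have "\<dots> \<le> WT N \<beta> \<kappa> t h" using h p by (intro WT_lower) auto
    finally show "(1 / N) ^ newc h * \<beta> ^ cycc h * \<kappa> ^ thirdc h \<le> WT N \<beta> \<kappa> t h" by simp
  qed
  also have "\<dots> \<le> (\<Sum>h\<in>walks V r m. WT N \<beta> \<kappa> t h)"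
    using p V by (intro sum_mono2 finite_walks WT_nonneg) auto
  also have "\<dots> \<le> (2 + real m * (\<beta> * t\<^sup>2 + 1 / t + \<kappa> * t)) ^ m"
    using p V by (intro sum_WT_le) auto
  finally show ?thesis .
qed

text \<open>Each cyclic or third step can afford an extra factor $\eta$, which is gained once.\<close>

lemma sum_bad_walks_le:
  assumes p: "N > 0" "\<kappa> \<ge> 0" "t \<ge> 1" "0 < \<eta>" "\<eta> \<le> 1"
    and V: "\<And>i. finite (V i)" "\<And>i. real (card (V i)) \<le> N"
  shows "(\<Sum>h | h \<in> walks V r m \<and> loopfree h \<and> cycc h + thirdc h \<ge> 1.
      (1 / N) ^ (newc h + cycc h) * \<kappa> ^ thirdc h)
    \<le> \<eta> * (2 + real m * (t\<^sup>2 / (N * \<eta>) + 1 / t + \<kappa> * t / \<eta>)) ^ m"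
proof -
  let ?f = "\<lambda>h. (1 / N) ^ newc h * (1 / (N * \<eta>)) ^ cycc h * (\<kappa> / \<eta>) ^ thirdc h"
  have f0: "0 \<le> ?f h" for h
    using p by (intro mult_nonneg_nonneg zero_le_power divide_nonneg_nonneg) simp_all
  have "(\<Sum>h | h \<in> walks V r m \<and> loopfree h \<and> cycc h + thirdc h \<ge> 1.
      (1 / N) ^ (newc h + cycc h) * \<kappa> ^ thirdc h)
    \<le> (\<Sum>h | h \<in> walks V r m \<and> loopfree h \<and> cycc h + thirdc h \<ge> 1. \<eta> * ?f h)"
  proof (rule sum_mono)
    fix h assume h: "h \<in> {h. h \<in> walks V r m \<and> loopfree h \<and> cycc h + thirdc h \<ge> 1}"
    have "1 / (N * \<eta>) * \<eta> = 1 / N" "\<kappa> / \<eta> * \<eta> = \<kappa>" using p by simp_all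
    then have e: "(1 / N) ^ b = (1 / (N * \<eta>)) ^ b * \<eta> ^ b" "\<kappa> ^ b = (\<kappa> / \<eta>) ^ b * \<eta> ^ b" for b
      by (simp_all only: power_mult_distrib[symmetric])
    have "(1 / N) ^ (newc h + cycc h) * \<kappa> ^ thirdc h = ?f h * \<eta> ^ (cycc h + thirdc h)"
      unfolding power_add e(1)[of "cycc h"] e(2)[of "thirdc h"] by (simp only: mult_ac)
    also have "\<dots> \<le> ?f h * \<eta> ^ 1"
      using h p f0[of h] by (intro mult_left_mono power_decreasing) simp_all
    finally show "(1 / N) ^ (newc h + cycc h) * \<kappa> ^ thirdc h \<le> \<eta> * ?f h"
      by (simp only: power_one_right mult.commute[of \<eta>])
  qed
  also have "\<dots> \<le> (\<Sum>h | h \<in> walks V r m \<and> loopfree h. \<eta> * ?f h)"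
  proof (rule sum_mono2)
    show "finite {h. h \<in> walks V r m \<and> loopfree h}" using finite_walks[of V r m] V(1) by simp
    show "0 \<le> \<eta> * ?f h" for h by (rule mult_nonneg_nonneg[OF less_imp_le[OF p(4)] f0])
  qed blast
  also have "\<dots> \<le> \<eta> * (2 + real m * (1 / (N * \<eta>) * t\<^sup>2 + 1 / t + \<kappa> / \<eta> * t)) ^ m"
    unfolding sum_distrib_left[symmetric]
    using p V by (intro mult_left_mono sum_walks_le) simp_all
  finally show ?thesis by (simp only: times_divide_eq_left mult_1_left)
qed

section \<open>Multiplicities of edges\<close>

definition edges :: "nat list \<Rightarrow> (nat \<times> nat) set" where
  "edges h = {e. cnt h e \<ge> 1}"

lemma edges_Cons: "edges (v # u # h) = insert (edge u v) (edges (u # h))"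
  by (auto simp: edges_def)

lemma finite_edges: "finite (edges h)"
  by (induction h rule: newc.induct) (simp_all add: edges_Cons, simp_all add: edges_def)

lemma card_edges: "card (edges h) = newc h + cycc h"
proof (induction h rule: newc.induct)
  case (1 v u h)
  have "edge u v \<in> edges (u # h) \<longleftrightarrow> cnt (u # h) (edge u v) \<noteq> 0" by (auto simp: edges_def)
  then show ?case
    using 1 cnt_notin[of v "u # h" u] by (auto simp: edges_Cons card_insert_if finite_edges)
qed (simp_all add: edges_def)

lemma sum_cnt_edges:
  "finite A \<Longrightarrow> edges h \<subseteq> A \<Longrightarrow> (\<Sum>e\<in>A. cnt h e) = length h - 1"
proof (induction h rule: newc.induct)
  case (1 v u h)
  then have "edge u v \<in> A" by (simp add: edges_Cons)
  then have "(\<Sum>e\<in>A. of_bool (edge u v = e) :: nat) = 1"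
    using 1 by (simp add: of_bool_def sum.delta')
  then show ?case using 1 by (simp add: edges_Cons sum.distrib)
qed simp_all

lemma sum_cnt_minus_2:
  assumes "\<And>e. e \<in> edges h \<Longrightarrow> cnt h e \<ge> 2"
  shows "(\<Sum>e\<in>edges h. cnt h e - 2) = length h - 1 - 2 * (newc h + cycc h)"
  using assms by (subst sum_subtractf_nat) (simp_all add: sum_cnt_edges finite_edges card_edges)

lemma finite_cnt_ge_2: "finite {e. cnt h e \<ge> 2}"
  by (rule finite_subset[OF _ finite_edges[of h]]) (auto simp: edges_def)

text \<open>Each step is the first, the second or a later traversal of its edge. First traversals
  are the new and cyclic steps, and second traversals correspond to the edges used at least
  twice.\<close>

lemma length_walk_eq: "length h - 1 = newc h + cycc h + card {e. cnt h e \<ge> 2} + thirdc h"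
proof (induction h rule: newc.induct)
  case (1 v u h)
  let ?A = "\<lambda>g. {e. cnt g e \<ge> 2}"
  let ?e = "edge u v"
  have A: "?A (v # u # h) = (if cnt (u # h) ?e \<ge> 1 then insert ?e (?A (u # h)) else ?A (u # h))"
  proof (rule Set.set_eqI)
    fix e
    show "e \<in> ?A (v # u # h) \<longleftrightarrow>
        e \<in> (if cnt (u # h) ?e \<ge> 1 then insert ?e (?A (u # h)) else ?A (u # h))"
      by (cases "e = ?e"; cases "cnt (u # h) ?e \<ge> 1") simp_all
  qed
  have "card (?A (v # u # h)) = card (?A (u # h)) + of_bool (cnt (u # h) ?e = 1)"
  proof (cases "cnt (u # h) ?e \<ge> 1")
    case True
    then show ?thesis unfolding A by (simp add: card_insert_if finite_cnt_ge_2)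
  next
    case False
    then have c: "cnt (u # h) ?e = 0" by linarith
    show ?thesis unfolding A[unfolded if_not_P[OF False]] c by simp
  qed
  moreover have "of_bool (v \<notin> set (u # h)) + of_bool (v \<in> set (u # h) \<and> cnt (u # h) ?e = 0)
      + of_bool (cnt (u # h) ?e = 1) + of_bool (cnt (u # h) ?e \<ge> 2) = (1 :: nat)"
    using cnt_notin[of v "u # h" u] by (cases "v \<in> set (u # h)") auto
  ultimately show ?case using "1.IH" by simp
qed simp_all

lemma thirdc_eq:
  assumes "\<And>e. e \<in> edges h \<Longrightarrow> cnt h e \<ge> 2"
  shows "length h - 1 = 2 * (newc h + cycc h) + thirdc h"
proof -
  have "{e. cnt h e \<ge> 2} = edges h" using assms by (force simp: edges_def)
  then show ?thesis using length_walk_eq[of h] by (simp add: card_edges)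
qed

section \<open>Tree-like walks\<close>

text \<open>A walk is tree-like if every step either visits a new vertex or returns along the edge by
  which the current vertex was first reached; the stack is the path of edges not yet retraced.
  The value \<open>[]\<close> marks walks that are not tree-like.\<close>

fun stk :: "nat list \<Rightarrow> nat list" where
  "stk (v # u # h) = (let s = stk (u # h) in
     if s = [] then [] else if v \<notin> set (u # h) then v # s
     else if tl s \<noteq> [] \<and> hd (tl s) = v then tl s else [])"
| "stk h = h"

text \<open>One joint invariant, since its parts feed each other: the open edges are exactly those
  of the stack. So a pop closes an edge by its second traversal and a push opens a fresh one; cyclic
  and third steps cannot occur, and the lengths of walk and stack determine the number of new
  vertices.\<close>

lemma stk_props:
  assumes "stk h \<noteq> []"
  shows "hd (stk h) = hd h \<and> last (stk h) = last h \<and> distinct (stk h) \<and> set (stk h) \<subseteq> set h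
    \<and> loopfree h \<and> 2 * newc h + 2 = length h + length (stk h) \<and> cycc h = 0 \<and> thirdc h = 0
    \<and> (\<forall>e. cnt h e \<le> 2 \<and> cnt (stk h) e = of_bool (cnt h e = 1))"
  using assms
proof (induction h rule: newc.induct)
  case (1 v u h)
  define s where "s = stk (u # h)"
  have s0: "s \<noteq> []" using "1.prems" by (auto simp: s_def Let_def split: if_splits)
  note IH = "1.IH"[folded s_def, OF s0]
  then obtain s' where s': "s = u # s'" using s0 by (cases s) auto
  have st: "stk (v # u # h) = (if v \<notin> set (u # h) then v # s
     else if tl s \<noteq> [] \<and> hd (tl s) = v then tl s else [])"
    using s0 by (simp add: s_def[symmetric] Let_def)
  have IHc: "cnt (u # h) e \<le> 2" "cnt s e = of_bool (cnt (u # h) e = 1)" for e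
    using IH by blast+
  show ?case
  proof (cases "v \<in> set (u # h)")
    case False
    then have e: "stk (v # u # h) = v # s" using st by simp
    have c: "cnt (u # h) (edge u v) = 0" using False by (rule cnt_notin)
    have "cnt (v # u # h) e \<le> 2 \<and> cnt (v # s) e = of_bool (cnt (v # u # h) e = 1)" for e
      using IHc[of e] c by (cases "e = edge u v") (auto simp: s')
    then show ?thesis unfolding e using IH False c s0 by (auto simp del: split_paired_All)
  next
    case True
    with st "1.prems" have t: "tl s \<noteq> []" "hd (tl s) = v" by (auto split: if_splits)
    then obtain s'' where s'': "s = u # v # s''" using s' by (cases s') auto
    have e: "stk (v # u # h) = v # s''" using st True t s'' by simp
    have uv: "u \<noteq> v" using IH s'' by auto
    have c: "cnt (u # h) (edge u v) = 1" "cnt (v # s'') (edge u v) = 0"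
      using IHc(2)[of "edge u v"]
      by (cases "cnt (u # h) (edge u v) = 1"; simp add: s'' edge_commute[of v u])+
    have "cnt (v # u # h) e \<le> 2 \<and> cnt (v # s'') e = of_bool (cnt (v # u # h) e = 1)" for e
    proof (cases "e = edge u v")
      case False
      then have "edge v u \<noteq> e" by (auto simp: edge_commute)
      with False show ?thesis using IHc[of e] by (auto simp: s'')
    qed (use c in simp)
    then show ?thesis unfolding e using IH True c uv s'' by (auto simp del: split_paired_All)
  qed
qed auto

text \<open>At the step where the stack breaks, the current vertex is the top of a valid stack and
  the next vertex is an old one. If the edge used were open, it would lie on the stack; as the stack
  is distinct, the only stack edge at its top is the topmost, so the step would have been a legal
  return.\<close>

lemma bad_walk:
  assumes "h \<noteq> []" "loopfree h" "stk h = []"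
  shows "cycc h + thirdc h \<ge> 1"
  using assms
proof (induction h rule: newc.induct)
  case (1 v u h)
  define s where "s = stk (u # h)"
  show ?case
  proof (cases "s = []")
    case True
    then have "cycc (u # h) + thirdc (u # h) \<ge> 1" using 1 by (auto simp: s_def)
    then show ?thesis by simp
  next
    case False
    note P = stk_props[of "u # h", folded s_def, OF False]
    then obtain s' where s': "s = u # s'" using False by (cases s) auto
    have v: "v \<in> set (u # h)" "\<not> (tl s \<noteq> [] \<and> hd (tl s) = v)"
      using "1.prems"(3) False by (auto simp: s_def[symmetric] Let_def split: if_splits)
    have "cnt (u # h) (edge u v) \<noteq> 1"
    proof
      assume "cnt (u # h) (edge u v) = 1"
      then have c: "cnt s (edge u v) = 1" using P by (simp del: split_paired_All)
      then obtain w s'' where w: "s' = w # s''" using s' by (cases s') auto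
      have "w \<noteq> v" using v(2) s' w by simp
      then have "edge w u \<noteq> edge u v" by (auto simp: edge_eq_iff)
      then have "cnt (w # s'') (edge u v) = 1" using c s' w by simp
      then have "u \<in> set (w # s'')" using cnt_pos_mem[of "w # s''" u v] by simp
      then show False using P s' w by simp
    qed
    then consider "cnt (u # h) (edge u v) = 0" | "cnt (u # h) (edge u v) \<ge> 2" by linarith
    then show ?thesis using v(1) by cases auto
  qed
qed simp_all

text \<open>The weights of the walks of length $m$ from 0 to $l$ on the half line that are at 0 at every
  time in $T$; these count the tree-like walks by the height of their stack.\<close>

fun jw :: "nat set \<Rightarrow> nat \<Rightarrow> nat \<Rightarrow> real" where
  "jw T 0 l = of_bool (l = 0)"
| "jw T (Suc m) l = (if Suc m \<in> T \<and> l \<noteq> 0 then 0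
     else (if l = 0 then 0 else jw T m (l - 1)) + jw T m (Suc l))"

lemma jw_nonneg: "0 \<le> jw T m l"
  by (induction m arbitrary: l) auto

text \<open>The factor \<open>1 / n\<close> per new vertex cancels the nearly \<open>n\<close>
  choices for it, so that all tree-like walks with the same stack heights together weigh about 1.
  The final height is \<open>l\<close>.\<close>

definition good_sum :: "nat set \<Rightarrow> nat \<Rightarrow> nat \<Rightarrow> nat \<Rightarrow> nat \<Rightarrow> real" where
  "good_sum T n r m l = (\<Sum>h\<in>walks (\<lambda>i. if i \<in> T then {r} else {1..n}) r m.
     of_bool (stk h \<noteq> [] \<and> length (stk h) = Suc l) * (1 / real n) ^ newc h)"

text \<open>The stack rises by any unvisited vertex and falls in exactly one way. At a pinned time
  the next vertex is the root, the bottom of the stack, which is a legal return only from height 1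
  to height 0.\<close>

lemma sum_good_steps:
  fixes l :: nat
  assumes h: "h \<noteq> []" "set h \<subseteq> {1..n}" "last h = r" and n: "n \<ge> 1"
  defines "f \<equiv> \<lambda>v. of_bool (stk (v # h) \<noteq> [] \<and> length (stk (v # h)) = Suc l) * (1 / real n) ^ newc (v # h)"
  shows "(\<Sum>v\<in>{1..n}. f v) = of_bool (stk h \<noteq> []) * (1 / real n) ^ newc h *
      (of_bool (length (stk h) = l) * (real n - real (card (set h))) / real n
       + of_bool (length (stk h) = Suc (Suc l)))" (is ?A)
    and "f r = of_bool (stk h \<noteq> []) * (1 / real n) ^ newc h * of_bool (l = 0 \<and> length (stk h) = 2)" (is ?B)
proof -
  obtain u g where ug: "h = u # g" using h(1) by (cases h) auto
  define s where "s = stk h"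
  have st: "stk (v # h) = (if s = [] then [] else if v \<notin> set h then v # s
     else if tl s \<noteq> [] \<and> hd (tl s) = v then tl s else [])" for v
    by (simp add: s_def ug Let_def)
  have nc: "newc (v # h) = of_bool (v \<notin> set h) + newc h" for v by (simp add: ug)
  have "?A \<and> ?B"
  proof (cases "s = []")
    case True
    then show ?thesis by (simp add: f_def st s_def[symmetric])
  next
    case False
    note P = stk_props[OF False[unfolded s_def], folded s_def]
    have f1: "f v = of_bool (length s = l) * (1 / real n) ^ newc h * (1 / real n)" if "v \<notin> set h" for v
      using that False by (simp add: f_def st nc)
    have f2: "f v = of_bool (length s = Suc (Suc l)) * of_bool (v = hd (tl s)) * (1 / real n) ^ newc h"
      if "v \<in> set h" for v
      using that False by (cases s; cases "tl s") (auto simp: f_def st nc)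
    have mem: "length s = Suc (Suc l) \<Longrightarrow> hd (tl s) \<in> set h"
      using P by (cases s; cases "tl s") auto
    have "(\<Sum>v\<in>{1..n}. f v) = (\<Sum>v\<in>{1..n} - set h. f v) + (\<Sum>v\<in>set h. f v)"
      using h(2) by (intro sum.subset_diff) auto
    also have "(\<Sum>v\<in>{1..n} - set h. f v) =
        of_bool (length s = l) * (1 / real n) ^ newc h * ((real n - real (card (set h))) / real n)"
    proof -
      have "card (set h) \<le> n" using card_mono[OF _ h(2)] by simp
      then have "real (card ({1..n} - set h)) = real n - real (card (set h))"
        using h(2) by (simp add: card_Diff_subset)
      then show ?thesis by (simp add: f1)
    qed
    also have "(\<Sum>v\<in>set h. f v) = of_bool (length s = Suc (Suc l)) * (1 / real n) ^ newc h"
    proof -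
      have "(\<Sum>v\<in>set h. f v) = (\<Sum>v\<in>set h. if v = hd (tl s)
          then of_bool (length s = Suc (Suc l)) * (1 / real n) ^ newc h else 0)"
        by (intro sum.cong refl) (simp add: f2)
      also have "\<dots> = (if hd (tl s) \<in> set h then of_bool (length s = Suc (Suc l)) * (1 / real n) ^ newc h else 0)"
        by (rule sum.delta) simp
      finally show ?thesis using mem by auto
    qed
    finally have A: ?A using False by (simp add: s_def[symmetric] algebra_simps)
    have r: "r \<in> set h" using h(1,3) last_in_set by blast
    \<comment> \<open>The stack is distinct with last element \<open>r\<close>, so \<open>r\<close>
      can be the second element only in a stack of length 2.\<close>
    have "(length s = Suc (Suc l) \<and> r = hd (tl s)) \<longleftrightarrow> (l = 0 \<and> length s = 2)"
    proof (cases "length s \<ge> 2")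
      case True
      then obtain a b s' where s: "s = a # b # s'" by (cases s; cases "tl s") auto
      have "last (b # s') = r" "distinct (b # s')" using P h(3) s by auto
      then have "r = b \<longleftrightarrow> s' = []" by (cases s' rule: rev_cases) auto
      then show ?thesis using s by auto
    qed auto
    then have ?B using f2[OF r] False by (simp add: s_def[symmetric] of_bool_conj[symmetric])
    with A show ?thesis by blast
  qed
  then show ?A ?B by blast+
qed

text \<open>The recursions of \<open>good_sum\<close> and \<open>jw\<close> differ only in rising
  steps, where the already visited vertices, at most \<open>M\<close> in number, are missing among
  the \<open>n\<close> choices.\<close>

lemma good_sum_bounds:
  assumes r: "r \<in> {1..n}" and M: "M \<le> n" and "m \<le> M"
  shows "(1 - real M / real n) ^ m * jw T m l \<le> good_sum T n r m l \<and> good_sum T n r m l \<le> jw T m l"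
  using \<open>m \<le> M\<close>
proof (induction m arbitrary: l)
  case 0
  show ?case by (simp add: good_sum_def)
next
  case (Suc m)
  let ?V = "\<lambda>i. if i \<in> T then {r} else {1..n}"
  let ?q = "1 - real M / real n"
  have n: "n \<ge> 1" using r by simp
  have q: "0 \<le> ?q" "?q \<le> 1" using M n by (auto simp: field_simps)
  have h: "h \<noteq> []" "set h \<subseteq> {1..n}" "last h = r" "card (set h) \<le> M" if "h \<in> walks ?V r m" for h
  proof -
    show "h \<noteq> []" "last h = r" using walks_basic[OF that] by auto
    show "set h \<subseteq> {1..n}" by (rule walks_subset[OF that]) (use r in auto)
    show "card (set h) \<le> M"
      using card_length[of h] walks_basic(1)[OF that] Suc.prems by linarith
  qed
  note IH = Suc.IH[OF Suc_leD[OF Suc.prems]]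
  let ?p = "\<lambda>h. of_bool (stk h \<noteq> []) * (1 / real n) ^ newc h"
  show ?case
  proof (cases "Suc m \<in> T")
    case True
    have "good_sum T n r (Suc m) l = (\<Sum>h\<in>walks ?V r m. ?p h * of_bool (l = 0 \<and> length (stk h) = 2))"
      unfolding good_sum_def sum_walks_Suc
    proof (intro sum.cong refl)
      fix h assume "h \<in> walks ?V r m"
      note g = sum_good_steps(2)[OF h(1-3)[OF this] n, of l]
      have V: "?V (Suc m) = {r}" using True by simp
      have sing: "sum f {r} = f r" for f :: "nat \<Rightarrow> real" by simp
      show "(\<Sum>v\<in>?V (Suc m). of_bool (stk (v # h) \<noteq> [] \<and> length (stk (v # h)) = Suc l) * (1 / real n) ^ newc (v # h))
        = ?p h * of_bool (l = 0 \<and> length (stk h) = 2)" unfolding V sing by (rule g)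
    qed
    also have "\<dots> = of_bool (l = 0) * good_sum T n r m 1"
      unfolding good_sum_def sum_distrib_left by (intro sum.cong refl) (auto simp: numeral_2_eq_2)
    finally have g: "good_sum T n r (Suc m) l = of_bool (l = 0) * good_sum T n r m 1" .
    have "?q ^ Suc m * jw T m 1 \<le> ?q ^ m * jw T m 1"
      using q by (intro mult_right_mono jw_nonneg power_decreasing) auto
    with IH[of 1] g True show ?thesis by auto
  next
    case False
    define A where "A = (\<Sum>h\<in>walks ?V r m. ?p h * (of_bool (length (stk h) = l) * ((real n - real (card (set h))) / real n)))"
    have "good_sum T n r (Suc m) l = (\<Sum>h\<in>walks ?V r m. ?p h *
       (of_bool (length (stk h) = l) * (real n - real (card (set h))) / real n
       + of_bool (length (stk h) = Suc (Suc l))))"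
      unfolding good_sum_def sum_walks_Suc
    proof (intro sum.cong refl)
      fix h assume "h \<in> walks ?V r m"
      note g = sum_good_steps(1)[OF h(1-3)[OF this] n, of l]
      have V: "?V (Suc m) = {1..n}" using False by simp
      show "(\<Sum>v\<in>?V (Suc m). of_bool (stk (v # h) \<noteq> [] \<and> length (stk (v # h)) = Suc l) * (1 / real n) ^ newc (v # h))
        = ?p h * (of_bool (length (stk h) = l) * (real n - real (card (set h))) / real n
       + of_bool (length (stk h) = Suc (Suc l)))" unfolding V by (rule g)
    qed
    also have "\<dots> = A + (\<Sum>h\<in>walks ?V r m. ?p h * of_bool (length (stk h) = Suc (Suc l)))"
      by (simp add: A_def distrib_left sum.distrib)
    also have "(\<Sum>h\<in>walks ?V r m. ?p h * of_bool (length (stk h) = Suc (Suc l))) = good_sum T n r m (Suc l)"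
      unfolding good_sum_def by (intro sum.cong refl) auto
    finally have g: "good_sum T n r (Suc m) l = A + good_sum T n r m (Suc l)" .
    let ?j = "if l = 0 then 0 else jw T m (l - 1)"
    have A: "?q ^ Suc m * ?j \<le> A \<and> A \<le> ?j"
    proof (cases "l = 0")
      case True
      then have "A = 0" unfolding A_def by (intro sum.neutral) auto
      with True show ?thesis by simp
    next
      case False
      let ?B = "good_sum T n r m (l - 1)"
      have B: "?B = (\<Sum>h\<in>walks ?V r m. ?p h * of_bool (length (stk h) = l))"
        unfolding good_sum_def using False by (intro sum.cong refl) auto
      have gen: "q * (p * b) \<le> p * (b * x)" if "q \<le> x" "0 \<le> p" "0 \<le> b" for q p b x :: real
        using mult_left_mono[OF that(1), of "p * b"] that by (simp add: mult_ac)
      have gen2: "p * (b * x) \<le> p * b" if "x \<le> 1" "0 \<le> p" "0 \<le> b" for p b x :: real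
        using that by (intro mult_left_mono mult_left_le)
      have "?q * ?B \<le> A"
        unfolding B A_def sum_distrib_left
      proof (rule sum_mono)
        fix h assume "h \<in> walks ?V r m"
        then have "?q \<le> (real n - real (card (set h))) / real n"
          using h(4)[of h] n by (simp add: field_simps)
        then show "?q * (?p h * of_bool (length (stk h) = l))
            \<le> ?p h * (of_bool (length (stk h) = l) * ((real n - real (card (set h))) / real n))"
          by (rule gen) simp_all
      qed
      moreover have "A \<le> ?B"
        unfolding B A_def
      proof (rule sum_mono)
        fix h :: "nat list"
        have "(real n - real (card (set h))) / real n \<le> 1" using n by (simp add: field_simps)
        then show "?p h * (of_bool (length (stk h) = l) * ((real n - real (card (set h))) / real n))
            \<le> ?p h * of_bool (length (stk h) = l)"
          by (intro gen2) simp_all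
      qed
      moreover have "?q * (?q ^ m * jw T m (l - 1)) \<le> ?q * ?B"
        using IH[of "l - 1"] q by (intro mult_left_mono) auto
      ultimately show ?thesis using IH[of "l - 1"] False by (simp add: mult.assoc)
    qed
    have "?q ^ Suc m * jw T m (Suc l) \<le> ?q ^ m * jw T m (Suc l)"
      using q by (intro mult_right_mono jw_nonneg power_decreasing) auto
    with IH[of "Suc l"] have "?q ^ Suc m * jw T m (Suc l) \<le> good_sum T n r m (Suc l)"
      "good_sum T n r m (Suc l) \<le> jw T m (Suc l)" by linarith+
    moreover have "jw T (Suc m) l = ?j + jw T m (Suc l)" using False by simp
    ultimately show ?thesis using A unfolding g by (simp only: distrib_left) linarith
  qed
qed

lemma good_sum_close:
  assumes r: "r \<in> {1..n}" and m: "m \<le> n"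
  shows "\<bar>good_sum T n r m l - jw T m l\<bar> \<le> jw T m l * (real m)\<^sup>2 / real n"
proof -
  have n: "n \<ge> 1" using r by simp
  have "1 + real m * (- (real m / real n)) \<le> (1 + (- (real m / real n))) ^ m"
    using m n by (intro Bernoulli_inequality) (simp add: field_simps)
  then have "1 - (real m)\<^sup>2 / real n \<le> (1 - real m / real n) ^ m"
    by (simp add: power2_eq_square)
  then have "(1 - (real m)\<^sup>2 / real n) * jw T m l \<le> (1 - real m / real n) ^ m * jw T m l"
    by (intro mult_right_mono jw_nonneg)
  with good_sum_bounds[OF r m order_refl, of T l] show ?thesis
    by (simp add: algebra_simps)
qed

text \<open>Renewal: at the pinned time \<open>k\<close> all weight sits at 0, and from there the
  recursion runs as from time 0 until the next pinned time.\<close>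

lemma jw_restart:
  assumes "\<And>i. 1 \<le> i \<Longrightarrow> i < p \<Longrightarrow> k + i \<notin> T" "k \<in> T" "k \<ge> 1"
  shows "i < p \<Longrightarrow> jw T (k + i) l = jw T k 0 * jw {} i l"
proof (induction i arbitrary: l)
  case 0
  obtain k' where "k = Suc k'" using assms(3) by (cases k) auto
  then show ?case using assms(2) by auto
next
  case (Suc i)
  then have "Suc (k + i) \<notin> T" using assms(1)[of "Suc i"] by simp
  with Suc show ?case by (simp add: distrib_left)
qed

lemma jw_no_constraint: "(\<And>i. 1 \<le> i \<Longrightarrow> i \<le> m \<Longrightarrow> i \<notin> T) \<Longrightarrow> jw T m l = jw {} m l"
  by (induction m arbitrary: l) auto

lemma jw_0_cong: "jw T m 1 = jw {} m 1 \<Longrightarrow> jw T (Suc m) 0 = jw {} (Suc m) 0"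
  by simp

lemma jw_single:
  assumes "k \<ge> 1"
  shows "jw {k} k 0 = jw {} k 0"
proof -
  obtain m where m: "k = Suc m" using assms by (cases k) auto
  have "jw {k} m 1 = jw {} m 1" by (rule jw_no_constraint) (auto simp: m)
  then show ?thesis unfolding m by (rule jw_0_cong[of "{Suc m}"])
qed

text \<open>This factorisation makes the leading term of the second moment of a diagonal entry equal
  to the square of that of its mean, so its variance vanishes in the limit.\<close>

lemma jw_double:
  assumes "k \<ge> 1"
  shows "jw {k, 2 * k} (2 * k) 0 = (jw {} k 0)\<^sup>2"
proof -
  obtain m where m: "k = Suc m" using assms by (cases k) auto
  have "jw {k, 2 * k} m 1 = jw {} m 1" by (rule jw_no_constraint) (auto simp: m)
  then have c: "jw {k, 2 * k} k 0 = jw {} k 0" unfolding m by (rule jw_0_cong[of "{Suc m, 2 * Suc m}"])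
  have e: "2 * k = Suc (k + m)" using m by simp
  have "jw {k, 2 * k} (2 * k) 0 = jw {k, 2 * k} (k + m) 1"
    unfolding e by simp
  also have "\<dots> = jw {k, 2 * k} k 0 * jw {} m 1"
    by (rule jw_restart[of k]) (use m in auto)
  also have "jw {} m 1 = jw {} k 0" unfolding m by simp
  finally show ?thesis unfolding c by (simp add: power2_eq_square)
qed

section \<open>Matrix powers as sums over walks\<close>

text \<open>The diagonal is 0: the diagonal entries of the random matrix are treated as a
  perturbation, and only loop-free walks contribute.\<close>

fun harr :: "(nat \<times> nat \<Rightarrow> quat) \<Rightarrow> nat \<Rightarrow> nat \<Rightarrow> quat" where
  "harr \<zeta> u v = (if u < v then \<zeta> (u, v) else if v < u then quat_cnj (\<zeta> (v, u)) else 0)"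

declare harr.simps [simp del]

fun XP :: "(nat \<times> nat \<Rightarrow> quat) \<Rightarrow> nat list \<Rightarrow> quat" where
  "XP \<zeta> (v # u # h) = XP \<zeta> (u # h) \<diamond> harr \<zeta> u v"
| "XP \<zeta> _ = qone"

lemma harr_cnj: "harr \<zeta> v u = quat_cnj (harr \<zeta> u v)"
  by (simp add: harr.simps)

lemma harr_cong: "\<zeta> (edge u v) = \<zeta>' (edge u v) \<Longrightarrow> harr \<zeta> u v = harr \<zeta>' u v"
  by (auto simp: harr.simps edge_def min_def max_def split: if_splits)

lemma norm_harr: "u \<noteq> v \<Longrightarrow> norm (harr \<zeta> u v) = norm (\<zeta> (edge u v))"
  by (auto simp: harr.simps edge_def min_def max_def)

lemma XP_not_loopfree: "\<not> loopfree h \<Longrightarrow> XP \<zeta> h = 0"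
  by (induction \<zeta> h rule: XP.induct) (auto simp: harr.simps qmul.zero_left qmul.zero_right)

lemma XP_cong: "(\<And>e. e \<in> edges h \<Longrightarrow> \<zeta> e = \<zeta>' e) \<Longrightarrow> XP \<zeta> h = XP \<zeta>' h"
proof (induction \<zeta> h rule: XP.induct)
  case (1 \<zeta> v u h)
  then have "harr \<zeta> u v = harr \<zeta>' u v" by (intro harr_cong) (simp add: edges_Cons)
  with 1 show ?case by (simp add: edges_Cons)
qed simp_all

lemma XP_update: "cnt h e = 0 \<Longrightarrow> XP (\<zeta>(e := q)) h = XP \<zeta> h"
  by (rule XP_cong) (auto simp: edges_def)

lemma bounded_linear_harr_update:
  assumes "u \<noteq> v"
  shows "bounded_linear (\<lambda>q. harr (\<zeta>(edge u v := q)) u v)"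
proof (cases "u < v")
  case True
  then have "(\<lambda>q. harr (\<zeta>(edge u v := q)) u v) = (\<lambda>q. q)"
    by (intro ext) (simp add: harr.simps edge_def min_def max_def)
  then show ?thesis by (simp add: bounded_linear_ident)
next
  case False
  then have "(\<lambda>q. harr (\<zeta>(edge u v := q)) u v) = quat_cnj"
    using assms by (intro ext) (simp add: harr.simps edge_def min_def max_def)
  then show ?thesis by (simp only: bounded_linear_quat_cnj)
qed

text \<open>The single occurrence may be conjugated and stands between other factors, but the
  product remains real-linear in it. This is how a vanishing mean annihilates the whole
  walk.\<close>

lemma bounded_linear_XP_update:
  assumes "loopfree h" "cnt h e = 1"
  shows "bounded_linear (\<lambda>q. XP (\<zeta>(e := q)) h)"
  using assms
proof (induction h rule: newc.induct)
  case (1 v u h)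
  show ?case
  proof (cases "edge u v = e")
    case True
    then have c: "cnt (u # h) e = 0" using 1 by simp
    have "u \<noteq> v" using 1 by simp
    have "bounded_linear (\<lambda>q. XP \<zeta> (u # h) \<diamond> harr (\<zeta>(e := q)) u v)"
      using bounded_linear_compose[OF qmul.bounded_linear_right bounded_linear_harr_update[OF \<open>u \<noteq> v\<close>]]
      unfolding True .
    then show ?thesis by (simp only: XP.simps XP_update[OF c])
  next
    case False
    then have c: "cnt (u # h) e = 1" using 1 by simp
    have "harr (\<zeta>(e := q)) u v = harr \<zeta> u v" for q
      by (rule harr_cong) (use False in simp)
    moreover have "bounded_linear (\<lambda>q. XP (\<zeta>(e := q)) (u # h))"
      by (rule "1.IH") (use "1.prems" c in simp_all)
    note bounded_linear_compose[OF qmul.bounded_linear_left this, of "harr \<zeta> u v"]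
    ultimately show ?thesis by (simp only: XP.simps)
  qed
qed simp_all

lemma norm_XP:
  assumes "loopfree h" "finite A" "edges h \<subseteq> A"
  shows "norm (XP \<zeta> h) = (\<Prod>e\<in>A. norm (\<zeta> e) ^ cnt h e)"
  using assms
proof (induction h rule: newc.induct)
  case (1 v u h)
  have "norm (\<zeta> (edge u v)) = (\<Prod>e\<in>A. norm (\<zeta> e) ^ of_bool (edge u v = e))"
  proof -
    have "(\<Prod>e\<in>A. norm (\<zeta> e) ^ of_bool (edge u v = e)) = (\<Prod>e\<in>A. if e = edge u v then norm (\<zeta> e) else 1)"
      by (intro prod.cong refl) auto
    then show ?thesis using 1 by (simp add: edges_Cons)
  qed
  moreover have "norm (XP \<zeta> (u # h)) = (\<Prod>e\<in>A. norm (\<zeta> e) ^ cnt (u # h) e)"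
    using 1 by (simp add: edges_Cons)
  ultimately have "norm (XP \<zeta> (v # u # h)) =
      (\<Prod>e\<in>A. norm (\<zeta> e) ^ cnt (u # h) e * norm (\<zeta> e) ^ of_bool (edge u v = e))"
    using 1 by (simp add: norm_qmul norm_harr prod.distrib)
  also have "\<dots> = (\<Prod>e\<in>A. norm (\<zeta> e) ^ cnt (v # u # h) e)"
    by (intro prod.cong refl) (simp add: power_add mult.commute)
  finally show ?case .
qed simp_all

text \<open>By the induction hypothesis the excursion before a return has collapsed to a real
  factor, so the two factors of the returning edge become adjacent. Their product is a squared norm,
  real and central, and only the product along the stack survives.\<close>

lemma XP_stk:
  assumes "stk h \<noteq> []"
  shows "XP \<zeta> h = (\<Prod>e | cnt h e = 2. (norm (\<zeta> e))\<^sup>2) *\<^sub>R XP \<zeta> (stk h)"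
  using assms
proof (induction h rule: newc.induct)
  case (1 v u h)
  define s where "s = stk (u # h)"
  have s0: "s \<noteq> []" using "1.prems" by (auto simp: s_def Let_def split: if_splits)
  note P = stk_props[of "u # h", folded s_def, OF s0]
  then obtain s' where s': "s = u # s'" using s0 by (cases s) auto
  define c where "c = (\<Prod>e | cnt (u # h) e = 2. (norm (\<zeta> e))\<^sup>2)"
  have IH: "XP \<zeta> (u # h) = c *\<^sub>R XP \<zeta> s" using 1 s0 by (simp add: s_def c_def)
  have st: "stk (v # u # h) = (if v \<notin> set (u # h) then v # s
     else if tl s \<noteq> [] \<and> hd (tl s) = v then tl s else [])"
    using s0 by (simp add: s_def[symmetric] Let_def)
  have fin: "finite {e. cnt (u # h) e = 2}"
    by (rule finite_subset[OF _ finite_cnt_ge_2[of "u # h"]]) auto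
  show ?case
  proof (cases "v \<in> set (u # h)")
    case False
    then have e: "stk (v # u # h) = v # s" using st by simp
    have "cnt (v # u # h) e = 2 \<longleftrightarrow> cnt (u # h) e = 2" for e
      using cnt_notin[OF False, of u] by (cases "e = edge u v") auto
    then have "(\<Prod>e | cnt (v # u # h) e = 2. (norm (\<zeta> e))\<^sup>2) = c" by (simp add: c_def)
    then show ?thesis unfolding e XP.simps(1) IH s' by (simp add: qmul.scaleR_left)
  next
    case True
    with st "1.prems" have t: "tl s \<noteq> []" "hd (tl s) = v" by (auto split: if_splits)
    then obtain s'' where s'': "s = u # v # s''" using s' by (cases s') auto
    have e: "stk (v # u # h) = v # s''" using st True t s'' by simp
    have uv: "u \<noteq> v" using P s'' by auto
    have "cnt s (edge u v) = of_bool (cnt (u # h) (edge u v) = 1)" using P by blast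
    moreover have "cnt s (edge u v) \<ge> 1" by (simp add: s'' edge_commute[of v u])
    ultimately have c1: "cnt (u # h) (edge u v) = 1"
      by (metis not_one_le_zero of_bool_eq(1))
    have "e \<in> {e. cnt (v # u # h) e = 2} \<longleftrightarrow> e \<in> insert (edge u v) {e. cnt (u # h) e = 2}" for e
      using c1 by (cases "e = edge u v") auto
    then have "{e. cnt (v # u # h) e = 2} = insert (edge u v) {e. cnt (u # h) e = 2}" by blast
    then have pr: "(\<Prod>e | cnt (v # u # h) e = 2. (norm (\<zeta> e))\<^sup>2) = (norm (\<zeta> (edge u v)))\<^sup>2 * c"
      using fin c1 by (simp add: c_def)
    have "harr \<zeta> v u \<diamond> harr \<zeta> u v = (norm (\<zeta> (edge u v)))\<^sup>2 *\<^sub>R qone"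
      unfolding harr_cnj[of \<zeta> v u] cnj_qmul norm_harr[OF uv] ..
    then have "XP \<zeta> (v # s'') \<diamond> harr \<zeta> v u \<diamond> harr \<zeta> u v = (norm (\<zeta> (edge u v)))\<^sup>2 *\<^sub>R XP \<zeta> (v # s'')"
      unfolding qmul_assoc by (simp add: qmul.scaleR_right)
    then show ?thesis unfolding e pr XP.simps(1) IH s'' by (simp add: qmul.scaleR_left)
  qed
next
  case ("2_1" )
  then show ?case by simp
next
  case ("2_2" v)
  then show ?case by simp
qed

lemma XP_closed_stk:
  assumes "stk h = [r]"
  shows "XP \<zeta> h = (\<Prod>e\<in>edges h. (norm (\<zeta> e))\<^sup>2) *\<^sub>R qone"
proof -
  have "stk h \<noteq> []" using assms by simp
  note P = stk_props[OF this]
  have "cnt h e \<noteq> 1 \<and> cnt h e \<le> 2" for e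
  proof -
    have "cnt [r] e = of_bool (cnt h e = 1)" "cnt h e \<le> 2" using P assms by metis+
    then show ?thesis by auto
  qed
  then have "cnt h e = 2 \<longleftrightarrow> cnt h e \<ge> 1" for e
    by (metis One_nat_def Suc_1 le_SucE le_numeral_extra(4) not_less_eq_eq one_le_numeral)
  then have "{e. cnt h e = 2} = edges h" by (simp add: edges_def)
  then show ?thesis using XP_stk[OF \<open>stk h \<noteq> []\<close>, of \<zeta>] by (simp add: assms)
qed

section \<open>Powers of an array\<close>

fun qpow :: "(nat \<Rightarrow> nat \<Rightarrow> quat) \<Rightarrow> nat \<Rightarrow> nat \<Rightarrow> nat \<Rightarrow> nat \<Rightarrow> quat" where
  "qpow X n 0 i j = (if i = j then qone else 0)"
| "qpow X n (Suc m) i j = (\<Sum>u\<in>{1..n}. qpow X n m i u \<diamond> X u j)"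

definition walk_sum :: "(nat \<times> nat \<Rightarrow> quat) \<Rightarrow> (nat \<Rightarrow> nat set) \<Rightarrow> nat \<Rightarrow> nat \<Rightarrow> nat \<Rightarrow> quat" where
  "walk_sum \<zeta> V r m v = (\<Sum>h\<in>walks V r m. of_bool (hd h = v) *\<^sub>R XP \<zeta> h)"

lemma walk_sum_Suc:
  assumes V: "\<And>i. V i \<subseteq> {1..n}" "r \<in> {1..n}" and v: "v \<in> V (Suc m)"
  shows "walk_sum \<zeta> V r (Suc m) v = (\<Sum>u\<in>{1..n}. walk_sum \<zeta> V r m u \<diamond> harr \<zeta> u v)"
proof -
  have fin: "finite (V (Suc m))" using V(1) by (rule finite_subset) simp
  have "walk_sum \<zeta> V r (Suc m) v = (\<Sum>h\<in>walks V r m. XP \<zeta> (v # h))"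
    unfolding walk_sum_def sum_walks_Suc
  proof (intro sum.cong refl)
    fix h
    have "(\<Sum>w\<in>V (Suc m). of_bool (hd (w # h) = v) *\<^sub>R XP \<zeta> (w # h))
        = (\<Sum>w\<in>V (Suc m). if w = v then XP \<zeta> (w # h) else 0)"
      by (intro sum.cong refl) simp
    then show "(\<Sum>w\<in>V (Suc m). of_bool (hd (w # h) = v) *\<^sub>R XP \<zeta> (w # h)) = XP \<zeta> (v # h)"
      using v fin by simp
  qed
  also have "\<dots> = (\<Sum>h\<in>walks V r m. \<Sum>u\<in>{1..n}. of_bool (hd h = u) *\<^sub>R XP \<zeta> h \<diamond> harr \<zeta> u v)"
  proof (intro sum.cong refl)
    fix h assume h: "h \<in> walks V r m"
    then obtain w g where wg: "h = w # g" using walks_basic(2) by (cases h) auto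
    have "w \<in> {1..n}" using walks_subset[OF h V(1) V(2)] wg by auto
    moreover have "(\<Sum>u\<in>{1..n}. of_bool (hd h = u) *\<^sub>R XP \<zeta> h \<diamond> harr \<zeta> u v)
        = (\<Sum>u\<in>{1..n}. if u = w then XP \<zeta> h \<diamond> harr \<zeta> u v else 0)"
      by (intro sum.cong refl) (simp add: wg qmul.zero_left)
    ultimately show "XP \<zeta> (v # h) = (\<Sum>u\<in>{1..n}. of_bool (hd h = u) *\<^sub>R XP \<zeta> h \<diamond> harr \<zeta> u v)"
      by (simp add: wg)
  qed
  also have "\<dots> = (\<Sum>u\<in>{1..n}. walk_sum \<zeta> V r m u \<diamond> harr \<zeta> u v)"
    unfolding walk_sum_def qmul.sum_left by (rule sum.swap)
  finally show ?thesis .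
qed

lemma walk_sum_outside:
  assumes "v \<notin> V (Suc m)"
  shows "walk_sum \<zeta> V r (Suc m) v = 0"
  unfolding walk_sum_def by (rule sum.neutral) (use assms in auto)

definition root_at :: "nat set \<Rightarrow> nat \<Rightarrow> nat \<Rightarrow> nat \<Rightarrow> nat set" where
  "root_at T n r i = (if i \<in> T then {r} else {1..n})"

lemma root_at_subset: "r \<in> {1..n} \<Longrightarrow> root_at T n r i \<subseteq> {1..n}"
  by (auto simp: root_at_def)

lemma walk_sum_root_at_free:
  assumes r: "r \<in> {1..n}" and T: "\<And>i. 1 \<le> i \<Longrightarrow> i \<le> m \<Longrightarrow> i \<notin> T" and v: "v \<in> {1..n}"
  shows "walk_sum \<zeta> (root_at T n r) r m v = qpow (harr \<zeta>) n m r v"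
  using T v
proof (induction m arbitrary: v)
  case (Suc m)
  have "v \<in> root_at T n r (Suc m)" using Suc.prems(1)[of "Suc m"] Suc.prems(2) by (simp add: root_at_def)
  note walk_sum_Suc[where V = "root_at T n r", OF root_at_subset[OF r] r this, of \<zeta>]
  also have "(\<Sum>u\<in>{1..n}. walk_sum \<zeta> (root_at T n r) r m u \<diamond> harr \<zeta> u v)
    = (\<Sum>u\<in>{1..n}. qpow (harr \<zeta>) n m r u \<diamond> harr \<zeta> u v)"
    using Suc.prems(1) by (intro sum.cong refl arg_cong2[where f = qmul] Suc.IH) auto
  finally show ?case by simp
qed (simp add: walk_sum_def)

lemma walk_sum_root_at_first:
  assumes r: "r \<in> {1..n}" and T: "\<And>i. 1 \<le> i \<Longrightarrow> i < k \<Longrightarrow> i \<notin> T" and k: "k \<in> T" "k \<ge> 1"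
  shows "walk_sum \<zeta> (root_at T n r) r k v = (if v = r then qpow (harr \<zeta>) n k r r else 0)"
proof -
  obtain m where m: "k = Suc m" using k by (cases k) auto
  have V: "root_at T n r (Suc m) = {r}" using k m by (simp add: root_at_def)
  show ?thesis
  proof (cases "v = r")
    case True
    then have "v \<in> root_at T n r (Suc m)" using V by simp
    note walk_sum_Suc[where V = "root_at T n r", OF root_at_subset[OF r] r this, of \<zeta>]
    also have "(\<Sum>u\<in>{1..n}. walk_sum \<zeta> (root_at T n r) r m u \<diamond> harr \<zeta> u v)
      = (\<Sum>u\<in>{1..n}. qpow (harr \<zeta>) n m r u \<diamond> harr \<zeta> u v)"
      using T m by (intro sum.cong refl arg_cong2[where f = qmul] walk_sum_root_at_free r) auto
    finally show ?thesis using True m by simp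
  next
    case False
    then show ?thesis using walk_sum_outside[of v "root_at T n r" m \<zeta> r] V m by simp
  qed
qed

text \<open>Pinning at time \<open>k\<close> cuts the walk into two closed ones. Thus the square of
  a diagonal entry of a power is one walk sum, to which the same expectation estimate applies as to
  the entry itself.\<close>

lemma walk_sum_root_at_twice:
  assumes r: "r \<in> {1..n}" and k: "k \<ge> 1"
  shows "walk_sum \<zeta> (root_at {k, 2 * k} n r) r (2 * k) r
    = qpow (harr \<zeta>) n k r r \<diamond> qpow (harr \<zeta>) n k r r"
proof -
  let ?V = "root_at {k, 2 * k} n r" and ?q = "qpow (harr \<zeta>) n k r r"
  have *: "walk_sum \<zeta> ?V r (k + i) v = ?q \<diamond> qpow (harr \<zeta>) n i r v" if "i < k" "v \<in> {1..n}" for i v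
    using that
  proof (induction i arbitrary: v)
    case 0
    show ?case using walk_sum_root_at_first[OF r, of k "{k, 2 * k}" \<zeta> v] k
      by (auto simp: qmul.zero_right)
  next
    case (Suc i)
    have "v \<in> ?V (Suc (k + i))" using Suc.prems by (simp add: root_at_def)
    note walk_sum_Suc[where V = ?V, OF root_at_subset[OF r] r this, of \<zeta>]
    also have "(\<Sum>u\<in>{1..n}. walk_sum \<zeta> ?V r (k + i) u \<diamond> harr \<zeta> u v)
      = (\<Sum>u\<in>{1..n}. ?q \<diamond> qpow (harr \<zeta>) n i r u \<diamond> harr \<zeta> u v)"
      using Suc by (intro sum.cong refl arg_cong2[where f = qmul]) auto
    finally show ?case by (simp add: qmul.sum_right qmul_assoc)
  qed
  obtain m where m: "k = Suc m" using k by (cases k) auto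
  have e: "2 * k = Suc (k + m)" using m by simp
  have "r \<in> ?V (Suc (k + m))" using e r by (auto simp: root_at_def)
  note walk_sum_Suc[where V = ?V, OF root_at_subset[OF r] r this, of \<zeta>]
  also have "(\<Sum>u\<in>{1..n}. walk_sum \<zeta> ?V r (k + m) u \<diamond> harr \<zeta> u r)
      = (\<Sum>u\<in>{1..n}. ?q \<diamond> qpow (harr \<zeta>) n m r u \<diamond> harr \<zeta> u r)"
    using m by (intro sum.cong refl arg_cong2[where f = qmul] *) auto
  finally show ?thesis unfolding e by (simp add: m qmul.sum_right qmul_assoc)
qed

lemma herm_harr: "herm (harr \<zeta>) n"
  by (simp add: herm_def harr_cnj[of \<zeta>, symmetric])

lemma herm_sym: "herm X n \<Longrightarrow> u \<in> {1..n} \<Longrightarrow> v \<in> {1..n} \<Longrightarrow> quat_cnj (X u v) = X v u"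
  unfolding herm_def by metis

lemma qpow_add:
  assumes "i \<in> {1..n}" "j \<in> {1..n}"
  shows "qpow X n (p + q) i j = (\<Sum>u\<in>{1..n}. qpow X n p i u \<diamond> qpow X n q u j)"
  using assms(2)
proof (induction q arbitrary: j)
  case 0
  have "(\<Sum>u\<in>{1..n}. qpow X n p i u \<diamond> qpow X n 0 u j) = (\<Sum>u\<in>{1..n}. if u = j then qpow X n p i u else 0)"
    by (intro sum.cong refl) (simp add: qmul.zero_right)
  then show ?case using 0 by simp
next
  case (Suc q)
  have "qpow X n (p + Suc q) i j = (\<Sum>w\<in>{1..n}. \<Sum>u\<in>{1..n}. qpow X n p i u \<diamond> (qpow X n q u w \<diamond> X w j))"
    by (simp add: Suc.IH qmul.sum_left qmul_assoc)
  also have "\<dots> = (\<Sum>u\<in>{1..n}. \<Sum>w\<in>{1..n}. qpow X n p i u \<diamond> (qpow X n q u w \<diamond> X w j))"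
    by (rule sum.swap)
  finally show ?case by (simp add: qmul.sum_right)
qed

lemma qpow_1: "i \<in> {1..n} \<Longrightarrow> qpow X n 1 i j = X i j"
proof -
  assume i: "i \<in> {1..n}"
  have "qpow X n 1 i j = (\<Sum>u\<in>{1..n}. if u = i then X u j else 0)"
    unfolding One_nat_def qpow.simps by (intro sum.cong refl) (simp add: qmul.zero_left)
  then show ?thesis using i by simp
qed

lemma qpow_cnj:
  assumes X: "herm X n" and "i \<in> {1..n}" "j \<in> {1..n}"
  shows "quat_cnj (qpow X n m i j) = qpow X n m j i"
  using assms(2,3)
proof (induction m arbitrary: i j)
  case (Suc m)
  have "quat_cnj (qpow X n (Suc m) i j) = (\<Sum>u\<in>{1..n}. quat_cnj (X u j) \<diamond> quat_cnj (qpow X n m i u))"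
    by (simp add: quat_cnj_sum quat_cnj_qmul)
  also have "\<dots> = (\<Sum>u\<in>{1..n}. qpow X n 1 j u \<diamond> qpow X n m u i)"
    using Suc herm_sym[OF X] by (intro sum.cong refl arg_cong2[where f = qmul]) (auto simp only: qpow_1)
  also have "\<dots> = qpow X n (1 + m) j i" by (rule qpow_add[symmetric, OF Suc.prems(2,1)])
  finally show ?case by simp
qed simp

text \<open>Half the trace of \<open>quat_mat q\<close>, so that the sum of \<open>Rq\<close> over a
  diagonal is half the trace of the complex matrix.\<close>

definition Rq :: "quat \<Rightarrow> real" where "Rq q = inner qone q"

lemma bounded_linear_Rq: "bounded_linear Rq"
  unfolding Rq_def by (rule bounded_linear_inner_right)

lemma Rq_qone [simp]: "Rq qone = 1"
  by (simp add: Rq_def qone_def)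

lemma Rq_le_norm: "\<bar>Rq q\<bar> \<le> norm q"
  using Cauchy_Schwarz_ineq2[of qone q] by (simp add: Rq_def)

lemma self_cnj: "quat_cnj q = q \<Longrightarrow> q = Rq q *\<^sub>R qone"
  by (cases q) (simp add: quat_cnj_def Rq_def qone_def)

lemma mvec_qpow:
  assumes "\<And>j. j \<in> {1..n} \<Longrightarrow> mvec X n w j = c *\<^sub>R w j" and j: "j \<in> {1..n}"
  shows "(\<Sum>k\<in>{1..n}. qpow X n p j k \<diamond> w k) = c ^ p *\<^sub>R w j"
proof (induction p)
  case 0
  have "(\<Sum>k\<in>{1..n}. qpow X n 0 j k \<diamond> w k) = (\<Sum>k\<in>{1..n}. if k = j then w k else 0)"
    by (intro sum.cong refl) (auto simp: qmul.zero_left)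
  then show ?case using j by simp
next
  case (Suc p)
  have "(\<Sum>k\<in>{1..n}. qpow X n (Suc p) j k \<diamond> w k)
      = (\<Sum>k\<in>{1..n}. \<Sum>u\<in>{1..n}. qpow X n p j u \<diamond> (X u k \<diamond> w k))"
    by (simp add: qmul.sum_left qmul_assoc)
  also have "\<dots> = (\<Sum>u\<in>{1..n}. qpow X n p j u \<diamond> mvec X n w u)"
    unfolding mvec_def qmul.sum_right by (rule sum.swap)
  also have "\<dots> = (\<Sum>u\<in>{1..n}. c *\<^sub>R (qpow X n p j u \<diamond> w u))"
    by (intro sum.cong refl) (simp add: assms(1) qmul.scaleR_right)
  finally show ?case unfolding scaleR_right.sum[symmetric] Suc by simp
qed

lemma norm_sum_qmul_sq:
  "(norm (\<Sum>k\<in>A. f k \<diamond> w k))\<^sup>2 \<le> (\<Sum>k\<in>A. (norm (f k))\<^sup>2) * (\<Sum>k\<in>A. (norm (w k))\<^sup>2)"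
proof -
  have "norm (\<Sum>k\<in>A. f k \<diamond> w k) \<le> (\<Sum>k\<in>A. norm (f k) * norm (w k))"
    by (rule order.trans[OF norm_sum]) (simp add: norm_qmul)
  then have "(norm (\<Sum>k\<in>A. f k \<diamond> w k))\<^sup>2 \<le> (\<Sum>k\<in>A. norm (f k) * norm (w k))\<^sup>2"
    by (intro power_mono) auto
  also have "\<dots> \<le> (\<Sum>k\<in>A. (norm (f k))\<^sup>2) * (\<Sum>k\<in>A. (norm (w k))\<^sup>2)"
    by (rule Cauchy_Schwarz_ineq_sum)
  finally show ?thesis .
qed

lemma Rq_qpow_even:
  assumes X: "herm X n" and i: "i \<in> {1..n}"
  shows "Rq (qpow X n (2 * p) i i) = (\<Sum>k\<in>{1..n}. (norm (qpow X n p i k))\<^sup>2)"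
proof -
  have "qpow X n (p + p) i i = (\<Sum>u\<in>{1..n}. qpow X n p i u \<diamond> quat_cnj (qpow X n p i u))"
    unfolding qpow_add[OF i i] by (intro sum.cong refl) (simp only: qpow_cnj[OF X i])
  also have "\<dots> = (\<Sum>u\<in>{1..n}. (norm (qpow X n p i u))\<^sup>2) *\<^sub>R qone"
    by (simp add: qmul_cnj scaleR_left.sum)
  finally show ?thesis
    by (simp add: mult_2 linear_scale[OF bounded_linear.linear[OF bounded_linear_Rq]])
qed

text \<open>The \<open>p\<close>-th power sends the unit vector \<open>w\<close> to
  \<open>c ^ p\<close> times itself, so \<open>c ^ (2 * p)\<close> is at most its squared
  Hilbert-Schmidt norm; for Hermitian \<open>X\<close> the squared norms of its rows are the
  diagonal entries of the power \<open>2 * p\<close>.\<close>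

lemma trace_power_bound:
  assumes X: "herm X n" and w: "nsq n w = 1" "\<And>j. j \<in> {1..n} \<Longrightarrow> mvec X n w j = c *\<^sub>R w j"
  shows "c ^ (2 * p) \<le> (\<Sum>i\<in>{1..n}. Rq (qpow X n (2 * p) i i))"
proof -
  have "c ^ (2 * p) = (\<Sum>j\<in>{1..n}. (norm (c ^ p *\<^sub>R w j))\<^sup>2)"
    using w(1) by (simp add: nsq_def power_mult_distrib sum_distrib_left[symmetric] power_even_abs
      flip: power_mult) (simp add: mult.commute power_mult)
  also have "\<dots> = (\<Sum>j\<in>{1..n}. (norm (\<Sum>k\<in>{1..n}. qpow X n p j k \<diamond> w k))\<^sup>2)"
    by (intro sum.cong refl) (simp only: mvec_qpow[OF w(2)])
  also have "\<dots> \<le> (\<Sum>j\<in>{1..n}. (\<Sum>k\<in>{1..n}. (norm (qpow X n p j k))\<^sup>2) * nsq n w)"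
    unfolding nsq_def by (intro sum_mono norm_sum_qmul_sq)
  also have "\<dots> = (\<Sum>i\<in>{1..n}. Rq (qpow X n (2 * p) i i))"
    unfolding w(1) mult_1_right
    by (intro sum.cong refl Rq_qpow_even[OF X, symmetric])
  finally show ?thesis .
qed

lemma harr_measurable:
  assumes "edge u v \<in> F"
  shows "(\<lambda>\<zeta>. harr \<zeta> u v) \<in> borel_measurable (Pi\<^sub>M F (\<lambda>_. borel))"
proof -
  have m [measurable]: "(\<lambda>\<zeta>. \<zeta> (edge u v)) \<in> borel_measurable (Pi\<^sub>M F (\<lambda>_. borel))"
    using assms by (rule measurable_component_singleton)
  have "(\<lambda>\<zeta>. harr \<zeta> u v) = (\<lambda>\<zeta>. if u < v then \<zeta> (edge u v) else if v < u then quat_cnj (\<zeta> (edge u v)) else 0)"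
    by (auto simp: harr.simps edge_def min_def max_def)
  then show ?thesis by simp
qed

lemma XP_measurable:
  "edges h \<subseteq> F \<Longrightarrow> (\<lambda>\<zeta>. XP \<zeta> h) \<in> borel_measurable (Pi\<^sub>M F (\<lambda>_. borel))"
  by (induction h rule: newc.induct)
     (auto simp: edges_Cons intro!: borel_measurable_qmul harr_measurable)

section \<open>Expectations of walk products\<close>

text \<open>The second moment is only bounded by \<open>s\<^sup>2\<close>: the upper bound on the
  spectrum asks for no more, and this leaves room for \<open>s > 0\<close> when the variance itself
  is 0.\<close>

locale rand_array = prob_space M for M :: "'w measure" +
  fixes Z :: "nat \<times> nat \<Rightarrow> 'w \<Rightarrow> quat" and K s :: real
  assumes meas [measurable]: "\<And>e. Z e \<in> borel_measurable M"
    and bdd: "\<And>e w. norm (Z e w) \<le> K"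
    and indep: "indep_vars (\<lambda>_. borel) Z {(j, k). 1 \<le> j \<and> j < k}"
    and mean0: "\<And>j k. 1 \<le> j \<Longrightarrow> j < k \<Longrightarrow> expectation (Z (j, k)) = 0"
    and second: "\<And>j k. 1 \<le> j \<Longrightarrow> j < k \<Longrightarrow> expectation (\<lambda>w. (norm (Z (j, k) w))\<^sup>2) \<le> s\<^sup>2"
    and s_pos: "0 < s"
begin

abbreviation upper :: "(nat \<times> nat) set" where "upper \<equiv> {(j, k). 1 \<le> j \<and> j < k}"

lemma K_nonneg: "0 \<le> K"
  using bdd[of undefined undefined] norm_ge_zero order.trans by blast

abbreviation XZ :: "nat list \<Rightarrow> 'w \<Rightarrow> quat" where "XZ h w \<equiv> XP (\<lambda>e. Z e w) h"

lemma XZ_measurable [measurable]: "XZ h \<in> borel_measurable M"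
proof -
  have "(\<lambda>w. harr (\<lambda>e. Z e w) u v) \<in> borel_measurable M" for u v
    unfolding harr.simps by measurable
  then show ?thesis
    by (induction h rule: newc.induct) (auto intro!: borel_measurable_qmul)
qed

lemma norm_XP_le:
  assumes "\<And>e. norm (\<zeta> e) \<le> K"
  shows "norm (XP \<zeta> h) \<le> max 1 K ^ length h"
proof (cases "loopfree h")
  case True
  have "norm (XP \<zeta> h) = (\<Prod>e\<in>edges h. norm (\<zeta> e) ^ cnt h e)"
    using True by (intro norm_XP finite_edges) auto
  also have "\<dots> \<le> (\<Prod>e\<in>edges h. max 1 K ^ cnt h e)"
    using assms by (intro prod_mono conjI power_mono) (auto simp: le_max_iff_disj)
  also have "\<dots> = max 1 K ^ (length h - 1)"
    by (simp add: power_sum[symmetric] sum_cnt_edges finite_edges)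
  also have "\<dots> \<le> max 1 K ^ length h" by (intro power_increasing) auto
  finally show ?thesis .
qed (simp add: XP_not_loopfree)

lemma XZ_integrable: "integrable M (XZ h)"
  by (rule integrable_const_bound[where B = "max 1 K ^ length h"]) (use norm_XP_le bdd in auto)

text \<open>Fubini: the entries on the walk have a product law, and integrating out the coordinate
  \<open>e\<close> first replaces it by its mean 0, because the walk product is linear in
  it.\<close>

lemma expectation_XZ_single:
  assumes lf: "loopfree h" and F: "edges h \<subseteq> upper" and e: "cnt h e = 1"
  shows "expectation (XZ h) = 0"
proof -
  define N where "N = (\<lambda>e. distr M borel (Z e))"
  have fin: "finite (edges h)" by (rule finite_edges)
  have eF: "e \<in> edges h" using e by (simp add: edges_def)
  define G where "G = edges h - {e}"
  have ins: "insert e G = edges h" "e \<notin> G" "finite G" using eF fin by (auto simp: G_def)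
  interpret N: prob_space "N i" for i unfolding N_def by (rule prob_space_distr) simp
  interpret P: product_sigma_finite N ..
  have "indep_vars (\<lambda>_. borel) Z (edges h)" by (rule indep_vars_subset[OF indep F])
  then have d: "distr M (\<Pi>\<^sub>M i\<in>edges h. borel) (\<lambda>w. \<lambda>i\<in>edges h. Z i w) = Pi\<^sub>M (edges h) N"
    unfolding N_def using eF by (subst (asm) indep_vars_iff_distr_eq_PiM) auto
  have meas': "(\<lambda>\<zeta>. XP \<zeta> h) \<in> borel_measurable (\<Pi>\<^sub>M i\<in>edges h. borel)"
    by (rule XP_measurable) simp
  have rm: "(\<lambda>w. \<lambda>i\<in>edges h. Z i w) \<in> M \<rightarrow>\<^sub>M (\<Pi>\<^sub>M i\<in>edges h. borel)" by measurable
  have XPr: "XP (\<lambda>i\<in>edges h. Z i w) h = XZ h w" for w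
    by (rule XP_cong) simp
  have int: "integrable (Pi\<^sub>M (insert e G) N) (\<lambda>\<zeta>. XP \<zeta> h)"
    unfolding ins d[symmetric] using integrable_distr_eq[OF rm meas'] by (simp only: XPr XZ_integrable)
  have "expectation (XZ h) = integral\<^sup>L (Pi\<^sub>M (insert e G) N) (\<lambda>\<zeta>. XP \<zeta> h)"
    unfolding ins d[symmetric] by (subst integral_distr[OF rm meas']) (simp only: XPr)
  also have "\<dots> = (\<integral>\<zeta>. (\<integral>y. XP (\<zeta>(e := y)) h \<partial>N e) \<partial>Pi\<^sub>M G N)"
    using int ins by (intro P.product_integral_insert) auto
  also have "\<dots> = (\<integral>\<zeta>. 0 \<partial>Pi\<^sub>M G N)"
  proof (intro Bochner_Integration.integral_cong refl)
    fix \<zeta>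
    have iy: "integrable (N e) (\<lambda>y. y)" unfolding N_def
      by (subst integrable_distr_eq) (auto intro!: integrable_const_bound[where B = K] bdd)
    obtain j k where jk: "e = (j, k)" "1 \<le> j" "j < k" using eF F by auto
    have "(\<integral>y. y \<partial>N e) = 0" unfolding N_def
      by (subst integral_distr) (use mean0[of j k] jk in auto)
    moreover have "(\<integral>y. XP (\<zeta>(e := y)) h \<partial>N e) = XP (\<zeta>(e := (\<integral>y. y \<partial>N e))) h"
      using integral_bounded_linear[OF bounded_linear_XP_update[OF lf e] iy] .
    ultimately show "(\<integral>y. XP (\<zeta>(e := y)) h \<partial>N e) = 0"
      using linear_0[OF bounded_linear.linear[OF bounded_linear_XP_update[OF lf e, of \<zeta>]]] by simp
  qed
  finally show ?thesis by simp
qed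

lemma norm_pow_integrable: "integrable M (\<lambda>w. norm (Z e w) ^ c)"
  by (rule integrable_const_bound[where B = "K ^ c"]) (auto intro!: power_mono bdd)

lemma expectation_norm_pow_le:
  assumes "e \<in> upper" "c \<ge> 2"
  shows "expectation (\<lambda>w. norm (Z e w) ^ c) \<le> s\<^sup>2 * K ^ (c - 2)"
proof -
  obtain j k where jk: "e = (j, k)" "1 \<le> j" "j < k" using assms by auto
  have "expectation (\<lambda>w. norm (Z e w) ^ c) \<le> expectation (\<lambda>w. (norm (Z e w))\<^sup>2 * K ^ (c - 2))"
  proof (rule integral_mono[OF norm_pow_integrable])
    show "integrable M (\<lambda>w. (norm (Z e w))\<^sup>2 * K ^ (c - 2))" using norm_pow_integrable by simp
    fix w
    have "norm (Z e w) ^ c = (norm (Z e w))\<^sup>2 * norm (Z e w) ^ (c - 2)"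
      using assms(2) by (metis le_add_diff_inverse power_add)
    then show "norm (Z e w) ^ c \<le> (norm (Z e w))\<^sup>2 * K ^ (c - 2)"
      by (auto intro!: mult_left_mono power_mono bdd)
  qed
  also have "\<dots> = expectation (\<lambda>w. (norm (Z e w))\<^sup>2) * K ^ (c - 2)" by simp
  also have "\<dots> \<le> s\<^sup>2 * K ^ (c - 2)"
    using second[of j k] jk K_nonneg by (intro mult_right_mono) auto
  finally show ?thesis .
qed

lemma expectation_prod_norm:
  assumes "finite F" "F \<subseteq> upper"
  shows "expectation (\<lambda>w. \<Prod>e\<in>F. norm (Z e w) ^ c e) = (\<Prod>e\<in>F. expectation (\<lambda>w. norm (Z e w) ^ c e))"
proof (rule indep_vars_lebesgue_integral[OF assms(1)])
  have "indep_vars (\<lambda>_. borel) Z F" by (rule indep_vars_subset[OF indep assms(2)])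
  then show "indep_vars (\<lambda>_. borel) (\<lambda>e w. norm (Z e w) ^ c e) F"
    by (rule indep_vars_compose2[where Y = "\<lambda>e q. norm q ^ c e"]) measurable
qed (rule norm_pow_integrable)

text \<open>An edge used \<open>c \<ge> 2\<close> times costs
  \<open>s\<^sup>2 * K ^ (c - 2)\<close>, and the exponents \<open>c - 2\<close> add up to the
  number of third steps. Since \<open>m\<close> is twice the number of edges plus that number,
  taking out \<open>(s * sqrt N) ^ m\<close> leaves \<open>1 / N\<close> per edge and
  \<open>K / (s * sqrt N)\<close> per third step, the weights summed above.\<close>

lemma expectation_XZ_bound:
  assumes F: "edges h \<subseteq> upper" and len: "length h = m + 1" and N: "N > 0"
  shows "norm (expectation (XZ h)) \<le> of_bool (loopfree h) *
    ((s * sqrt N) ^ m * ((1 / N) ^ (newc h + cycc h) * (K / (s * sqrt N)) ^ thirdc h))"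
proof (cases "loopfree h \<and> (\<forall>e\<in>edges h. cnt h e \<ge> 2)")
  case False
  then have "expectation (XZ h) = 0"
  proof (cases "loopfree h")
    case True
    with False obtain e where "e \<in> edges h" "\<not> cnt h e \<ge> 2" by blast
    then have "cnt h e = 1" by (simp add: edges_def)
    then show ?thesis using expectation_XZ_single[OF True F] by blast
  qed (simp add: XP_not_loopfree)
  then show ?thesis using s_pos N K_nonneg by simp
next
  case True
  then have lf: "loopfree h" and c2: "\<And>e. e \<in> edges h \<Longrightarrow> cnt h e \<ge> 2" by auto
  let ?E = "newc h + cycc h"
  have mE: "m = 2 * ?E + thirdc h" using thirdc_eq[OF c2] len by simp
  have "norm (expectation (XZ h)) \<le> expectation (\<lambda>w. norm (XZ h w))"
    by (rule integral_norm_bound)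
  also have "\<dots> = expectation (\<lambda>w. \<Prod>e\<in>edges h. norm (Z e w) ^ cnt h e)"
    by (simp add: norm_XP[OF lf finite_edges order_refl])
  also have "\<dots> = (\<Prod>e\<in>edges h. expectation (\<lambda>w. norm (Z e w) ^ cnt h e))"
    by (rule expectation_prod_norm[OF finite_edges F])
  also have "\<dots> \<le> (\<Prod>e\<in>edges h. s\<^sup>2 * K ^ (cnt h e - 2))"
    using F c2 by (intro prod_mono conjI expectation_norm_pow_le Bochner_Integration.integral_nonneg) auto
  also have "\<dots> = (s\<^sup>2) ^ ?E * K ^ thirdc h"
    using mE len by (simp add: prod.distrib power_sum[symmetric] sum_cnt_minus_2[OF c2] card_edges)
  also have "\<dots> = (s * sqrt N) ^ m * ((1 / N) ^ ?E * (K / (s * sqrt N)) ^ thirdc h)"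
  proof -
    have a: "(s * sqrt N) ^ m = (s\<^sup>2 * N) ^ ?E * (s * sqrt N) ^ thirdc h"
      unfolding mE power_add power_mult using N by (simp add: power_mult_distrib)
    have b: "(s\<^sup>2 * N) ^ ?E * (1 / N) ^ ?E = (s\<^sup>2) ^ ?E"
      unfolding power_mult_distrib[symmetric] using N by simp
    have c: "(s * sqrt N) ^ thirdc h * (K / (s * sqrt N)) ^ thirdc h = K ^ thirdc h"
      unfolding power_mult_distrib[symmetric] using N s_pos by simp
    have "x * y * (z * u) = (x * z) * (y * u)" for x y z u :: real by (simp only: mult_ac)
    from this[of "(s\<^sup>2 * N) ^ ?E"] show ?thesis unfolding a b[symmetric] c[symmetric] by (rule sym)
  qed
  finally show ?thesis using lf by simp
qed

abbreviation WS :: "nat \<Rightarrow> nat set \<Rightarrow> nat \<Rightarrow> nat \<Rightarrow> 'w \<Rightarrow> quat" where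
  "WS n T r m w \<equiv> walk_sum (\<lambda>e. Z e w) (root_at T n r) r m r"

lemma edges_upper:
  assumes "set h \<subseteq> {1..n}" "loopfree h"
  shows "edges h \<subseteq> upper"
  using assms by (induction h rule: newc.induct) (auto simp: edges_Cons edge_def, auto simp: edges_def)

lemma walk_in_range:
  assumes "r \<in> {1..n}" "h \<in> walks (root_at T n r) r m"
  shows "set h \<subseteq> {1..n}"
  by (rule walks_subset[OF assms(2) root_at_subset]) (use assms in auto)

lemma expectation_WS:
  "expectation (WS n T r m) = (\<Sum>h\<in>walks (root_at T n r) r m. of_bool (hd h = r) *\<^sub>R expectation (XZ h))"
  unfolding walk_sum_def
  by (subst Bochner_Integration.integral_sum) (auto intro: integrable_scaleR_right XZ_integrable)

lemma WS_integrable: "integrable M (WS n T r m)"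
  unfolding walk_sum_def by (intro Bochner_Integration.integrable_sum integrable_scaleR_right XZ_integrable)

lemma root_at_card: "r \<in> {1..n} \<Longrightarrow> finite (root_at T n r i)" "r \<in> {1..n} \<Longrightarrow> real (card (root_at T n r i)) \<le> real n"
  by (auto simp: root_at_def)

lemma walk_bound:
  assumes r: "r \<in> {1..n}" and h: "h \<in> walks (root_at T n r) r m"
  shows "norm (of_bool (hd h = r) *\<^sub>R expectation (XZ h)) \<le> of_bool (loopfree h) *
    ((s * sqrt (real n)) ^ m * ((1 / real n) ^ (newc h + cycc h) * (K / (s * sqrt (real n))) ^ thirdc h))"
proof (cases "loopfree h")
  case True
  have "norm (of_bool (hd h = r) *\<^sub>R expectation (XZ h)) \<le> norm (expectation (XZ h))" by simp
  also have "\<dots> \<le> of_bool (loopfree h) * ((s * sqrt (real n)) ^ m *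
      ((1 / real n) ^ (newc h + cycc h) * (K / (s * sqrt (real n))) ^ thirdc h))"
    using r walks_basic(1)[OF h] by (intro expectation_XZ_bound edges_upper[OF walk_in_range[OF r h] True]) auto
  finally show ?thesis .
qed (simp add: XP_not_loopfree)

lemma WS_upper:
  assumes r: "r \<in> {1..n}" and t: "t \<ge> 1"
  shows "norm (expectation (WS n T r m)) \<le> (s * sqrt (real n)) ^ m *
    (2 + real m * (t\<^sup>2 / real n + 1 / t + K / (s * sqrt (real n)) * t)) ^ m"
proof -
  let ?V = "root_at T n r" and ?c = "(s * sqrt (real n)) ^ m" and ?k = "K / (s * sqrt (real n))"
  have n: "real n > 0" using r by simp
  have c: "0 \<le> ?c" "0 \<le> ?k" using s_pos K_nonneg by auto
  have "norm (expectation (WS n T r m)) \<le> (\<Sum>h\<in>walks ?V r m. of_bool (loopfree h) *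
      (?c * ((1 / real n) ^ (newc h + cycc h) * ?k ^ thirdc h)))"
    unfolding expectation_WS by (intro order.trans[OF norm_sum] sum_mono walk_bound[OF r])
  also have "\<dots> = ?c * (\<Sum>h\<in>walks ?V r m. if loopfree h then (1 / real n) ^ newc h * (1 / real n) ^ cycc h * ?k ^ thirdc h else 0)"
    unfolding sum_distrib_left by (intro sum.cong refl) (simp add: power_add)
  also have "\<dots> = ?c * (\<Sum>h | h \<in> walks ?V r m \<and> loopfree h. (1 / real n) ^ newc h * (1 / real n) ^ cycc h * ?k ^ thirdc h)"
    using finite_walks[of ?V r m] root_at_card[OF r] by (simp add: sum.inter_filter)
  also have "\<dots> \<le> ?c * (2 + real m * (1 / real n * t\<^sup>2 + 1 / t + ?k * t)) ^ m"
    using n t c root_at_card[OF r] by (intro mult_left_mono sum_walks_le) auto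
  finally show ?thesis by (simp only: times_divide_eq_left mult_1_left)
qed

end

text \<open>Lower bounds need the value of the tree-like contribution and not just an upper
  estimate, hence an exact second moment.\<close>

locale rand_array_exact = rand_array +
  assumes second_eq: "\<And>j k. 1 \<le> j \<Longrightarrow> j < k \<Longrightarrow> expectation (\<lambda>w. (norm (Z (j, k) w))\<^sup>2) = s\<^sup>2"
begin

lemma expectation_XZ_good:
  assumes F: "edges h \<subseteq> upper" and st: "stk h = [r]" and len: "length h = m + 1" and N: "N > 0"
  shows "expectation (XZ h) = ((s * sqrt N) ^ m * (1 / N) ^ newc h) *\<^sub>R qone"
proof -
  have "stk h \<noteq> []" using st by simp
  note P = stk_props[OF this]
  have m: "m = 2 * newc h" using P st len by (auto simp: st)
  have card: "card (edges h) = newc h" using P by (simp add: card_edges)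
  have int: "integrable M (\<lambda>w. \<Prod>e\<in>edges h. (norm (Z e w))\<^sup>2)"
  proof (rule integrable_const_bound[where B = "\<Prod>e\<in>edges h. K\<^sup>2"])
    have "(\<Prod>e\<in>edges h. (norm (Z e w))\<^sup>2) \<le> (\<Prod>e\<in>edges h. K\<^sup>2)" for w
      by (intro prod_mono conjI power_mono bdd) auto
    then show "AE w in M. norm (\<Prod>e\<in>edges h. (norm (Z e w))\<^sup>2) \<le> (\<Prod>e\<in>edges h. K\<^sup>2)"
      by (intro AE_I2) (simp add: abs_of_nonneg prod_nonneg)
  qed measurable
  have "expectation (XZ h) = expectation (\<lambda>w. (\<Prod>e\<in>edges h. (norm (Z e w))\<^sup>2) *\<^sub>R qone)"
    by (simp add: XP_closed_stk[OF st])
  also have "\<dots> = expectation (\<lambda>w. \<Prod>e\<in>edges h. (norm (Z e w))\<^sup>2) *\<^sub>R qone"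
    using int by (intro integral_scaleR_left) auto
  also have "expectation (\<lambda>w. \<Prod>e\<in>edges h. (norm (Z e w))\<^sup>2) = (\<Prod>e\<in>edges h. expectation (\<lambda>w. (norm (Z e w))\<^sup>2))"
    by (rule expectation_prod_norm[OF finite_edges F])
  also have "\<dots> = (\<Prod>e\<in>edges h. s\<^sup>2)"
    using F second_eq by (intro prod.cong refl) auto
  also have "\<dots> = (s * sqrt N) ^ m * (1 / N) ^ newc h"
    unfolding m power_mult using N by (simp add: card power_mult_distrib power_divide)
  finally show ?thesis .
qed

text \<open>Walks are sorted by \<open>stk\<close>. The closed tree-like ones have explicit
  expectations and sum to \<open>jw\<close> up to \<open>good_sum_close\<close>; a loop-free walk
  with empty stack has a cyclic or third step by \<open>bad_walk\<close> and gains the factor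
  \<eta>.\<close>

lemma WS_asymptotic:
  assumes r: "r \<in> {1..n}" and t: "t \<ge> 1" and \<eta>: "0 < \<eta>" "\<eta> \<le> 1" and m: "m \<le> n"
  shows "norm (expectation (WS n T r m) - ((s * sqrt (real n)) ^ m * jw T m 0) *\<^sub>R qone) \<le>
    (s * sqrt (real n)) ^ m * (jw T m 0 * (real m)\<^sup>2 / real n +
     \<eta> * (2 + real m * (t\<^sup>2 / (real n * \<eta>) + 1 / t + K / (s * sqrt (real n)) * t / \<eta>)) ^ m)"
proof -
  let ?V = "root_at T n r" and ?c = "(s * sqrt (real n)) ^ m" and ?k = "K / (s * sqrt (real n))"
  let ?W = "walks ?V r m"
  have n: "real n > 0" using r by simp
  have c: "0 \<le> ?c" "0 \<le> ?k" using s_pos K_nonneg by auto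
  have finW: "finite ?W" using root_at_card(1)[OF r] by (rule finite_walks)
  let ?f = "\<lambda>h. of_bool (hd h = r) *\<^sub>R expectation (XZ h)"
  have good: "(\<Sum>h | h \<in> ?W \<and> stk h \<noteq> []. ?f h) = (?c * good_sum T n r m 0) *\<^sub>R qone"
  proof -
    have "(\<Sum>h | h \<in> ?W \<and> stk h \<noteq> []. ?f h) = (\<Sum>h\<in>?W. if stk h \<noteq> [] then ?f h else 0)"
      using finW by (rule sum.inter_filter)
    also have "\<dots> =
      (\<Sum>h\<in>?W. (of_bool (stk h \<noteq> [] \<and> length (stk h) = Suc 0) * (?c * (1 / real n) ^ newc h)) *\<^sub>R qone)"
    proof (intro sum.cong refl)
      fix h assume h: "h \<in> ?W"
      show "(if stk h \<noteq> [] then ?f h else 0) =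
        (of_bool (stk h \<noteq> [] \<and> length (stk h) = Suc 0) * (?c * (1 / real n) ^ newc h)) *\<^sub>R qone"
      proof (cases "stk h = []")
        case False
        note P = stk_props[OF False]
        then have P1: "hd (stk h) = hd h" "last (stk h) = last h" "distinct (stk h)" by blast+
        have l: "last h = r" "length h = m + 1" using walks_basic[OF h] by auto
        \<comment> \<open>A distinct stack whose first and last elements are both \<open>r\<close>
          has length 1.\<close>
        have eq: "hd h = r \<longleftrightarrow> stk h = [r]"
        proof
          assume "hd h = r"
          then have "hd (stk h) = r" "last (stk h) = r" using P1 l(1) by auto
          then show "stk h = [r]" using False P1(3) by (cases "stk h") (auto split: if_splits)
        next
          assume "stk h = [r]"
          then have "hd (stk h) = r" by simp
          then show "hd h = r" using P1(1) by simp
        qed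
        have eq2: "length (stk h) = Suc 0 \<longleftrightarrow> stk h = [r]"
        proof
          assume "length (stk h) = Suc 0"
          then obtain a where "stk h = [a]" by (cases "stk h") auto
          moreover have "last (stk h) = r" using P1(2) l(1) by simp
          ultimately show "stk h = [r]" by simp
        qed simp
        have lf: "loopfree h" using P by blast
        show ?thesis
        proof (cases "stk h = [r]")
          case True
          from expectation_XZ_good[OF edges_upper[OF walk_in_range[OF r h] lf] this l(2) n]
          show ?thesis using eq True by simp
        next
          case F2: False
          then show ?thesis using eq eq2 by simp
        qed
      qed simp
    qed
    also have "\<dots> = (?c * good_sum T n r m 0) *\<^sub>R qone"
      unfolding good_sum_def scaleR_left.sum[symmetric] sum_distrib_left root_at_def
      by (simp add: mult.left_commute)
    finally show ?thesis .
  qed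
  have bad: "norm (\<Sum>h | h \<in> ?W \<and> stk h = []. ?f h) \<le>
      ?c * (\<eta> * (2 + real m * (t\<^sup>2 / (real n * \<eta>) + 1 / t + ?k * t / \<eta>)) ^ m)"
  proof -
    have "norm (\<Sum>h | h \<in> ?W \<and> stk h = []. ?f h) \<le>
      (\<Sum>h | h \<in> ?W \<and> stk h = []. of_bool (loopfree h) * (?c * ((1 / real n) ^ (newc h + cycc h) * ?k ^ thirdc h)))"
      by (intro order.trans[OF norm_sum] sum_mono walk_bound[OF r]) auto
    also have "\<dots> \<le> (\<Sum>h | h \<in> ?W \<and> loopfree h \<and> cycc h + thirdc h \<ge> 1. ?c * ((1 / real n) ^ (newc h + cycc h) * ?k ^ thirdc h))"
    proof -
      have "(\<Sum>h | h \<in> ?W \<and> stk h = []. of_bool (loopfree h) * (?c * ((1 / real n) ^ (newc h + cycc h) * ?k ^ thirdc h)))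
        = (\<Sum>h | h \<in> ?W \<and> stk h = [] \<and> loopfree h. ?c * ((1 / real n) ^ (newc h + cycc h) * ?k ^ thirdc h))"
        using finW by (intro sum.mono_neutral_cong_right) auto
      also have "\<dots> \<le> (\<Sum>h | h \<in> ?W \<and> loopfree h \<and> cycc h + thirdc h \<ge> 1. ?c * ((1 / real n) ^ (newc h + cycc h) * ?k ^ thirdc h))"
      proof (rule sum_mono2)
        show "{h. h \<in> ?W \<and> stk h = [] \<and> loopfree h} \<subseteq> {h. h \<in> ?W \<and> loopfree h \<and> cycc h + thirdc h \<ge> 1}"
          using bad_walk walks_basic(2) by blast
        show "0 \<le> ?c * ((1 / real n) ^ (newc h + cycc h) * ?k ^ thirdc h)" for h
          using c by (intro mult_nonneg_nonneg zero_le_power)  (use s_pos K_nonneg in simp_all)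
      qed (use finW in simp)
      finally show ?thesis .
    qed
    also have "\<dots> \<le> ?c * (\<eta> * (2 + real m * (t\<^sup>2 / (real n * \<eta>) + 1 / t + ?k * t / \<eta>)) ^ m)"
      unfolding sum_distrib_left[symmetric]
      using n c t \<eta> root_at_card[OF r] by (intro mult_left_mono sum_bad_walks_le) auto
    finally show ?thesis .
  qed
  have "expectation (WS n T r m) = (\<Sum>h | h \<in> ?W \<and> stk h \<noteq> []. ?f h) + (\<Sum>h | h \<in> ?W \<and> stk h = []. ?f h)"
    unfolding expectation_WS using finW
    by (subst sum.union_disjoint[symmetric]) (auto intro!: sum.cong)
  then have "expectation (WS n T r m) - (?c * jw T m 0) *\<^sub>R qone =
      (?c * (good_sum T n r m 0 - jw T m 0)) *\<^sub>R qone + (\<Sum>h | h \<in> ?W \<and> stk h = []. ?f h)"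
    by (simp add: good algebra_simps)
  also have "norm \<dots> \<le> \<bar>?c * (good_sum T n r m 0 - jw T m 0)\<bar> +
      ?c * (\<eta> * (2 + real m * (t\<^sup>2 / (real n * \<eta>) + 1 / t + ?k * t / \<eta>)) ^ m)"
    by (rule order.trans[OF norm_triangle_ineq add_mono[OF _ bad]]) simp
  also have "\<bar>?c * (good_sum T n r m 0 - jw T m 0)\<bar> \<le> ?c * (jw T m 0 * (real m)\<^sup>2 / real n)"
    unfolding abs_mult abs_of_nonneg[OF c(1)] by (rule mult_left_mono[OF good_sum_close[OF r m] c(1)])
  finally show ?thesis by (simp only: distrib_left)
qed

end

section \<open>Trace bounds and second moments of diagonal entries\<close>

lemma linear_Rq: "linear Rq"
  by (rule bounded_linear.linear[OF bounded_linear_Rq])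

lemma Rq_scaleR: "Rq (c *\<^sub>R q) = c * Rq q"
  by (simp add: linear_scale[OF linear_Rq])

text \<open>The even power makes the trace bound two-sided: a maximiser for the negated array is an
  eigenvector of \<open>X\<close> for the opposite eigenvalue.\<close>

lemma ray_le_of_trace:
  assumes X: "herm X n" and n: "n \<ge> 1" and p: "p \<ge> 1" and C: "C \<ge> 0"
    and tr: "(\<Sum>i\<in>{1..n}. Rq (qpow X n (2 * p) i i)) \<le> C ^ (2 * p)"
  shows "\<bar>ray X n u u\<bar> \<le> C * nsq n u"
proof -
  have le: "\<bar>c\<bar> \<le> C" if "nsq n w = 1" "\<And>j. j \<in> {1..n} \<Longrightarrow> mvec X n w j = c *\<^sub>R w j" for c w
  proof -
    have "c ^ (2 * p) \<le> C ^ (2 * p)" using trace_power_bound[OF X that] tr by (rule order.trans)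
    then have "\<bar>c\<bar> ^ (2 * p) \<le> C ^ (2 * p)" by (simp add: power_even_abs)
    then show ?thesis using C p by (simp add: power_mono_iff)
  qed
  have mv: "mvec (\<lambda>j k. - X j k) n w j = - mvec X n w j" for w j
    by (simp add: mvec_def qmul.minus_left sum_negf)
  have X': "herm (\<lambda>j k. - X j k) n"
    unfolding herm_def
  proof (intro ballI)
    fix j k assume "j \<in> {1..n}" "k \<in> {1..n}"
    then have "X k j = quat_cnj (X j k)" using X unfolding herm_def by blast
    then show "- X k j = quat_cnj (- X j k)" by (simp add: linear_neg[OF linear_quat_cnj])
  qed
  let ?a = "max_eigenvalue (quat_corner X n)" and ?b = "max_eigenvalue (quat_corner (\<lambda>j k. - X j k) n)"
  obtain w where w: "nsq n w = 1" "\<forall>j\<in>{1..n}. mvec X n w j = ?a *\<^sub>R w j"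
    using max_eigenvalue_quat_corner(2)[OF X n] by blast
  then have a: "?a \<le> C" using le[of w ?a] by auto
  obtain v where v: "nsq n v = 1" "\<forall>j\<in>{1..n}. mvec (\<lambda>j k. - X j k) n v j = ?b *\<^sub>R v j"
    using max_eigenvalue_quat_corner(2)[OF X' n] by blast
  have "mvec X n v j = (- ?b) *\<^sub>R v j" if "j \<in> {1..n}" for j
  proof -
    have e: "- mvec X n v j = ?b *\<^sub>R v j" using v(2) that unfolding mv by blast
    have "mvec X n v j = - (- mvec X n v j)" by simp
    then show ?thesis unfolding e scaleR_minus_left .
  qed
  then have b: "?b \<le> C" using le[of v "- ?b"] v(1) by auto
  have "ray X n u u \<le> C * nsq n u"
    using max_eigenvalue_quat_corner(1)[OF X n, of u] mult_right_mono[OF a nsq_nonneg[of n u]] by linarith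
  moreover have "ray (\<lambda>j k. - X j k) n u u = - ray X n u u"
    by (simp add: ray_def mv sum_negf)
  then have "- ray X n u u \<le> C * nsq n u"
    using max_eigenvalue_quat_corner(1)[OF X' n, of u] mult_right_mono[OF b nsq_nonneg[of n u]] by linarith
  ultimately show ?thesis by linarith
qed

context rand_array
begin

abbreviation qpZ :: "nat \<Rightarrow> nat \<Rightarrow> nat \<Rightarrow> 'w \<Rightarrow> quat" where
  "qpZ n m i w \<equiv> qpow (harr (\<lambda>e. Z e w)) n m i i"

abbreviation trZ :: "nat \<Rightarrow> nat \<Rightarrow> 'w \<Rightarrow> real" where
  "trZ n m w \<equiv> (\<Sum>i\<in>{1..n}. Rq (qpZ n m i w))"

lemma qpZ_eq_WS: "i \<in> {1..n} \<Longrightarrow> m \<ge> 1 \<Longrightarrow> qpZ n m i w = WS n {m} i m w"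
  using walk_sum_root_at_first[of i n m "{m}" "\<lambda>e. Z e w" i] by simp

lemma integral_Rq: "integrable M f \<Longrightarrow> expectation (\<lambda>w. Rq (f w)) = Rq (expectation f)"
  by (rule integral_bounded_linear[OF bounded_linear_Rq])

lemma integrable_Rq: "integrable M f \<Longrightarrow> integrable M (\<lambda>w. Rq (f w))"
  by (rule integrable_bounded_linear[OF bounded_linear_Rq])

lemma trZ_integrable: "m \<ge> 1 \<Longrightarrow> integrable M (trZ n m)"
  by (intro Bochner_Integration.integrable_sum) (simp add: qpZ_eq_WS integrable_Rq WS_integrable)

lemma expectation_trZ_le:
  assumes m: "m \<ge> 1" and t: "t \<ge> 1"
  shows "expectation (trZ n m) \<le> real n * ((s * sqrt (real n)) ^ m *
    (2 + real m * (t\<^sup>2 / real n + 1 / t + K / (s * sqrt (real n)) * t)) ^ m)"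
proof -
  have "expectation (trZ n m) = (\<Sum>i\<in>{1..n}. expectation (\<lambda>w. Rq (qpZ n m i w)))"
    using m by (intro Bochner_Integration.integral_sum) (simp add: qpZ_eq_WS integrable_Rq WS_integrable)
  also have "\<dots> \<le> (\<Sum>i\<in>{1..n}. (s * sqrt (real n)) ^ m *
    (2 + real m * (t\<^sup>2 / real n + 1 / t + K / (s * sqrt (real n)) * t)) ^ m)"
  proof (rule sum_mono)
    fix i assume i: "i \<in> {1..n}"
    have "expectation (\<lambda>w. Rq (qpZ n m i w)) = Rq (expectation (WS n {m} i m))"
      using i m by (simp add: qpZ_eq_WS integral_Rq WS_integrable)
    also have "\<dots> \<le> norm (expectation (WS n {m} i m))" using Rq_le_norm abs_le_D1 by blast
    also note WS_upper[OF i t]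
    finally show "expectation (\<lambda>w. Rq (qpZ n m i w)) \<le> (s * sqrt (real n)) ^ m *
      (2 + real m * (t\<^sup>2 / real n + 1 / t + K / (s * sqrt (real n)) * t)) ^ m" .
  qed
  finally show ?thesis by simp
qed

lemma trZ_prob:
  assumes p: "p \<ge> 1" and t: "t \<ge> 1" and n: "n \<ge> 1" and \<rho>: "\<rho> > 0"
    and B: "2 + real (2 * p) * (t\<^sup>2 / real n + 1 / t + K / (s * sqrt (real n)) * t) \<le> B"
  shows "prob {w \<in> space M. trZ n (2 * p) w \<ge> (\<rho> * sqrt (real n)) ^ (2 * p)} \<le> real n * (s * B / \<rho>) ^ (2 * p)"
proof -
  let ?b = "2 + real (2 * p) * (t\<^sup>2 / real n + 1 / t + K / (s * sqrt (real n)) * t)"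
  have b0: "0 \<le> ?b" using t s_pos K_nonneg by simp
  have pos: "0 < (\<rho> * sqrt (real n)) ^ (2 * p)" using \<rho> n by simp
  have nn: "AE w in M. 0 \<le> trZ n (2 * p) w"
    by (intro AE_I2 sum_nonneg) (simp add: Rq_qpow_even[OF herm_harr] sum_nonneg)
  have "prob {w \<in> space M. trZ n (2 * p) w \<ge> (\<rho> * sqrt (real n)) ^ (2 * p)}
    \<le> expectation (trZ n (2 * p)) / (\<rho> * sqrt (real n)) ^ (2 * p)"
    using p by (intro integral_Markov_inequality_measure[OF trZ_integrable sets.empty_sets nn pos]) auto
  also have "\<dots> \<le> real n * ((s * sqrt (real n)) ^ (2 * p) * ?b ^ (2 * p)) / (\<rho> * sqrt (real n)) ^ (2 * p)"
    using p expectation_trZ_le[OF _ t, of "2 * p" n] pos by (intro divide_right_mono) auto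
  also have "\<dots> \<le> real n * ((s * sqrt (real n)) ^ (2 * p) * B ^ (2 * p)) / (\<rho> * sqrt (real n)) ^ (2 * p)"
    using b0 B pos s_pos by (intro divide_right_mono mult_left_mono power_mono) auto
  also have "\<dots> = real n * (s * B / \<rho>) ^ (2 * p)"
  proof -
    have "(s * sqrt (real n)) * B / (\<rho> * sqrt (real n)) = s * B / \<rho>" using n by simp
    then show ?thesis by (simp only: power_mult_distrib[symmetric] power_divide[symmetric] times_divide_eq_right[symmetric])
  qed
  finally show ?thesis .
qed

end

context rand_array_exact
begin

text \<open>After expanding the square, the quadratic term is a sum over walks pinned at
  \<open>k\<close> and \<open>2 * k\<close> and the linear one a sum over walks pinned at
  \<open>k\<close>. The main terms cancel by \<open>jw_double\<close> and only the errors of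
  \<open>WS_asymptotic\<close> remain.\<close>

lemma second_moment_qpZ:
  fixes k n :: nat and \<eta> :: real
  assumes k: "k \<ge> 1" and n: "2 * k \<le> n" and \<eta>: "0 < \<eta>" "\<eta> \<le> 1"
  defines "c \<equiv> jw {} k 0" and "B \<equiv> \<lambda>m. 2 + real m * (1 / (real n * \<eta>) + 1 + K / (s * sqrt (real n)) / \<eta>)"
  shows "integrable M (\<lambda>w. (Rq (qpZ n k 1 w) / sqrt (real n) ^ k - s ^ k * c)\<^sup>2)"
    and "expectation (\<lambda>w. (Rq (qpZ n k 1 w) / sqrt (real n) ^ k - s ^ k * c)\<^sup>2) \<le>
      s ^ (2 * k) * ((c\<^sup>2 * (2 * real k)\<^sup>2 / real n + \<eta> * B (2 * k) ^ (2 * k))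
        + 2 * c * (c * (real k)\<^sup>2 / real n + \<eta> * B k ^ k))"
proof -
  let ?q = "sqrt (real n) ^ k"
  have r: "1 \<in> {1..n}" using n k by auto
  have n0: "n \<ge> 1" using n k by linarith
  have q: "?q > 0" using n0 by simp
  have q2: "sqrt (real n) ^ (2 * k) = ?q\<^sup>2" by (simp add: power_mult[symmetric] mult.commute)
  have c0: "0 \<le> c" by (simp add: c_def jw_nonneg)
  define f where "f w = Rq (qpZ n k 1 w)" for w
  have f1: "f w = Rq (WS n {k} 1 k w)" for w unfolding f_def using qpZ_eq_WS[OF r k] by simp
  have f2: "(f w)\<^sup>2 = Rq (WS n {k, 2 * k} 1 (2 * k) w)" for w
  proof -
    \<comment> \<open>A diagonal entry of a power of a Hermitian array is self-conjugate, hence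
      real, so its quaternion square is the square of its real part.\<close>
    have "qpZ n k 1 w = f w *\<^sub>R qone"
      unfolding f_def by (rule self_cnj) (rule qpow_cnj[OF herm_harr r r])
    then have "qpZ n k 1 w \<diamond> qpZ n k 1 w = (f w)\<^sup>2 *\<^sub>R qone"
      by (simp add: qmul.scaleR_left power2_eq_square)
    then show ?thesis unfolding walk_sum_root_at_twice[OF r k] by (simp add: Rq_scaleR)
  qed
  have i1: "integrable M f" unfolding f1 by (intro integrable_Rq WS_integrable)
  have i2: "integrable M (\<lambda>w. (f w)\<^sup>2)" unfolding f2 by (intro integrable_Rq WS_integrable)
  have ex: "(f w / ?q - s ^ k * c)\<^sup>2 = (f w)\<^sup>2 / ?q\<^sup>2 - 2 * s ^ k * c / ?q * f w + (s ^ k * c)\<^sup>2" for w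
    using q by (simp add: power2_diff power_divide)
  show "integrable M (\<lambda>w. (Rq (qpZ n k 1 w) / ?q - s ^ k * c)\<^sup>2)"
    unfolding f_def[symmetric] ex using i1 i2 by simp
  have key: "\<bar>expectation (\<lambda>w. Rq (WS n T 1 m w)) / sqrt (real n) ^ m - s ^ m * jw T m 0\<bar>
      \<le> s ^ m * (jw T m 0 * (real m)\<^sup>2 / real n + \<eta> * B m ^ m)" if "m \<le> n" for T m
  proof -
    let ?p = "sqrt (real n) ^ m"
    have p: "?p > 0" using n0 by simp
    have "\<bar>expectation (\<lambda>w. Rq (WS n T 1 m w)) - (s * sqrt (real n)) ^ m * jw T m 0\<bar>
        = \<bar>Rq (expectation (WS n T 1 m) - ((s * sqrt (real n)) ^ m * jw T m 0) *\<^sub>R qone)\<bar>"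
      by (simp add: integral_Rq WS_integrable linear_diff[OF linear_Rq] Rq_scaleR)
    also have "\<dots> \<le> norm (expectation (WS n T 1 m) - ((s * sqrt (real n)) ^ m * jw T m 0) *\<^sub>R qone)"
      by (rule Rq_le_norm)
    \<comment> \<open>Here \<open>t = 1\<close> is enough: for a walk length independent of
      \<open>n\<close> the base \<open>B m\<close> need only stay bounded, and smallness comes from
      \<eta>.\<close>
    also have "\<dots> \<le> (s * sqrt (real n)) ^ m * (jw T m 0 * (real m)\<^sup>2 / real n + \<eta> * B m ^ m)"
      using WS_asymptotic[OF r order_refl \<eta> that, of T] by (simp add: B_def)
    finally have "\<bar>expectation (\<lambda>w. Rq (WS n T 1 m w)) - (s * sqrt (real n)) ^ m * jw T m 0\<bar> / ?p
        \<le> (s * sqrt (real n)) ^ m * (jw T m 0 * (real m)\<^sup>2 / real n + \<eta> * B m ^ m) / ?p"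
      using p by (intro divide_right_mono) auto
    moreover have "\<bar>expectation (\<lambda>w. Rq (WS n T 1 m w)) - (s * sqrt (real n)) ^ m * jw T m 0\<bar> / ?p
        = \<bar>expectation (\<lambda>w. Rq (WS n T 1 m w)) / ?p - s ^ m * jw T m 0\<bar>"
    proof -
      have "\<bar>x\<bar> / ?p = \<bar>x / ?p\<bar>" for x using p by (simp only: abs_divide abs_of_pos)
      moreover have "(x - (s * sqrt (real n)) ^ m * y) / ?p = x / ?p - s ^ m * y" for x y
        using n0 by (simp add: diff_divide_distrib power_mult_distrib)
      ultimately show ?thesis by (simp only:)
    qed
    moreover have "(s * sqrt (real n)) ^ m * x / ?p = s ^ m * x" for x
      using n0 by (simp add: power_mult_distrib)
    ultimately show ?thesis by simp
  qed
  have a1: "\<bar>expectation f / ?q - s ^ k * c\<bar> \<le> s ^ k * (c * (real k)\<^sup>2 / real n + \<eta> * B k ^ k)"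
    using key[of k "{k}"] n unfolding f1[abs_def] c_def by (simp only: jw_single[OF k])
  have a2: "\<bar>expectation (\<lambda>w. (f w)\<^sup>2) / ?q\<^sup>2 - s ^ (2 * k) * c\<^sup>2\<bar>
      \<le> s ^ (2 * k) * (c\<^sup>2 * (2 * real k)\<^sup>2 / real n + \<eta> * B (2 * k) ^ (2 * k))"
    using key[of "2 * k" "{k, 2 * k}"] n unfolding f2 c_def q2 jw_double[OF k] of_nat_mult of_nat_numeral by simp
  have s2: "s ^ (2 * k) = (s ^ k)\<^sup>2" by (simp add: power_mult[symmetric] mult.commute)
  have id1: "x - 2 * a * b / q' * y + (a * b)\<^sup>2 = (x - a\<^sup>2 * b\<^sup>2) + 2 * a * b * (a * b - y / q')"
    for x a b q' y :: real by (simp add: power2_eq_square algebra_simps)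
  have id2: "a\<^sup>2 * x + 2 * a * b * (a * y) = a\<^sup>2 * (x + 2 * b * y)" for x a b y :: real
    by (simp add: power2_eq_square algebra_simps)
  have "expectation (\<lambda>w. (f w / ?q - s ^ k * c)\<^sup>2) =
      expectation (\<lambda>w. (f w)\<^sup>2) / ?q\<^sup>2 - 2 * s ^ k * c / ?q * expectation f + (s ^ k * c)\<^sup>2"
    unfolding ex using i1 i2 by (simp add: prob_space)
  also have "\<dots> = (expectation (\<lambda>w. (f w)\<^sup>2) / ?q\<^sup>2 - s ^ (2 * k) * c\<^sup>2)
      + 2 * s ^ k * c * (s ^ k * c - expectation f / ?q)"
    unfolding s2 by (rule id1)
  also have "\<dots> \<le> s ^ (2 * k) * (c\<^sup>2 * (2 * real k)\<^sup>2 / real n + \<eta> * B (2 * k) ^ (2 * k))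
      + 2 * s ^ k * c * (s ^ k * (c * (real k)\<^sup>2 / real n + \<eta> * B k ^ k))"
    using a1 a2 c0 s_pos by (intro add_mono mult_left_mono) auto
  also have "\<dots> = s ^ (2 * k) * ((c\<^sup>2 * (2 * real k)\<^sup>2 / real n + \<eta> * B (2 * k) ^ (2 * k))
        + 2 * c * (c * (real k)\<^sup>2 / real n + \<eta> * B k ^ k))"
    unfolding s2 by (rule id2)
  finally show "expectation (\<lambda>w. (Rq (qpZ n k 1 w) / ?q - s ^ k * c)\<^sup>2) \<le>
      s ^ (2 * k) * ((c\<^sup>2 * (2 * real k)\<^sup>2 / real n + \<eta> * B (2 * k) ^ (2 * k))
        + 2 * c * (c * (real k)\<^sup>2 / real n + \<eta> * B k ^ k))"
    unfolding f_def .
qed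

end

section \<open>Almost sure limits for truncated arrays\<close>

text \<open>Markov's inequality and Borel-Cantelli for each of the countably many thresholds
  \<open>1 / Suc j\<close>.\<close>

lemma (in prob_space) AE_tendsto_0_of_summable:
  fixes f :: "nat \<Rightarrow> 'a \<Rightarrow> real"
  assumes int: "\<And>i. i \<ge> i0 \<Longrightarrow> integrable M (f i)" and nn: "\<And>i w. 0 \<le> f i w"
    and b: "\<And>i. i \<ge> i0 \<Longrightarrow> expectation (f i) \<le> g i" and sm: "summable g"
  shows "AE w in M. (\<lambda>i. f i w) \<longlonglongrightarrow> 0"
proof -
  have "AE w in M. eventually (\<lambda>i. f i w < 1 / real (Suc j)) sequentially" for j
  proof -
    let ?e = "1 / real (Suc j)"
    define A where "A i = (if i \<ge> i0 then {w \<in> space M. f i w \<ge> ?e} else {})" for i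
    have [measurable]: "A i \<in> sets M" for i
    proof (cases "i \<ge> i0")
      case True
      then have [measurable]: "f i \<in> borel_measurable M" using int by blast
      show ?thesis unfolding A_def using True by simp
    qed (simp add: A_def)
    have pA: "prob (A i) \<le> real (Suc j) * \<bar>g i\<bar>" for i
    proof (cases "i \<ge> i0")
      case True
      have "prob {w \<in> space M. f i w \<ge> ?e} \<le> expectation (f i) / ?e"
        by (rule integral_Markov_inequality_measure[OF int[OF True] sets.empty_sets]) (auto simp: nn)
      also have "\<dots> \<le> real (Suc j) * \<bar>g i\<bar>"
      proof -
        have "expectation (f i) \<le> \<bar>g i\<bar>" using b[OF True] by linarith
        then show ?thesis by (simp add: mult.commute mult_left_mono)
      qed
      finally show ?thesis using True by (simp add: A_def)
    qed (simp add: A_def)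
    have "\<exists>N. \<forall>i\<ge>N. norm (g i) = \<bar>g i\<bar>" by simp
    have "summable (\<lambda>i. prob (A i))"
    proof (rule summable_comparison_test_ev)
      show "eventually (\<lambda>i. norm (prob (A i)) \<le> real (Suc j) * g i) sequentially"
        using eventually_ge_at_top[of i0]
      proof eventually_elim
        case (elim i)
        have "0 \<le> expectation (f i)" using nn by (intro Bochner_Integration.integral_nonneg) auto
        then have "\<bar>g i\<bar> = g i" using b[OF elim] by linarith
        then show ?case using pA[of i] by simp
      qed
      show "summable (\<lambda>i. real (Suc j) * g i)" using sm by (rule summable_mult)
    qed
    then have "AE w in M. eventually (\<lambda>i. w \<in> space M - A i) sequentially"
      by (intro borel_cantelli_AE1) (auto simp: emeasure_eq_measure)
    then show ?thesis
    proof (rule AE_mp, intro AE_I2 impI)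
      fix w assume "eventually (\<lambda>i. w \<in> space M - A i) sequentially"
      with eventually_ge_at_top[of i0] show "eventually (\<lambda>i. f i w < ?e) sequentially"
        by eventually_elim (auto simp: A_def not_le)
    qed
  qed
  then have "AE w in M. \<forall>j. eventually (\<lambda>i. f i w < 1 / real (Suc j)) sequentially"
    by (simp add: AE_all_countable)
  then show ?thesis
  proof (rule AE_mp, intro AE_I2 impI)
    fix w assume w: "\<forall>j. eventually (\<lambda>i. f i w < 1 / real (Suc j)) sequentially"
    show "(\<lambda>i. f i w) \<longlonglongrightarrow> 0"
    proof (rule tendstoI)
      fix e :: real assume "e > 0"
      then obtain j where "inverse (real (Suc j)) < e" using reals_Archimedean by blast
      then have j: "1 / real (Suc j) < e" by (simp add: inverse_eq_divide)
      show "eventually (\<lambda>i. dist (f i w) 0 < e) sequentially"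
        using w[rule_format, of j] by eventually_elim (use nn j in \<open>simp add: abs_of_nonneg\<close>)
    qed
  qed
qed

lemma (in prob_space) upper_as:
  fixes Z :: "nat \<Rightarrow> nat \<times> nat \<Rightarrow> 'a \<Rightarrow> quat"
  assumes ra: "\<And>n. n \<ge> 1 \<Longrightarrow> rand_array M (Z n) (2 * real n powr (7 / 16)) s" and e: "\<epsilon> > 0"
  shows "AE w in M. eventually (\<lambda>n. \<forall>u. \<bar>ray (harr (\<lambda>e. Z n e w)) n u u\<bar>
    \<le> (2 * s + \<epsilon>) * sqrt (real n) * nsq n u) sequentially"
proof -
  have s: "s > 0" using rand_array.s_pos[OF ra[OF order_refl]] .
  \<comment> \<open>\<open>s * B\<close> is \<open>2 * s + \<epsilon> / 2\<close>, midway between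
    \<open>2 * s\<close> and \<rho>, so \<open>q < 1\<close>. The factor \<open>A\<close> in the
    exponent turns \<open>q ^ (2 * p n)\<close> into at most \<open>n powr (- 4)\<close>, which
    survives the factor \<open>n\<close> of the trace and stays summable.\<close>
  define \<delta> B \<rho> q A where defs: "\<delta> = \<epsilon> / (2 * s)" "B = 2 + \<delta>" "\<rho> = 2 * s + \<epsilon>" "q = s * B / \<rho>" "A = 2 / (- ln q)"
  have \<delta>: "\<delta> > 0" and \<rho>: "\<rho> > 0" using s e by (auto simp: defs)
  have sB: "s * B = 2 * s + \<epsilon> / 2" using s by (simp add: defs field_simps)
  have q: "0 < q" "q < 1" using s e \<rho> by (auto simp: defs(4) sB) (simp add: defs)
  then have lq: "ln q < 0" by simp
  then have A: "A > 0" by (simp add: defs divide_neg_neg)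
  define p where "p n = nat \<lceil>A * ln (real n)\<rceil> + 1" for n
  \<comment> \<open>A small power of \<open>n\<close>: \<open>1 / t\<close> must beat the
    logarithmic length, while the third-step error, of order \<open>n powr (- 1 / 16)\<close> times
    \<open>t\<close>, must still tend to 0 faster than 1 over a logarithm.\<close>
  define t where "t n = real n powr (1 / 64)" for n :: nat
  have p_ge: "A * ln (real n) \<le> real (p n)" and p_le: "n \<ge> 1 \<Longrightarrow> real (p n) \<le> A * ln (real n) + 2" for n
  proof -
    show "A * ln (real n) \<le> real (p n)" unfolding p_def by linarith
    assume "n \<ge> 1"
    then have "0 \<le> A * ln (real n)" using A by simp
    then show "real (p n) \<le> A * ln (real n) + 2" unfolding p_def by linarith
  qed
  let ?D = "\<lambda>n. (t n)\<^sup>2 / real n + 1 / t n + 2 * real n powr (7 / 16) / (s * sqrt (real n)) * t n"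
  have "(\<lambda>n. 2 * (A * ln (real n) + 2) * ((real n powr (1 / 64))\<^sup>2 / real n + 1 / real n powr (1 / 64)
      + (2 / s) * (real n powr (7 / 16) / sqrt (real n) * real n powr (1 / 64)))) \<longlonglongrightarrow> 0"
    by real_asymp
  then have "eventually (\<lambda>n. 2 * (A * ln (real n) + 2) * ((real n powr (1 / 64))\<^sup>2 / real n + 1 / real n powr (1 / 64)
      + (2 / s) * (real n powr (7 / 16) / sqrt (real n) * real n powr (1 / 64))) < \<delta>) sequentially"
    using \<delta> by (rule order_tendstoD)
  then have ev: "eventually (\<lambda>n. 2 + real (2 * p n) * ?D n \<le> B) sequentially"
    using eventually_ge_at_top[of 1]
  proof eventually_elim
    case (elim n)
    have "0 \<le> ?D n" using s by (simp add: t_def)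
    then have 1: "2 * real (p n) * ?D n \<le> 2 * (A * ln (real n) + 2) * ?D n"
      using p_le[OF elim(2)] by (intro mult_right_mono) auto
    have 2: "?D n = (real n powr (1 / 64))\<^sup>2 / real n + 1 / real n powr (1 / 64)
      + (2 / s) * (real n powr (7 / 16) / sqrt (real n) * real n powr (1 / 64))"
      by (simp add: t_def)
    have "2 * real (p n) * ?D n \<le> \<delta>"
      using 1 elim(1) unfolding 2 by linarith
    then show ?case unfolding defs(2) of_nat_mult of_nat_numeral by (rule add_left_mono)
  qed
  define T where "T n w = (\<Sum>i\<in>{1..n}. Rq (qpow (harr (\<lambda>e. Z n e w)) n (2 * p n) i i))" for n w
  define E where "E n = (if n \<ge> 1 then {w \<in> space M. T n w \<ge> (\<rho> * sqrt (real n)) ^ (2 * p n)} else {})" for n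
  have [measurable]: "E n \<in> sets M" for n
  proof (cases "n \<ge> 1")
    case True
    interpret rand_array M "Z n" "2 * real n powr (7 / 16)" s by (rule ra[OF True])
    have [measurable]: "T n \<in> borel_measurable M"
      unfolding T_def by (rule borel_measurable_integrable[OF trZ_integrable]) (simp add: p_def)
    show ?thesis using True by (simp add: E_def)
  qed (simp add: E_def)
  have "summable (\<lambda>n. prob (E n))"
  proof (rule summable_comparison_test_ev)
    show "eventually (\<lambda>n. norm (prob (E n)) \<le> real n powr (- 3)) sequentially"
      using ev eventually_ge_at_top[of 1]
    proof eventually_elim
      case (elim n)
      interpret R: rand_array M "Z n" "2 * real n powr (7 / 16)" s by (rule ra[OF elim(2)])
      have t1: "t n \<ge> 1" using elim(2) by (simp add: t_def ge_one_powr_ge_zero)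
      have "prob (E n) \<le> real n * q ^ (2 * p n)"
        using R.trZ_prob[OF _ t1 elim(2) \<rho> elim(1)] elim(2) by (simp add: E_def T_def defs(4) p_def)
      also have "q ^ (2 * p n) = exp (real (2 * p n) * ln q)"
        by (simp only: exp_of_nat_mult exp_ln[OF q(1)])
      also have "\<dots> \<le> exp (2 * (A * ln (real n)) * ln q)"
        using lq p_ge[of n] by (auto intro!: mult_right_mono_neg)
      also have "2 * (A * ln (real n)) * ln q = - 4 * ln (real n)"
        using lq by (simp add: defs)
      also have "exp (- 4 * ln (real n)) = real n powr (- 4)"
        using elim(2) by (simp add: powr_def)
      finally have "prob (E n) \<le> real n * real n powr (- 4)"
        using elim(2) by (simp add: mult_left_mono)
      also have "\<dots> = real n powr (- 3)" using elim(2) powr_mult_base[of "real n" "-4"] by simp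
      finally show ?case by simp
    qed
    show "summable (\<lambda>n. real n powr (- 3))" by (subst summable_real_powr_iff) simp
  qed
  then have "AE w in M. eventually (\<lambda>n. w \<in> space M - E n) sequentially"
    by (intro borel_cantelli_AE1) (auto simp: emeasure_eq_measure)
  then show ?thesis
  proof (rule AE_mp, intro AE_I2 impI)
    fix w assume "eventually (\<lambda>n. w \<in> space M - E n) sequentially"
    then show "eventually (\<lambda>n. \<forall>u. \<bar>ray (harr (\<lambda>e. Z n e w)) n u u\<bar>
      \<le> (2 * s + \<epsilon>) * sqrt (real n) * nsq n u) sequentially"
      using eventually_ge_at_top[of 1]
    proof eventually_elim
      case (elim n)
      then have "T n w \<le> (\<rho> * sqrt (real n)) ^ (2 * p n)" by (auto simp: E_def)
      then have "\<bar>ray (harr (\<lambda>e. Z n e w)) n u u\<bar> \<le> \<rho> * sqrt (real n) * nsq n u" for u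
        using elim(2) \<rho> by (intro ray_le_of_trace[OF herm_harr, of n "p n"]) (auto simp: T_def p_def)
      then show ?case by (simp add: defs)
    qed
  qed
qed

text \<open>With $n = i^{64}$ the truncation level $n^{7/16}$ is $i^{28}$ and $\sqrt n$ is $i^{32}$, which makes
  the variances summable in $i$.\<close>

lemma (in prob_space) lower_moments_as:
  fixes Z :: "nat \<Rightarrow> nat \<times> nat \<Rightarrow> 'a \<Rightarrow> quat"
  assumes ra: "\<And>n. n \<ge> n0 \<Longrightarrow> rand_array_exact M (Z n) (2 * real n powr (7 / 16)) (sn n)"
    and sn: "\<And>n. n \<ge> n0 \<Longrightarrow> \<sigma> / 2 \<le> sn n" "\<And>n. n \<ge> n0 \<Longrightarrow> sn n \<le> \<sigma>" "sn \<longlonglongrightarrow> \<sigma>" and \<sigma>: "\<sigma> > 0"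
    and k: "k \<ge> 1"
  shows "AE w in M. (\<lambda>i. Rq (qpow (harr (\<lambda>e. Z (i ^ 64) e w)) (i ^ 64) k 1 1) / sqrt (real (i ^ 64)) ^ k)
    \<longlonglongrightarrow> \<sigma> ^ k * jw {} k 0"
proof -
  define c where "c = jw {} k 0"
  have c0: "0 \<le> c" by (simp add: c_def jw_nonneg)
  define m where "m i w = Rq (qpow (harr (\<lambda>e. Z (i ^ 64) e w)) (i ^ 64) k 1 1) / sqrt (real (i ^ 64)) ^ k" for i w
  define f where "f i w = (m i w - sn (i ^ 64) ^ k * c)\<^sup>2" for i w
  \<comment> \<open>A bound for the base that is uniform in \<open>i\<close>: 2 covers
    \<open>1 / (n * \<eta>) + 1\<close>, and \<open>4 / \<sigma>\<close> comes from
    \<open>2 / sn n\<close> with \<open>sn n \<ge> \<sigma> / 2\<close>.\<close>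
  define Bm where "Bm j = 2 + real j * (2 + 4 / \<sigma>)" for j :: nat
  have Bm0: "0 \<le> Bm j" for j using \<sigma> by (simp add: Bm_def)
  define D where "D = \<sigma> ^ (2 * k) * ((c\<^sup>2 * (2 * real k)\<^sup>2 + Bm (2 * k) ^ (2 * k)) + 2 * c * (c * (real k)\<^sup>2 + Bm k ^ k))"
  define i0 where "i0 = max n0 (2 * k)"
  have ge: "i ^ 64 \<ge> n0" "2 * k \<le> i ^ 64" "i \<ge> 1" if "i \<ge> i0" for i
  proof -
    show i: "i \<ge> 1" using that k by (simp add: i0_def)
    then have "i \<le> i ^ 64" by (simp add: self_le_power)
    then show "i ^ 64 \<ge> n0" "2 * k \<le> i ^ 64" using that by (auto simp: i0_def)
  qed
  have "AE w in M. (\<lambda>i. f i w) \<longlonglongrightarrow> 0"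
  proof (rule AE_tendsto_0_of_summable[of i0])
    fix i assume i: "i \<ge> i0"
    note g = ge[OF i]
    define n where "n = i ^ 64"
    \<comment> \<open>Summable in \<open>i\<close>, yet large enough that dividing the third-step
      weight, of order \<open>i\<close> to the power 28 - 32, by \<eta> leaves it bounded.\<close>
    define \<eta> where "\<eta> = 1 / (real i)\<^sup>2"
    interpret rand_array_exact M "Z n" "2 * real n powr (7 / 16)" "sn n"
      by (rule ra) (simp add: n_def g)
    have \<eta>: "0 < \<eta>" "\<eta> \<le> 1" using g(3) by (auto simp: \<eta>_def)
    have n2k: "2 * k \<le> n" using g by (simp add: n_def)
    let ?B = "\<lambda>m. 2 + real m * (1 / (real n * \<eta>) + 1 + 2 * real n powr (7 / 16) / (sn n * sqrt (real n)) / \<eta>)"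
    note S = second_moment_qpZ[OF k n2k \<eta>, folded c_def]
    show "integrable M (f i)" using S(1) by (simp add: f_def[abs_def] m_def n_def)
    have ri: "real i \<ge> 1" using g(3) by simp
    have rn: "real n = real i ^ 64" by (simp add: n_def)
    have inv_n: "1 / real n \<le> \<eta>"
      unfolding rn \<eta>_def using ri by (intro divide_left_mono power_increasing) auto
    have B_le: "?B j \<le> Bm j" "0 \<le> ?B j" for j
    proof -
      have "real n * \<eta> = real i ^ 62"
        using ri by (simp add: rn \<eta>_def power2_eq_square field_simps flip: power_Suc)
      then have a: "1 / (real n * \<eta>) \<le> 1" using ri by simp
      have sq: "sqrt (real n) = real i ^ 32"
        unfolding rn by (rule real_sqrt_unique) (simp_all flip: power_mult)
      have pw: "real n powr (7 / 16) = real i ^ 28"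
      proof -
        have e: "real i ^ m = real i powr real m" for m
          using ri by (intro powr_realpow[symmetric]) simp
        have "real (64 :: nat) * (7 / 16) = real (28 :: nat)" by simp
        then show ?thesis unfolding rn e powr_powr by (simp only:)
      qed
      have gen: "2 * y / (r * (y * z * z)) / (1 / z) = 2 / r * (1 / z)"
        if "y \<noteq> 0" "z \<noteq> 0" "r \<noteq> 0" for y z r :: real using that by simp
      have i2: "real i ^ 32 = real i ^ 28 * (real i)\<^sup>2 * (real i)\<^sup>2" by (simp flip: power_add)
      have "2 * real n powr (7 / 16) / (sn n * sqrt (real n)) / \<eta> = 2 / sn n * (1 / (real i)\<^sup>2)"
        unfolding sq pw \<eta>_def i2 using ri s_pos by (intro gen) auto
      also have "\<dots> \<le> 2 / sn n * 1" using ri s_pos by (intro mult_left_mono) auto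
      also have "\<dots> \<le> 4 / \<sigma>" using sn(1)[of n] g(1) \<sigma> s_pos by (simp add: n_def field_simps)
      finally have b: "2 * real n powr (7 / 16) / (sn n * sqrt (real n)) / \<eta> \<le> 4 / \<sigma>" .
      show "?B j \<le> Bm j" unfolding Bm_def using a b by (intro add_left_mono mult_left_mono) auto
      show "0 \<le> ?B j" using s_pos \<eta>(1) by simp
    qed
    have le1: "x / real n + \<eta> * ?B j ^ j \<le> \<eta> * (x + Bm j ^ j)" if "0 \<le> x" for x j
    proof -
      have "x / real n \<le> x * \<eta>" using mult_left_mono[OF inv_n that] by simp
      moreover have "\<eta> * ?B j ^ j \<le> \<eta> * Bm j ^ j" using \<eta> B_le by (intro mult_left_mono power_mono) auto
      ultimately show ?thesis by (simp add: distrib_left mult.commute)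
    qed
    have "expectation (f i) \<le> sn n ^ (2 * k) * ((c\<^sup>2 * (2 * real k)\<^sup>2 / real n + \<eta> * ?B (2 * k) ^ (2 * k))
        + 2 * c * (c * (real k)\<^sup>2 / real n + \<eta> * ?B k ^ k))"
      using S(2) by (simp add: f_def[abs_def] m_def n_def)
    also have "\<dots> \<le> \<sigma> ^ (2 * k) * (\<eta> * (c\<^sup>2 * (2 * real k)\<^sup>2 + Bm (2 * k) ^ (2 * k))
        + 2 * c * (\<eta> * (c * (real k)\<^sup>2 + Bm k ^ k)))"
      using c0 s_pos sn(2)[of n] g(1) \<eta> B_le Bm0
      by (intro mult_mono add_mono mult_left_mono le1 power_mono) (auto simp: n_def intro!: add_nonneg_nonneg mult_nonneg_nonneg zero_le_power)
    also have "\<dots> = D * (1 / (real i)\<^sup>2)" by (simp add: D_def \<eta>_def algebra_simps add_divide_distrib)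
    finally show "expectation (f i) \<le> D * (1 / (real i)\<^sup>2)" .
  next
    show "summable (\<lambda>i. D * (1 / (real i)\<^sup>2))"
      using inverse_power_summable[of 2, where 'a = real] by (intro summable_mult) (simp add: inverse_eq_divide)
  qed (simp add: f_def)
  then show ?thesis
  proof (rule AE_mp, intro AE_I2 impI)
    fix w assume "(\<lambda>i. f i w) \<longlonglongrightarrow> 0"
    then have "(\<lambda>i. \<bar>m i w - sn (i ^ 64) ^ k * c\<bar>) \<longlonglongrightarrow> 0"
      using tendsto_real_sqrt[of "\<lambda>i. f i w" 0] by (simp add: f_def)
    then have d: "(\<lambda>i. m i w - sn (i ^ 64) ^ k * c) \<longlonglongrightarrow> 0" by (simp add: tendsto_rabs_zero_iff)
    have "filterlim (\<lambda>i::nat. i ^ 64) at_top sequentially"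
      by (intro filterlim_subseq strict_monoI power_strict_mono) auto
    then have "(\<lambda>i. sn (i ^ 64)) \<longlonglongrightarrow> \<sigma>" using sn(3) by (rule filterlim_compose[rotated])
    then have "(\<lambda>i. sn (i ^ 64) ^ k * c) \<longlonglongrightarrow> \<sigma> ^ k * c" by (intro tendsto_intros)
    from tendsto_add[OF d this] show "(\<lambda>i. Rq (qpow (harr (\<lambda>e. Z (i ^ 64) e w)) (i ^ 64) k 1 1) / sqrt (real (i ^ 64)) ^ k)
      \<longlonglongrightarrow> \<sigma> ^ k * jw {} k 0" by (simp add: m_def c_def)
  qed
qed

section \<open>Krylov vectors\<close>

lemma jw_free_zero: "m < l \<Longrightarrow> jw {} m l = 0"
  by (induction m arbitrary: l) auto

lemma jw_free_odd: "odd (m + l) \<Longrightarrow> jw {} m l = 0"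
  by (induction m arbitrary: l) (auto simp: odd_pos)

text \<open>Symmetry of the adjacency operator of the half line: the forward and the backward shift
  are adjoint, and \<open>N\<close> lies beyond the support, so no boundary term appears.\<close>

lemma jw_free_step:
  assumes "a < N" "b < N"
  shows "(\<Sum>l<N. jw {} a l * jw {} (Suc b) l) = (\<Sum>l<N. jw {} (Suc a) l * jw {} b l)"
proof -
  obtain N' where N: "N = Suc N'" using assms by (cases N) auto
  have sh: "(\<Sum>l<N. (if l = 0 then 0 else x (l - 1)) * y l) = (\<Sum>l<N. x l * y (Suc l))"
    if "y N = 0" for x y :: "nat \<Rightarrow> real"
    unfolding N using that N by (subst sum.lessThan_Suc_shift) simp
  have "(\<Sum>l<N. jw {} a l * jw {} (Suc b) l) = (\<Sum>l<N. (if l = 0 then 0 else jw {} b (l - 1)) * jw {} a l)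
      + (\<Sum>l<N. jw {} a l * jw {} b (Suc l))"
    unfolding sum.distrib[symmetric] by (intro sum.cong refl) (auto simp: algebra_simps)
  also have "\<dots> = (\<Sum>l<N. jw {} b l * jw {} a (Suc l)) + (\<Sum>l<N. (if l = 0 then 0 else jw {} a (l - 1)) * jw {} b l)"
    using assms by (simp add: sh jw_free_zero)
  also have "\<dots> = (\<Sum>l<N. jw {} (Suc a) l * jw {} b l)"
    unfolding sum.distrib[symmetric] by (intro sum.cong refl) (auto simp: algebra_simps)
  finally show ?thesis .
qed

text \<open>Moving the \<open>b\<close> applications of the symmetric operator one by one to the
  other factor leaves the return weight of length \<open>a + b\<close>.\<close>

lemma jw_free_inner:
  assumes "a + b < N"
  shows "(\<Sum>l<N. jw {} a l * jw {} b l) = jw {} (a + b) 0"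
  using assms
proof (induction b arbitrary: a)
  case 0
  have "(\<Sum>l<N. jw {} a l * jw {} 0 l) = (\<Sum>l<N. if l = 0 then jw {} a 0 else 0)"
    by (intro sum.cong refl) simp
  then show ?case using 0 by simp
next
  case (Suc b)
  then show ?case using jw_free_step[of a N b] Suc.IH[of "Suc a"] by simp
qed

text \<open>Coefficients of the Chebyshev polynomials $U_l(x/2)$, which turn the vector at 0 of the
  half line into the vector at $l$.\<close>

fun cheb :: "nat \<Rightarrow> nat \<Rightarrow> real" where
  "cheb 0 i = of_bool (i = 0)"
| "cheb (Suc 0) i = of_bool (i = 1)"
| "cheb (Suc (Suc l)) i = (if i = 0 then 0 else cheb (Suc l) (i - 1)) - cheb l i"

lemma cheb_zero: "l < i \<Longrightarrow> cheb l i = 0"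
  by (induction l i rule: cheb.induct) auto

text \<open>The recursion of \<open>cheb\<close> inverts the action of the operator: applied to the
  unit vector at \<open>l + 1\<close> it gives those at \<open>l\<close> and \<open>l + 2\<close>,
  and the former is subtracted.\<close>

lemma cheb_jw: "l < N \<Longrightarrow> (\<Sum>i<N. cheb l i * jw {} i x) = of_bool (x = l)"
proof (induction l arbitrary: x rule: induct_nat_012)
  case 0
  have "(\<Sum>i<N. cheb 0 i * jw {} i x) = (\<Sum>i<N. if i = 0 then jw {} 0 x else 0)"
    by (intro sum.cong refl) auto
  then show ?case using 0 by simp
next
  case 1
  have "(\<Sum>i<N. cheb (Suc 0) i * jw {} i x) = (\<Sum>i<N. if i = 1 then jw {} 1 x else 0)"
    by (intro sum.cong refl) auto
  then show ?case using 1 by (cases x) auto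
next
  case (ge2 l)
  obtain N' where N: "N = Suc N'" using ge2.prems by (cases N) auto
  have z: "cheb (Suc l) N' = 0" using ge2.prems N by (intro cheb_zero) simp
  have "(\<Sum>i<N. (if i = 0 then 0 else cheb (Suc l) (i - 1)) * jw {} i x) = (\<Sum>i<N'. cheb (Suc l) i * jw {} (Suc i) x)"
    unfolding N by (subst sum.lessThan_Suc_shift) simp
  also have "\<dots> = (\<Sum>i<N. cheb (Suc l) i * jw {} (Suc i) x)" using z by (simp add: N)
  also have "\<dots> = (if x = 0 then 0 else \<Sum>i<N. cheb (Suc l) i * jw {} i (x - 1)) + (\<Sum>i<N. cheb (Suc l) i * jw {} i (Suc x))"
    by (simp add: sum.distrib distrib_left)
  also have "\<dots> = (if x = 0 then 0 else of_bool (x - 1 = Suc l)) + of_bool (Suc x = Suc l)"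
    using ge2 by simp
  finally have "(\<Sum>i<N. cheb (Suc (Suc l)) i * jw {} i x) =
      (if x = 0 then 0 else of_bool (x - 1 = Suc l)) + of_bool (Suc x = Suc l) - of_bool (x = l)"
    using ge2 by (simp add: left_diff_distrib sum_subtractf)
  then show ?case by (cases x) auto
qed

definition chebsum :: "nat \<Rightarrow> nat \<Rightarrow> real" where
  "chebsum L i = (\<Sum>l<L. cheb l i)"

lemma chebsum_jw: "(\<Sum>i<L. chebsum L i * jw {} i x) = of_bool (x < L)"
proof -
  have "(\<Sum>i<L. chebsum L i * jw {} i x) = (\<Sum>l<L. \<Sum>i<L. cheb l i * jw {} i x)"
    unfolding chebsum_def sum_distrib_right by (rule sum.swap)
  also have "\<dots> = (\<Sum>l<L. if l = x then 1 else 0)"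
    by (intro sum.cong refl) (auto simp: cheb_jw)
  finally show ?thesis by simp
qed

text \<open>Squared norm and adjacency form of the indicator of \<open>{..<L}\<close>: it has
  \<open>L\<close> points and \<open>L - 1\<close> inner edges, each counted twice.\<close>

lemma chebsum_quadratic:
  assumes L: "L \<ge> 1"
  shows "(\<Sum>i<L. \<Sum>k<L. chebsum L i * chebsum L k * jw {} (i + k) 0) = real L"
    and "(\<Sum>i<L. \<Sum>k<L. chebsum L i * chebsum L k * jw {} (i + k + 1) 0) = 2 * (real L - 1)"
proof -
  let ?a = "chebsum L"
  \<comment> \<open>Large enough for \<open>jw_free_inner\<close>: the walk lengths involved are at
    most \<open>2 * (L - 1) + 1\<close>.\<close>
  define N where "N = 2 * L + 2"
  have gen: "(\<Sum>i<L. \<Sum>k<L. ?a i * ?a k * jw {} (i + (k + d)) 0)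
      = (\<Sum>x<N. (\<Sum>i<L. ?a i * jw {} i x) * (\<Sum>k<L. ?a k * jw {} (k + d) x))" if "d \<le> 1" for d
  proof -
    have "(\<Sum>i<L. \<Sum>k<L. ?a i * ?a k * jw {} (i + (k + d)) 0)
        = (\<Sum>i<L. \<Sum>k<L. \<Sum>x<N. (?a i * jw {} i x) * (?a k * jw {} (k + d) x))"
    proof (intro sum.cong refl)
      fix i k assume "i \<in> {..<L}" "k \<in> {..<L}"
      then have "i + (k + d) < N" using that by (auto simp: N_def)
      from jw_free_inner[OF this, symmetric]
      show "?a i * ?a k * jw {} (i + (k + d)) 0 = (\<Sum>x<N. (?a i * jw {} i x) * (?a k * jw {} (k + d) x))"
        by (simp add: sum_distrib_left mult_ac)
    qed
    also have "\<dots> = (\<Sum>i<L. \<Sum>x<N. \<Sum>k<L. (?a i * jw {} i x) * (?a k * jw {} (k + d) x))"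
      by (rule sum.cong[OF refl]) (rule sum.swap)
    also have "\<dots> = (\<Sum>x<N. \<Sum>i<L. \<Sum>k<L. (?a i * jw {} i x) * (?a k * jw {} (k + d) x))"
      by (rule sum.swap)
    finally show ?thesis by (simp only: sum_product)
  qed
  have N: "{..<N} \<inter> {x. x < L} = {..<L}" by (auto simp: N_def)
  have sub: "(\<Sum>x<N. of_bool (x < L) * g x) = (\<Sum>x<L. g x)" for g :: "nat \<Rightarrow> real"
  proof -
    have "(\<Sum>x<N. of_bool (x < L) * g x) = (\<Sum>x<N. if x \<in> {x. x < L} then g x else 0)"
      by (intro sum.cong refl) simp
    then show ?thesis by (simp only: sum.inter_restrict[symmetric, OF finite_lessThan] N)
  qed
  show "(\<Sum>i<L. \<Sum>k<L. ?a i * ?a k * jw {} (i + k) 0) = real L"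
    using gen[of 0] by (simp add: chebsum_jw sub)
  have st: "(\<Sum>k<L. ?a k * jw {} (k + 1) x) = (if x = 0 then 0 else of_bool (x - 1 < L)) + of_bool (Suc x < L)" for x
  proof -
    have "(\<Sum>k<L. ?a k * jw {} (k + 1) x) = (if x = 0 then 0 else \<Sum>k<L. ?a k * jw {} k (x - 1)) + (\<Sum>k<L. ?a k * jw {} k (Suc x))"
      by (simp add: sum.distrib distrib_left)
    then show ?thesis by (simp only: chebsum_jw)
  qed
  obtain L' where L': "L = Suc L'" using L by (cases L) auto
  have "(\<Sum>i<L. \<Sum>k<L. ?a i * ?a k * jw {} (i + (k + 1)) 0)
      = (\<Sum>x<L. (if x = 0 then 0 else of_bool (x - 1 < L)) + of_bool (Suc x < L))"
    unfolding gen[OF order_refl] st chebsum_jw by (rule sub)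
  also have "\<dots> = (\<Sum>x<L. (if x = 0 then 0 else of_bool (x - 1 < L))) + (\<Sum>x<L. of_bool (Suc x < L))"
    by (rule sum.distrib)
  also have "(\<Sum>x<L. (if x = 0 then 0 else of_bool (x - 1 < L))) = real L - 1"
    unfolding L' by (subst sum.lessThan_Suc_shift) simp
  also have "(\<Sum>x<L. of_bool (Suc x < L)) = real L - 1"
    unfolding L' by simp
  finally show "(\<Sum>i<L. \<Sum>k<L. ?a i * ?a k * jw {} (i + k + 1) 0) = 2 * (real L - 1)"
    by (simp add: add.assoc)
qed

section \<open>Rayleigh quotients of Krylov vectors\<close>

lemma inner_eq_Rq: "inner p q = Rq (quat_cnj p \<diamond> q)"
  by (cases p; cases q) (simp add: Rq_def qone_def quat_cnj_def)

lemma inner_krylov: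
  assumes X: "herm X n" and n: "n \<ge> 1"
  shows "(\<Sum>j\<in>{1..n}. inner (qpow X n i j 1) (qpow X n k j 1)) = Rq (qpow X n (i + k) 1 1)"
proof -
  have r: "1 \<in> {1..n}" using n by simp
  have "(\<Sum>j\<in>{1..n}. inner (qpow X n i j 1) (qpow X n k j 1)) = (\<Sum>j\<in>{1..n}. Rq (qpow X n i 1 j \<diamond> qpow X n k j 1))"
    by (intro sum.cong refl) (simp only: inner_eq_Rq qpow_cnj[OF X _ r])
  also have "\<dots> = Rq (\<Sum>j\<in>{1..n}. qpow X n i 1 j \<diamond> qpow X n k j 1)"
    by (rule linear_sum[OF linear_Rq, symmetric])
  finally show ?thesis unfolding qpow_add[OF r r] .
qed

lemma krylov_vector:
  fixes b :: "nat \<Rightarrow> real" and L :: nat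
  assumes X: "herm X n" and n: "n \<ge> 1"
  defines "w \<equiv> \<lambda>j. \<Sum>i<L. b i *\<^sub>R qpow X n i j 1"
  shows "nsq n w = (\<Sum>i<L. \<Sum>k<L. b i * b k * Rq (qpow X n (i + k) 1 1))"
    and "ray X n w w = (\<Sum>i<L. \<Sum>k<L. b i * b k * Rq (qpow X n (i + k + 1) 1 1))"
proof -
  have gen: "(\<Sum>j\<in>{1..n}. inner (w j) (\<Sum>k<L. b k *\<^sub>R qpow X n (k + d) j 1))
      = (\<Sum>i<L. \<Sum>k<L. b i * b k * Rq (qpow X n (i + (k + d)) 1 1))" for d
  proof -
    have "(\<Sum>j\<in>{1..n}. inner (w j) (\<Sum>k<L. b k *\<^sub>R qpow X n (k + d) j 1))
        = (\<Sum>j\<in>{1..n}. \<Sum>i<L. \<Sum>k<L. b i * b k * inner (qpow X n i j 1) (qpow X n (k + d) j 1))"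
      unfolding w_def inner_sum_left
      by (intro sum.cong refl) (simp add: inner_sum_right sum_distrib_left mult_ac)
    also have "\<dots> = (\<Sum>i<L. \<Sum>j\<in>{1..n}. \<Sum>k<L. b i * b k * inner (qpow X n i j 1) (qpow X n (k + d) j 1))"
      by (rule sum.swap)
    also have "\<dots> = (\<Sum>i<L. \<Sum>k<L. \<Sum>j\<in>{1..n}. b i * b k * inner (qpow X n i j 1) (qpow X n (k + d) j 1))"
      by (rule sum.cong[OF refl]) (rule sum.swap)
    finally show ?thesis unfolding sum_distrib_left[symmetric] inner_krylov[OF X n] .
  qed
  show "nsq n w = (\<Sum>i<L. \<Sum>k<L. b i * b k * Rq (qpow X n (i + k) 1 1))"
    using gen[of 0] by (simp add: nsq_def power2_norm_eq_inner w_def)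
  have mv: "mvec X n w j = (\<Sum>k<L. b k *\<^sub>R qpow X n (k + 1) j 1)" if j: "j \<in> {1..n}" for j
  proof -
    have r: "1 \<in> {1..n}" using n by simp
    have "mvec X n w j = (\<Sum>u\<in>{1..n}. \<Sum>k<L. b k *\<^sub>R (X j u \<diamond> qpow X n k u 1))"
      by (simp add: mvec_def w_def qmul.sum_right qmul.scaleR_right)
    also have "\<dots> = (\<Sum>k<L. b k *\<^sub>R (\<Sum>u\<in>{1..n}. qpow X n 1 j u \<diamond> qpow X n k u 1))"
      unfolding scaleR_right.sum qpow_1[OF j] by (rule sum.swap)
    also have "\<dots> = (\<Sum>k<L. b k *\<^sub>R qpow X n (1 + k) j 1)"
      unfolding qpow_add[OF j r] ..
    finally show ?thesis by (simp only: add.commute)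
  qed
  have "ray X n w w = (\<Sum>j\<in>{1..n}. inner (w j) (\<Sum>k<L. b k *\<^sub>R qpow X n (k + 1) j 1))"
    unfolding ray_def by (intro sum.cong refl) (simp only: mv)
  then show "ray X n w w = (\<Sum>i<L. \<Sum>k<L. b i * b k * Rq (qpow X n (i + k + 1) 1 1))"
    unfolding gen[of 1] by (simp only: add.assoc)
qed

text \<open>The sign \<epsilon> treats both ends of the spectrum together: the odd moments of the
  limit vanish, so they are unchanged when the matrix is negated.\<close>

lemma krylov_limit:
  fixes X :: "nat \<Rightarrow> nat \<Rightarrow> nat \<Rightarrow> quat" and N :: "nat \<Rightarrow> nat"
  assumes X: "\<And>i. herm (X i) (N i)" and N: "eventually (\<lambda>i. N i \<ge> 1) sequentially"
    and lim: "\<And>k. (\<lambda>i. Rq (qpow (X i) (N i) k 1 1) / sqrt (real (N i)) ^ k) \<longlonglongrightarrow> \<sigma> ^ k * jw {} k 0"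
    and \<sigma>: "\<sigma> > 0" and \<gamma>: "\<gamma> < 2 * \<sigma>" and \<epsilon>: "\<epsilon> = 1 \<or> \<epsilon> = (-1 :: real)"
  shows "eventually (\<lambda>i. \<exists>u. nsq (N i) u > 0 \<and>
    \<gamma> * sqrt (real (N i)) * nsq (N i) u < \<epsilon> * ray (X i) (N i) u u) sequentially"
proof -
  \<comment> \<open>This is the condition for \<open>2 * \<sigma> * (1 - 1 / L)\<close> to exceed
    \<gamma>.\<close>
  have "2 * \<sigma> / (2 * \<sigma> - \<gamma>) < real L" if "L = nat \<lceil>2 * \<sigma> / (2 * \<sigma> - \<gamma>)\<rceil> + 1" for L
    unfolding that by linarith
  then obtain L :: nat where L: "2 * \<sigma> / (2 * \<sigma> - \<gamma>) < real L" by blast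
  have "0 < 2 * \<sigma> / (2 * \<sigma> - \<gamma>)" using \<sigma> \<gamma> by simp
  then have L1: "L \<ge> 1" using L by (cases L) auto
  have gap: "\<gamma> * real L < \<sigma> * (2 * (real L - 1))" using L \<gamma> by (simp add: field_simps)
  let ?a = "chebsum L"
  define \<mu> where "\<mu> i k = Rq (qpow (X i) (N i) k 1 1)" for i k
  define \<nu> where "\<nu> i k = \<mu> i k / sqrt (real (N i)) ^ k" for i k
  have \<nu>: "(\<lambda>i. \<nu> i k) \<longlonglongrightarrow> \<sigma> ^ k * jw {} k 0" for k using lim by (simp add: \<nu>_def \<mu>_def)
  \<comment> \<open>The polynomial is evaluated at \<epsilon> times the array divided by
    \<open>\<sigma> * sqrt n\<close>, whose limiting moments are those of the half line.\<close>
  define b where "b i j = ?a j * (\<epsilon> / (\<sigma> * sqrt (real (N i)))) ^ j" for i j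
  define A where "A i = (\<Sum>j<L. \<Sum>k<L. ?a j * ?a k * ((\<epsilon> / \<sigma>) ^ (j + k) * \<nu> i (j + k)))" for i
  define R where "R i = \<epsilon> * (\<Sum>j<L. \<Sum>k<L. ?a j * ?a k * ((\<epsilon> / \<sigma>) ^ (j + k) * \<nu> i (j + k + 1)))" for i
  have \<epsilon>_pow: "\<epsilon> ^ m * jw {} m 0 = jw {} m 0" for m
    using \<epsilon> jw_free_odd[of m 0] by (cases "even m") (auto simp: minus_one_power_iff)
  have e2: "\<epsilon> * \<epsilon> = 1" using \<epsilon> by auto
  have limA: "A \<longlonglongrightarrow> real L"
  proof -
    have "A \<longlonglongrightarrow> (\<Sum>j<L. \<Sum>k<L. ?a j * ?a k * ((\<epsilon> / \<sigma>) ^ (j + k) * (\<sigma> ^ (j + k) * jw {} (j + k) 0)))"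
      unfolding A_def by (intro tendsto_intros \<nu>)
    also have "(\<Sum>j<L. \<Sum>k<L. ?a j * ?a k * ((\<epsilon> / \<sigma>) ^ (j + k) * (\<sigma> ^ (j + k) * jw {} (j + k) 0)))
        = (\<Sum>j<L. \<Sum>k<L. ?a j * ?a k * jw {} (j + k) 0)"
    proof (intro sum.cong refl arg_cong2[where f = "(*)"])
      fix j k
      have "(\<epsilon> / \<sigma>) ^ (j + k) * \<sigma> ^ (j + k) = \<epsilon> ^ (j + k)"
        unfolding power_mult_distrib[symmetric] using \<sigma> by simp
      then show "(\<epsilon> / \<sigma>) ^ (j + k) * (\<sigma> ^ (j + k) * jw {} (j + k) 0) = jw {} (j + k) 0"
        using \<epsilon>_pow[of "j + k"] by (simp add: mult.assoc[symmetric])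
    qed
    finally show ?thesis unfolding chebsum_quadratic(1)[OF L1] .
  qed
  have limR: "R \<longlonglongrightarrow> \<sigma> * (2 * (real L - 1))"
  proof -
    have "R \<longlonglongrightarrow> \<epsilon> * (\<Sum>j<L. \<Sum>k<L. ?a j * ?a k * ((\<epsilon> / \<sigma>) ^ (j + k) * (\<sigma> ^ (j + k + 1) * jw {} (j + k + 1) 0)))"
      unfolding R_def by (intro tendsto_intros \<nu>)
    also have "\<epsilon> * (\<Sum>j<L. \<Sum>k<L. ?a j * ?a k * ((\<epsilon> / \<sigma>) ^ (j + k) * (\<sigma> ^ (j + k + 1) * jw {} (j + k + 1) 0)))
        = \<sigma> * (\<Sum>j<L. \<Sum>k<L. ?a j * ?a k * jw {} (j + k + 1) 0)"
      unfolding sum_distrib_left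
    proof (intro sum.cong refl)
      fix j k
      have "(\<epsilon> / \<sigma>) ^ (j + k) * \<sigma> ^ (j + k) = \<epsilon> ^ (j + k)"
        unfolding power_mult_distrib[symmetric] using \<sigma> by simp
      then have "(\<epsilon> / \<sigma>) ^ (j + k) * \<sigma> ^ (j + k) * \<epsilon> * jw {} (j + k + 1) 0 = jw {} (j + k + 1) 0"
        using \<epsilon>_pow[of "j + k + 1"] by (simp only: power_add power_one_right)
      moreover have "\<epsilon> * (?a j * ?a k * ((\<epsilon> / \<sigma>) ^ (j + k) * (\<sigma> ^ (j + k + 1) * jw {} (j + k + 1) 0)))
          = \<sigma> * (?a j * ?a k * ((\<epsilon> / \<sigma>) ^ (j + k) * \<sigma> ^ (j + k) * \<epsilon> * jw {} (j + k + 1) 0))"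
        by (simp only: power_add power_one_right mult_ac)
      ultimately show "\<epsilon> * (?a j * ?a k * ((\<epsilon> / \<sigma>) ^ (j + k) * (\<sigma> ^ (j + k + 1) * jw {} (j + k + 1) 0)))
          = \<sigma> * (?a j * ?a k * jw {} (j + k + 1) 0)" by (simp only:)
    qed
    finally show ?thesis unfolding chebsum_quadratic(2)[OF L1] .
  qed
  have "eventually (\<lambda>i. A i > 0) sequentially"
    using limA L1 by (intro order_tendstoD(1)) auto
  moreover have "eventually (\<lambda>i. R i - \<gamma> * A i > 0) sequentially"
  proof -
    have "(\<lambda>i. R i - \<gamma> * A i) \<longlonglongrightarrow> \<sigma> * (2 * (real L - 1)) - \<gamma> * real L"
      by (intro tendsto_intros limA limR)
    then show ?thesis using gap by (intro order_tendstoD(1)) auto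
  qed
  ultimately show ?thesis using N
  proof eventually_elim
    case (elim i)
    let ?n = "N i" and ?q = "sqrt (real (N i))"
    have q: "?q > 0" using elim(3) by simp
    define w where "w = (\<lambda>j. \<Sum>k<L. b i k *\<^sub>R qpow (X i) ?n k j 1)"
    have bb: "b i j * b i k * \<mu> i m = ?a j * ?a k * ((\<epsilon> / \<sigma>) ^ (j + k) * (\<mu> i m / ?q ^ (j + k)))" for j k m
      by (simp add: b_def power_add power_divide power_mult_distrib mult_ac)
    have nw: "nsq ?n w = A i"
      unfolding w_def krylov_vector(1)[OF X elim(3)] A_def \<mu>_def[symmetric] bb \<nu>_def ..
    have "ray (X i) ?n w w = (\<Sum>j<L. \<Sum>k<L. ?a j * ?a k * ((\<epsilon> / \<sigma>) ^ (j + k) * (\<mu> i (j + k + 1) / ?q ^ (j + k))))"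
      unfolding w_def krylov_vector(2)[OF X elim(3)] \<mu>_def[symmetric] bb ..
    also have "\<dots> = ?q * (\<Sum>j<L. \<Sum>k<L. ?a j * ?a k * ((\<epsilon> / \<sigma>) ^ (j + k) * \<nu> i (j + k + 1)))"
      unfolding sum_distrib_left
    proof (intro sum.cong refl)
      fix j k
      have "\<mu> i (j + k + 1) / ?q ^ (j + k) = ?q * \<nu> i (j + k + 1)" using q by (simp add: \<nu>_def)
      then show "?a j * ?a k * ((\<epsilon> / \<sigma>) ^ (j + k) * (\<mu> i (j + k + 1) / ?q ^ (j + k)))
        = ?q * (?a j * ?a k * ((\<epsilon> / \<sigma>) ^ (j + k) * \<nu> i (j + k + 1)))"
        by (simp only: mult_ac)
    qed
    finally have rw: "\<epsilon> * ray (X i) ?n w w = ?q * R i" by (simp add: R_def mult.left_commute)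
    have "\<gamma> * ?q * nsq ?n w < \<epsilon> * ray (X i) ?n w w"
      unfolding rw nw using q elim(2) by (simp add: mult.commute mult.assoc)
    then show ?case using elim(1) nw by (intro exI[of _ w]) simp
  qed
qed

section \<open>Row sums, tail sums and Borel--Cantelli\<close>

text \<open>The arithmetic-geometric mean inequality splits each entry's contribution between its
  two indices, and symmetry makes both halves row sums.\<close>

lemma schur_test:
  assumes row: "\<And>j. j \<in> {1..n} \<Longrightarrow> (\<Sum>k\<in>{1..n}. norm (X j k)) \<le> R"
    and sym: "\<And>j k. j \<in> {1..n} \<Longrightarrow> k \<in> {1..n} \<Longrightarrow> norm (X k j) = norm (X j k)"
  shows "\<bar>ray X n u u\<bar> \<le> R * nsq n u"
proof -
  let ?g = "\<lambda>j k. norm (X j k) * (norm (u j))\<^sup>2"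
  have "\<bar>ray X n u u\<bar> \<le> (\<Sum>j\<in>{1..n}. \<Sum>k\<in>{1..n}. \<bar>inner (u j) (X j k \<diamond> u k)\<bar>)"
    unfolding ray_def mvec_def inner_sum_right by (intro order.trans[OF sum_abs] sum_mono sum_abs)
  also have "\<dots> \<le> (\<Sum>j\<in>{1..n}. \<Sum>k\<in>{1..n}. (?g j k + norm (X j k) * (norm (u k))\<^sup>2) / 2)"
  proof (intro sum_mono)
    fix j k
    have "\<bar>inner (u j) (X j k \<diamond> u k)\<bar> \<le> norm (u j) * (norm (X j k) * norm (u k))"
      using Cauchy_Schwarz_ineq2[of "u j" "X j k \<diamond> u k"] by (simp add: norm_qmul)
    also have "\<dots> = norm (X j k) * (norm (u j) * norm (u k))" by simp
    also have "\<dots> \<le> norm (X j k) * (((norm (u j))\<^sup>2 + (norm (u k))\<^sup>2) / 2)"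
      using sum_squares_bound[of "norm (u j)" "norm (u k)"] by (intro mult_left_mono) auto
    finally show "\<bar>inner (u j) (X j k \<diamond> u k)\<bar> \<le> (?g j k + norm (X j k) * (norm (u k))\<^sup>2) / 2"
      by (simp add: distrib_left)
  qed
  also have "\<dots> = ((\<Sum>j\<in>{1..n}. \<Sum>k\<in>{1..n}. ?g j k) + (\<Sum>j\<in>{1..n}. \<Sum>k\<in>{1..n}. norm (X j k) * (norm (u k))\<^sup>2)) / 2"
    by (simp add: sum.distrib sum_divide_distrib[symmetric])
  also have "(\<Sum>j\<in>{1..n}. \<Sum>k\<in>{1..n}. norm (X j k) * (norm (u k))\<^sup>2) = (\<Sum>k\<in>{1..n}. \<Sum>j\<in>{1..n}. ?g k j)"
    by (subst sum.swap) (auto intro!: sum.cong simp: sym)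
  also have "((\<Sum>j\<in>{1..n}. \<Sum>k\<in>{1..n}. ?g j k) + (\<Sum>k\<in>{1..n}. \<Sum>j\<in>{1..n}. ?g k j)) / 2
      = (\<Sum>j\<in>{1..n}. (\<Sum>k\<in>{1..n}. norm (X j k)) * (norm (u j))\<^sup>2)"
    by (simp add: sum_distrib_right)
  also have "\<dots> \<le> (\<Sum>j\<in>{1..n}. R * (norm (u j))\<^sup>2)"
    by (intro sum_mono mult_right_mono row) auto
  finally show ?thesis by (simp add: nsq_def sum_distrib_left)
qed

section \<open>Moments through sums of tail probabilities\<close>

lemma less_nat_ceiling_iff: "k < nat \<lceil>y\<rceil> \<longleftrightarrow> real k < y"
  by (simp add: zless_nat_eq_int_zless less_ceiling_iff)

lemma sum_tail_lessThan:
  fixes y :: real and f :: "nat \<Rightarrow> real"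
  assumes "\<And>k. 0 \<le> f k"
  shows "(\<Sum>k<N. f k * of_bool (real k < y)) \<le> (\<Sum>k<nat \<lceil>y\<rceil>. f k)"
proof -
  have "(\<Sum>k<N. f k * of_bool (real k < y)) = (\<Sum>k<N. if real k < y then f k else 0)"
    by (intro sum.cong refl) simp
  also have "\<dots> = (\<Sum>k\<in>{k \<in> {..<N}. real k < y}. f k)"
    by (rule sum.inter_filter[symmetric]) simp
  also have "\<dots> \<le> (\<Sum>k<nat \<lceil>y\<rceil>. f k)"
    using assms by (intro sum_mono2) (auto simp: less_nat_ceiling_iff)
  finally show ?thesis .
qed

lemma sum_tail_ceiling:
  fixes y :: real and f :: "nat \<Rightarrow> real"
  shows "(\<Sum>k<nat \<lceil>y\<rceil>. f k * of_bool (real k < y)) = (\<Sum>k<nat \<lceil>y\<rceil>. f k)"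
  by (intro sum.cong refl) (auto simp: less_nat_ceiling_iff)

lemma sum_lessThan_real: "2 * (\<Sum>k<m. real k) = (real m)\<^sup>2 - real m"
  by (induction m) (simp_all add: power2_eq_square algebra_simps)

context prob_space
begin

text \<open>A discrete layer-cake formula: \<phi> dominates the running sum of the weights
  \<open>a\<close> up to \<open>Y\<close>. Weights 1 and \<open>real k\<close> give first and second
  moments below, with \<phi> absorbing the rounding to integers.\<close>

lemma summable_tail:
  fixes Y :: "'a \<Rightarrow> real" and a :: "nat \<Rightarrow> real"
  assumes [measurable]: "Y \<in> borel_measurable M" and a: "\<And>k. 0 \<le> a k"
    and int: "integrable M (\<lambda>w. \<phi> (Y w))"
    and le: "\<And>w N. w \<in> space M \<Longrightarrow> (\<Sum>k<N. a k * of_bool (real k < Y w)) \<le> \<phi> (Y w)"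
  shows "summable (\<lambda>k. a k * prob {w \<in> space M. real k < Y w})"
proof (rule summableI_nonneg_bounded)
  fix N
  have pi: "integrable M (\<lambda>w. a k * of_bool (real k < Y w))" for k
    by (rule integrable_const_bound[where B = "a k"]) (use a in auto)
  have pe: "expectation (\<lambda>w. a k * of_bool (real k < Y w)) = a k * prob {w \<in> space M. real k < Y w}" for k
  proof -
    have "expectation (\<lambda>w. of_bool (real k < Y w) :: real) = expectation (indicator {w \<in> space M. real k < Y w})"
      by (intro Bochner_Integration.integral_cong) (auto simp: indicator_def)
    then show ?thesis by simp
  qed
  have "(\<Sum>k<N. a k * prob {w \<in> space M. real k < Y w}) = expectation (\<lambda>w. \<Sum>k<N. a k * of_bool (real k < Y w))"
    using pi by (subst Bochner_Integration.integral_sum) (auto simp only: pe)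
  also have "\<dots> \<le> expectation (\<lambda>w. \<phi> (Y w))"
    using pi int le by (intro integral_mono Bochner_Integration.integrable_sum) auto
  finally show "(\<Sum>k<N. a k * prob {w \<in> space M. real k < Y w}) \<le> expectation (\<lambda>w. \<phi> (Y w))" .
qed (use a in simp)

lemma integrable_of_summable_tail:
  fixes Y :: "'a \<Rightarrow> real" and a :: "nat \<Rightarrow> real"
  assumes [measurable]: "Y \<in> borel_measurable M" "\<phi> \<in> borel_measurable borel" and a: "\<And>k. 0 \<le> a k"
    and C: "0 \<le> C" and nn: "\<And>w. 0 \<le> \<phi> (Y w)"
    and le: "\<And>w. \<exists>N. \<phi> (Y w) \<le> C + (\<Sum>k<N. a k * of_bool (real k < Y w))"
    and sm: "summable (\<lambda>k. a k * prob {w \<in> space M. real k < Y w})"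
  shows "integrable M (\<lambda>w. \<phi> (Y w))"
proof (rule integrableI_bounded)
  show "(\<lambda>w. \<phi> (Y w)) \<in> borel_measurable M" by measurable
  have "(\<integral>\<^sup>+w. ennreal (norm (\<phi> (Y w))) \<partial>M)
    \<le> (\<integral>\<^sup>+w. ennreal C + (\<Sum>k. ennreal (a k * of_bool (real k < Y w))) \<partial>M)"
  proof (rule nn_integral_mono)
    fix w
    obtain N where N: "\<phi> (Y w) \<le> C + (\<Sum>k<N. a k * of_bool (real k < Y w))" using le by blast
    have "ennreal (norm (\<phi> (Y w))) \<le> ennreal (C + (\<Sum>k<N. a k * of_bool (real k < Y w)))"
      using N nn by (intro ennreal_leI) simp
    also have "\<dots> = ennreal C + (\<Sum>k<N. ennreal (a k * of_bool (real k < Y w)))"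
      using C a by (simp add: sum_nonneg)
    also have "\<dots> \<le> ennreal C + (\<Sum>k. ennreal (a k * of_bool (real k < Y w)))"
      by (intro add_left_mono sum_le_suminf) auto
    finally show "ennreal (norm (\<phi> (Y w))) \<le> ennreal C + (\<Sum>k. ennreal (a k * of_bool (real k < Y w)))" .
  qed
  also have "\<dots> = ennreal C + (\<Sum>k. \<integral>\<^sup>+w. ennreal (a k * of_bool (real k < Y w)) \<partial>M)"
    by (simp add: nn_integral_add nn_integral_suminf emeasure_space_1)
  also have "(\<lambda>k. \<integral>\<^sup>+w. ennreal (a k * of_bool (real k < Y w)) \<partial>M)
      = (\<lambda>k. ennreal (a k * prob {w \<in> space M. real k < Y w}))"
  proof
    fix k
    have "(\<integral>\<^sup>+w. ennreal (a k * of_bool (real k < Y w)) \<partial>M)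
        = (\<integral>\<^sup>+w. ennreal (a k) * indicator {w \<in> space M. real k < Y w} w \<partial>M)"
      by (intro nn_integral_cong) (auto simp: indicator_def)
    also have "\<dots> = ennreal (a k) * emeasure M {w \<in> space M. real k < Y w}"
      by (rule nn_integral_cmult_indicator) simp
    finally show "(\<integral>\<^sup>+w. ennreal (a k * of_bool (real k < Y w)) \<partial>M) = ennreal (a k * prob {w \<in> space M. real k < Y w})"
      using a by (simp add: emeasure_eq_measure ennreal_mult)
  qed
  also have "(\<Sum>k. ennreal (a k * prob {w \<in> space M. real k < Y w})) = ennreal (\<Sum>k. a k * prob {w \<in> space M. real k < Y w})"
    using a sm by (intro suminf_ennreal2) auto
  also have "ennreal C + ennreal (\<Sum>k. a k * prob {w \<in> space M. real k < Y w}) < \<infinity>" by simp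
  finally show "(\<integral>\<^sup>+w. ennreal (norm (\<phi> (Y w))) \<partial>M) < \<infinity>" .
qed

lemma summable_tail_1:
  assumes Y: "integrable M Y" "\<And>w. 0 \<le> Y w"
  shows "summable (\<lambda>k. prob {w \<in> space M. real k < Y w})"
proof -
  have "summable (\<lambda>k. (1::real) * prob {w \<in> space M. real k < Y w})"
  proof (rule summable_tail[where \<phi> = "\<lambda>y. y + 1"])
    fix w and N :: nat
    show "(\<Sum>k<N. (1::real) * of_bool (real k < Y w)) \<le> Y w + 1"
      using sum_tail_lessThan[where f = "\<lambda>_. 1" and N = N and y = "Y w"] Y(2)[of w] by simp linarith
  qed (use Y in auto)
  then show ?thesis by simp
qed

lemma summable_tail_2:
  assumes [measurable]: "Y \<in> borel_measurable M" and Y: "integrable M (\<lambda>w. (Y w)\<^sup>2)" "\<And>w. 0 \<le> Y w"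
  shows "summable (\<lambda>k. real k * prob {w \<in> space M. real k < Y w})"
proof (rule summable_tail[where \<phi> = "\<lambda>y. (y + 1)\<^sup>2"])
  have "integrable M Y" by (rule square_integrable_imp_integrable[OF assms(1) Y(1)])
  then show "integrable M (\<lambda>w. (Y w + 1)\<^sup>2)"
    unfolding power2_sum by (intro Bochner_Integration.integrable_add Y(1)) auto
  fix w and N :: nat
  let ?m = "nat \<lceil>Y w\<rceil>"
  have m: "real ?m \<le> Y w + 1" using Y(2)[of w] by linarith
  have "(\<Sum>k<N. real k * of_bool (real k < Y w)) \<le> (\<Sum>k<?m. real k)"
    by (rule sum_tail_lessThan) simp
  also have "\<dots> \<le> (real ?m)\<^sup>2" using sum_lessThan_real[of ?m] zero_le_power2[of "real ?m"] by linarith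
  also have "\<dots> \<le> (Y w + 1)\<^sup>2" using m by (intro power_mono) auto
  finally show "(\<Sum>k<N. real k * of_bool (real k < Y w)) \<le> (Y w + 1)\<^sup>2" .
qed auto

lemma integrable_of_summable_tail_1:
  assumes [measurable]: "Y \<in> borel_measurable M" and Y: "\<And>w. 0 \<le> Y w"
    and sm: "summable (\<lambda>k. prob {w \<in> space M. real k < Y w})"
  shows "integrable M Y"
proof (rule integrable_of_summable_tail[where \<phi> = "\<lambda>y. y" and a = "\<lambda>_. 1" and C = 0])
  fix w
  show "\<exists>N. Y w \<le> 0 + (\<Sum>k<N. 1 * of_bool (real k < Y w))"
    by (intro exI[of _ "nat \<lceil>Y w\<rceil>"], subst sum_tail_ceiling[where f = "\<lambda>_. 1"]) (simp, linarith)
qed (use Y sm in auto)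

lemma integrable_of_summable_tail_2:
  assumes [measurable]: "Y \<in> borel_measurable M" and Y: "\<And>w. 0 \<le> Y w"
    and sm: "summable (\<lambda>k. real k * prob {w \<in> space M. real k < Y w})"
  shows "integrable M (\<lambda>w. (Y w)\<^sup>2)"
proof (rule integrable_of_summable_tail[where \<phi> = "\<lambda>y. y\<^sup>2" and a = "\<lambda>k. 4 * real k" and C = 4])
  fix w
  let ?m = "nat \<lceil>Y w\<rceil>"
  have "Y w \<le> real ?m" by linarith
  then have "(Y w)\<^sup>2 \<le> (real ?m)\<^sup>2" using Y by (intro power_mono)
  \<comment> \<open>By \<open>sum_lessThan_real\<close> the difference of the two sides is
    \<open>(real ?m - 1)\<^sup>2 + 3\<close>.\<close>
  also have "\<dots> \<le> 4 + 4 * (\<Sum>k<?m. real k)"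
  proof -
    have "0 \<le> (real ?m - 1)\<^sup>2" by simp
    then show ?thesis using sum_lessThan_real[of ?m] by (simp add: power2_diff)
  qed
  finally show "\<exists>N. (Y w)\<^sup>2 \<le> 4 + (\<Sum>k<N. 4 * real k * of_bool (real k < Y w))"
    by (intro exI[of _ ?m], subst sum_tail_ceiling) (simp add: sum_distrib_left)
next
  show "summable (\<lambda>k. 4 * real k * prob {w \<in> space M. real k < Y w})"
    using summable_mult[OF sm, of 4] by (simp add: mult.assoc)
qed auto

text \<open>The second Borel-Cantelli lemma, for blocks and in contrapositive form. If exceedances
  almost surely stop, some event \<open>G m\<close> that none occurs from \<open>m\<close> on has
  probability above 1/2. Independence bounds this probability by \<open>exp\<close> of minus any
  finite sum of exceedance probabilities from \<open>m\<close> on, so these sums stay below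
  \<open>ln 2\<close>.\<close>

lemma borel_cantelli_indep:
  fixes Y :: "'i \<Rightarrow> 'a \<Rightarrow> real" and E :: "nat \<Rightarrow> 'i set"
  assumes ind: "indep_vars (\<lambda>_. borel) Y I" and E: "\<And>n. finite (E n)" "\<And>n. E n \<subseteq> I" "disjoint_family E"
    and ae: "AE w in M. eventually (\<lambda>n. \<forall>e\<in>E n. Y e w \<le> c n) sequentially"
  shows "summable (\<lambda>n. \<Sum>e\<in>E n. prob {w \<in> space M. c n < Y e w})"
proof -
  have Ym: "e \<in> I \<Longrightarrow> Y e \<in> borel_measurable M" for e using ind by (simp add: indep_vars_def)
  define G where "G m = {w \<in> space M. \<forall>n\<in>{m..}. \<forall>e\<in>E n. Y e w \<le> c n}" for m
  have G[measurable]: "G m \<in> sets M" for m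
  proof -
    have "{w \<in> space M. \<forall>e\<in>E n. Y e w \<le> c n} \<in> sets M" for n
    proof (rule sets.sets_Collect_finite_All)
      fix e assume "e \<in> E n"
      then have [measurable]: "Y e \<in> borel_measurable M" using E Ym by blast
      show "{w \<in> space M. Y e w \<le> c n} \<in> sets M" by measurable
    qed (use E in simp)
    then show ?thesis unfolding G_def by (intro sets.sets_Collect_countable_Ball) auto
  qed
  have "incseq G" by (auto simp: incseq_def G_def)
  then have "(\<lambda>m. prob (G m)) \<longlonglongrightarrow> prob (\<Union>m. G m)"
    by (intro finite_Lim_measure_incseq) auto
  also have "prob (\<Union>m. G m) = 1"
  proof (rule prob_eq_1[THEN iffD2])
    show "AE w in M. w \<in> (\<Union>m. G m)"
      using ae AE_space by eventually_elim (auto simp: G_def eventually_sequentially)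
  qed auto
  finally have "eventually (\<lambda>m. prob (G m) > 1 / 2) sequentially" by (rule order_tendstoD) simp
  then obtain m where m: "prob (G m) > 1 / 2" by (auto simp: eventually_sequentially)
  let ?p = "\<lambda>n e. prob {w \<in> space M. c n < Y e w}"
  have bound: "(\<Sum>n\<in>{m..<N}. \<Sum>e\<in>E n. ?p n e) \<le> ln 2" for N
  proof -
    define J where "J = (\<Union>n\<in>{m..<N}. E n)"
    have J: "finite J" "J \<subseteq> I" using E by (auto simp: J_def)
    \<comment> \<open>The blocks are disjoint, so each index knows its own threshold; this turns the
      double sum into a sum over the single independent family \<open>J\<close>.\<close>
    define lev where "lev e = (THE n. e \<in> E n)" for e
    have lev: "e \<in> E n \<Longrightarrow> lev e = n" for e n
      unfolding lev_def using E(3) by (intro the_equality) (auto simp: disjoint_family_on_def)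
    have s: "(\<Sum>n\<in>{m..<N}. \<Sum>e\<in>E n. ?p n e) = (\<Sum>e\<in>J. ?p (lev e) e)"
    proof -
      have "(\<Sum>n\<in>{m..<N}. \<Sum>e\<in>E n. ?p n e) = (\<Sum>n\<in>{m..<N}. \<Sum>e\<in>E n. ?p (lev e) e)"
        by (intro sum.cong refl) (simp add: lev)
      also have "\<dots> = (\<Sum>e\<in>J. ?p (lev e) e)"
        unfolding J_def using E by (intro sum.UNION_disjoint[symmetric]) (auto simp: disjoint_family_on_def)
      finally show ?thesis .
    qed
    show ?thesis
    proof (cases "J = {}")
      case True
      then show ?thesis unfolding s by simp
    next
      case False
      have "1 / 2 < prob (G m)" by (rule m)
      also have "prob (G m) \<le> prob (\<Inter>e\<in>J. Y e -` {..c (lev e)} \<inter> space M)"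
      proof (rule finite_measure_mono)
        show "G m \<subseteq> (\<Inter>e\<in>J. Y e -` {..c (lev e)} \<inter> space M)"
          by (auto simp: G_def J_def lev)
        show "(\<Inter>e\<in>J. Y e -` {..c (lev e)} \<inter> space M) \<in> sets M"
          using J False Ym by (intro sets.finite_INT measurable_sets[where A = borel]) auto
      qed
      also have "\<dots> = (\<Prod>e\<in>J. prob (Y e -` {..c (lev e)} \<inter> space M))"
        by (rule indep_varsD[OF ind False J]) simp
      also have "\<dots> \<le> (\<Prod>e\<in>J. exp (- ?p (lev e) e))"
      proof (intro prod_mono conjI measure_nonneg)
        fix e assume "e \<in> J"
        then have [measurable]: "Y e \<in> borel_measurable M" using J Ym by auto
        have "Y e -` {..c (lev e)} \<inter> space M = space M - {w \<in> space M. c (lev e) < Y e w}" by auto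
        then have "prob (Y e -` {..c (lev e)} \<inter> space M) = 1 - ?p (lev e) e"
          by (simp add: prob_compl)
        also have "\<dots> \<le> exp (- ?p (lev e) e)" using exp_ge_add_one_self[of "- ?p (lev e) e"] by simp
        finally show "prob (Y e -` {..c (lev e)} \<inter> space M) \<le> exp (- ?p (lev e) e)" .
      qed
      also have "\<dots> = exp (- (\<Sum>e\<in>J. ?p (lev e) e))"
        using J by (simp add: exp_sum sum_negf[symmetric])
      finally have "ln (1 / 2) < ln (exp (- (\<Sum>e\<in>J. ?p (lev e) e)))"
        by (subst ln_less_cancel_iff) simp_all
      then show ?thesis unfolding s by (simp add: ln_div)
    qed
  qed
  show ?thesis
  proof (rule summableI_nonneg_bounded)
    fix N
    have "(\<Sum>n<N. \<Sum>e\<in>E n. ?p n e) \<le> (\<Sum>n\<in>{..<m} \<union> {m..<N}. \<Sum>e\<in>E n. ?p n e)"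
      by (intro sum_mono2) (auto intro: sum_nonneg)
    also have "\<dots> = (\<Sum>n<m. \<Sum>e\<in>E n. ?p n e) + (\<Sum>n\<in>{m..<N}. \<Sum>e\<in>E n. ?p n e)"
      by (intro sum.union_disjoint) auto
    also have "\<dots> \<le> (\<Sum>n<m. \<Sum>e\<in>E n. ?p n e) + ln 2" using bound by simp
    finally show "(\<Sum>n<N. \<Sum>e\<in>E n. ?p n e) \<le> (\<Sum>n<m. \<Sum>e\<in>E n. ?p n e) + ln 2" .
  qed (auto intro: sum_nonneg)
qed

end

text \<open>Only finitely many columns violate their own bound, and their entries, bounded by some
  \<open>B\<close>, are eventually swamped by the growing root.\<close>

lemma eventually_all_le_sqrt:
  fixes f :: "nat \<Rightarrow> nat \<Rightarrow> real"
  assumes ev: "eventually (\<lambda>k. \<forall>j\<in>J k. f j k \<le> \<delta> * sqrt (real k)) sequentially"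
    and J: "\<And>k. finite (J k)" and \<delta>: "\<delta> > 0"
  shows "eventually (\<lambda>n. \<forall>k\<le>n. \<forall>j\<in>J k. f j k \<le> \<delta> * sqrt (real n)) sequentially"
proof -
  obtain k0 where k0: "\<And>k j. k \<ge> k0 \<Longrightarrow> j \<in> J k \<Longrightarrow> f j k \<le> \<delta> * sqrt (real k)"
    using ev by (auto simp: eventually_sequentially)
  define B where "B = (\<Sum>k<k0. \<Sum>j\<in>J k. \<bar>f j k\<bar>)"
  have B: "f j k \<le> B" if "k < k0" "j \<in> J k" for j k
  proof -
    have "\<bar>f j k\<bar> \<le> (\<Sum>j\<in>J k. \<bar>f j k\<bar>)" using that J by (intro member_le_sum) auto
    also have "\<dots> \<le> B" unfolding B_def using that
      by (intro member_le_sum[of k "{..<k0}" "\<lambda>k. \<Sum>j\<in>J k. \<bar>f j k\<bar>"]) (auto intro: sum_nonneg)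
    finally show ?thesis by linarith
  qed
  have "filterlim (\<lambda>n::nat. \<delta> * sqrt (real n)) at_top sequentially"
    using \<delta> by real_asymp
  then have "eventually (\<lambda>n. B \<le> \<delta> * sqrt (real n)) sequentially"
    by (simp add: filterlim_at_top)
  then show ?thesis
  proof eventually_elim
    case (elim n)
    show ?case
    proof (intro allI impI ballI)
      fix k j assume kj: "k \<le> n" "j \<in> J k"
      show "f j k \<le> \<delta> * sqrt (real n)"
      proof (cases "k < k0")
        case True
        then show ?thesis using B[OF True kj(2)] elim by linarith
      next
        case False
        then have "f j k \<le> \<delta> * sqrt (real k)" using k0 kj by simp
        also have "\<dots> \<le> \<delta> * sqrt (real n)" using kj \<delta> by (intro mult_left_mono) auto
        finally show ?thesis .
      qed
    qed
  qed
qed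

declare One_nat_def [simp del]

section \<open>Truncation\<close>

locale quat_wigner = prob_space M for M :: "'w measure" +
  fixes x :: "nat \<Rightarrow> nat \<Rightarrow> 'w \<Rightarrow> quat"
  assumes x_herm: "\<And>j k \<omega>. 1 \<le> j \<Longrightarrow> 1 \<le> k \<Longrightarrow> \<omega> \<in> space M \<Longrightarrow> x k j \<omega> = quat_cnj (x j k \<omega>)"
    and x_indep: "indep_vars (\<lambda>_. borel) (\<lambda>(j, k). x j k) {(j, k). 1 \<le> j \<and> j \<le> k}"
    and x_diag: "\<And>j. 1 \<le> j \<Longrightarrow> distr M borel (x j j) = distr M borel (x 1 1)"
    and x_off: "\<And>j k. 1 \<le> j \<Longrightarrow> j < k \<Longrightarrow> distr M borel (x j k) = distr M borel (x 1 2)"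
begin

lemma x_measurable: "1 \<le> j \<Longrightarrow> j \<le> k \<Longrightarrow> x j k \<in> borel_measurable M"
  using x_indep unfolding indep_vars_def by auto

lemma herm_x: "\<omega> \<in> space M \<Longrightarrow> herm (\<lambda>j k. x j k \<omega>) n"
  unfolding herm_def by (intro ballI x_herm) auto

lemma norm_x_sym: "1 \<le> j \<Longrightarrow> 1 \<le> k \<Longrightarrow> \<omega> \<in> space M \<Longrightarrow> norm (x k j \<omega>) = norm (x j k \<omega>)"
  using x_herm[of j k \<omega>] by simp

lemma off_transfer:
  fixes f :: "quat \<Rightarrow> 'b :: {banach, second_countable_topology}"
  assumes [measurable]: "f \<in> borel_measurable borel" and jk: "1 \<le> j" "j < k"
  shows "expectation (\<lambda>\<omega>. f (x j k \<omega>)) = expectation (\<lambda>\<omega>. f (x 1 2 \<omega>))"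
proof -
  have [measurable]: "x j k \<in> borel_measurable M" by (rule x_measurable) (use jk in auto)
  have [measurable]: "x 1 2 \<in> borel_measurable M" by (rule x_measurable) auto
  have "expectation (\<lambda>\<omega>. f (x j k \<omega>)) = integral\<^sup>L (distr M borel (x j k)) f"
    by (subst integral_distr) auto
  also have "\<dots> = expectation (\<lambda>\<omega>. f (x 1 2 \<omega>))"
    unfolding x_off[OF jk] by (subst integral_distr) auto
  finally show ?thesis .
qed

lemma off_prob:
  assumes [measurable]: "A \<in> sets borel" and jk: "1 \<le> j" "j < k"
  shows "prob (x j k -` A \<inter> space M) = prob (x 1 2 -` A \<inter> space M)"
proof -
  have [measurable]: "x j k \<in> borel_measurable M" by (rule x_measurable) (use jk in auto)
  have [measurable]: "x 1 2 \<in> borel_measurable M" by (rule x_measurable) auto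
  have "prob (x j k -` A \<inter> space M) = measure (distr M borel (x j k)) A"
    by (subst measure_distr) auto
  also have "\<dots> = prob (x 1 2 -` A \<inter> space M)"
    unfolding x_off[OF jk] by (subst measure_distr) auto
  finally show ?thesis .
qed

lemma diag_prob:
  assumes [measurable]: "A \<in> sets borel" and j: "1 \<le> j"
  shows "prob (x j j -` A \<inter> space M) = prob (x 1 1 -` A \<inter> space M)"
proof -
  have [measurable]: "x j j \<in> borel_measurable M" by (rule x_measurable) (use j in auto)
  have [measurable]: "x 1 1 \<in> borel_measurable M" by (rule x_measurable) auto
  have "prob (x j j -` A \<inter> space M) = measure (distr M borel (x j j)) A"
    by (subst measure_distr) auto
  also have "\<dots> = prob (x 1 1 -` A \<inter> space M)"
    unfolding x_diag[OF j] by (subst measure_distr) auto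
  finally show ?thesis .
qed

lemma norm_gt_vimage: "{\<omega> \<in> space M. c < norm (x j k \<omega>)} = x j k -` {q. c < norm q} \<inter> space M"
  by auto

lemma norm_gt_borel [measurable]: "{q :: quat. c < norm q} \<in> sets borel"
  by measurable

lemma off_prob_norm:
  "1 \<le> j \<Longrightarrow> j < k \<Longrightarrow> prob {\<omega> \<in> space M. c < norm (x j k \<omega>)} = prob {\<omega> \<in> space M. c < norm (x 1 2 \<omega>)}"
  unfolding norm_gt_vimage by (rule off_prob[OF norm_gt_borel])

lemma diag_prob_norm:
  "1 \<le> j \<Longrightarrow> prob {\<omega> \<in> space M. c < norm (x j j \<omega>)} = prob {\<omega> \<in> space M. c < norm (x 1 1 \<omega>)}"
  unfolding norm_gt_vimage by (rule diag_prob[OF norm_gt_borel])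

text \<open>Borel-Cantelli by columns: an entry is compared once, with the root of its own column
  index, and not anew for every larger \<open>n\<close>. This is why two moments on the diagonal and
  four off it suffice.\<close>

lemma small_entries:
  assumes \<delta>: "\<delta> > 0" and J: "\<And>k. finite (J k)" "\<And>k j. j \<in> J k \<Longrightarrow> 1 \<le> j \<and> j \<le> k"
    and q: "\<And>k j. j \<in> J k \<Longrightarrow> prob {\<omega> \<in> space M. \<delta> * sqrt (real k) < norm (x j k \<omega>)} \<le> q k"
    and sm: "summable (\<lambda>k. real (card (J k)) * q k)"
  shows "AE \<omega> in M. eventually (\<lambda>n. \<forall>k\<le>n. \<forall>j\<in>J k. norm (x j k \<omega>) \<le> \<delta> * sqrt (real n)) sequentially"
proof -
  define A where "A k = (\<Union>j\<in>J k. {\<omega> \<in> space M. \<delta> * sqrt (real k) < norm (x j k \<omega>)})" for k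
  have m: "{\<omega> \<in> space M. \<delta> * sqrt (real k) < norm (x j k \<omega>)} \<in> sets M" if "j \<in> J k" for j k
  proof -
    have [measurable]: "x j k \<in> borel_measurable M" using J(2)[OF that] x_measurable by blast
    show ?thesis by measurable
  qed
  have [measurable]: "A k \<in> sets M" for k
    unfolding A_def using J(1) m by (intro sets.finite_UN) auto
  have "prob (A k) \<le> real (card (J k)) * q k" for k
  proof -
    have "prob (A k) \<le> (\<Sum>j\<in>J k. prob {\<omega> \<in> space M. \<delta> * sqrt (real k) < norm (x j k \<omega>)})"
      unfolding A_def using J(1) m by (intro finite_measure_subadditive_finite) auto
    also have "\<dots> \<le> (\<Sum>j\<in>J k. q k)" by (intro sum_mono q)
    finally show ?thesis by simp
  qed
  then have "summable (\<lambda>k. prob (A k))"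
    by (intro summable_comparison_test_ev[OF _ sm]) auto
  then have "AE \<omega> in M. eventually (\<lambda>k. \<omega> \<in> space M - A k) sequentially"
    by (intro borel_cantelli_AE1) (auto simp: emeasure_eq_measure)
  then show ?thesis
  proof (rule AE_mp, intro AE_I2 impI)
    fix \<omega> assume "eventually (\<lambda>k. \<omega> \<in> space M - A k) sequentially"
    then have "eventually (\<lambda>k. \<forall>j\<in>J k. norm (x j k \<omega>) \<le> \<delta> * sqrt (real k)) sequentially"
      by eventually_elim (auto simp: A_def not_less)
    then show "eventually (\<lambda>n. \<forall>k\<le>n. \<forall>j\<in>J k. norm (x j k \<omega>) \<le> \<delta> * sqrt (real n)) sequentially"
      by (rule eventually_all_le_sqrt[OF _ J(1) \<delta>])
  qed
qed

lemma norm_gt_sqrt_iff: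
  assumes "\<delta> > 0"
  shows "\<delta> * sqrt (real k) < norm (q :: quat) \<longleftrightarrow> real k < (norm q)\<^sup>2 / \<delta>\<^sup>2"
proof -
  have "\<delta> * sqrt (real k) < norm q \<longleftrightarrow> sqrt (real k) < norm q / \<delta>"
    using assms by (simp add: field_simps)
  also have "\<dots> \<longleftrightarrow> sqrt (real k) < sqrt ((norm q / \<delta>)\<^sup>2)" using assms by simp
  also have "\<dots> \<longleftrightarrow> real k < (norm q / \<delta>)\<^sup>2" by (rule real_sqrt_less_iff)
  finally show ?thesis by (simp add: power_divide)
qed

lemma diag_small:
  assumes int: "integrable M (\<lambda>\<omega>. (norm (x 1 1 \<omega>))\<^sup>2)" and \<delta>: "\<delta> > 0"
  shows "AE \<omega> in M. eventually (\<lambda>n. \<forall>k\<in>{1..n}. norm (x k k \<omega>) \<le> \<delta> * sqrt (real n)) sequentially"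
proof -
  define J where "J k = (if k \<ge> 1 then {k} else {})" for k :: nat
  define q where "q k = prob {\<omega> \<in> space M. real k < (norm (x 1 1 \<omega>))\<^sup>2 / \<delta>\<^sup>2}" for k
  have "AE \<omega> in M. eventually (\<lambda>n. \<forall>k\<le>n. \<forall>j\<in>J k. norm (x j k \<omega>) \<le> \<delta> * sqrt (real n)) sequentially"
  proof (rule small_entries[OF \<delta>, where q = q])
    show "prob {\<omega> \<in> space M. \<delta> * sqrt (real k) < norm (x j k \<omega>)} \<le> q k" if "j \<in> J k" for j k
      using that diag_prob_norm[of k "\<delta> * sqrt (real k)"] by (simp add: J_def q_def norm_gt_sqrt_iff[OF \<delta>] split: if_splits)
    have "summable q" unfolding q_def by (rule summable_tail_1) (use int in auto)
    then show "summable (\<lambda>k. real (card (J k)) * q k)"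
      by (rule summable_comparison_test_ev[rotated]) (auto intro!: always_eventually simp: J_def q_def)
  qed (auto simp: J_def split: if_splits)
  then show ?thesis
    by (rule AE_mp) (auto simp: J_def elim!: eventually_mono intro!: AE_I2)
qed

text \<open>Column \<open>k\<close> has about \<open>k\<close> entries above the diagonal, which
  turns the tail sum into that of a second moment of the squared norm.\<close>

lemma off_small:
  assumes int: "integrable M (\<lambda>\<omega>. norm (x 1 2 \<omega>) ^ 4)" and \<delta>: "\<delta> > 0"
  shows "AE \<omega> in M. eventually (\<lambda>n. \<forall>k\<le>n. \<forall>j\<in>{1..<k}. norm (x j k \<omega>) \<le> \<delta> * sqrt (real n)) sequentially"
proof (rule small_entries[OF \<delta>, where q = "\<lambda>k. prob {\<omega> \<in> space M. real k < (norm (x 1 2 \<omega>))\<^sup>2 / \<delta>\<^sup>2}"])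
  let ?q = "\<lambda>k. prob {\<omega> \<in> space M. real k < (norm (x 1 2 \<omega>))\<^sup>2 / \<delta>\<^sup>2}"
  show "prob {\<omega> \<in> space M. \<delta> * sqrt (real k) < norm (x j k \<omega>)} \<le> ?q k" if "j \<in> {1..<k}" for j k
    using that off_prob_norm[of j k "\<delta> * sqrt (real k)"] by (simp add: norm_gt_sqrt_iff[OF \<delta>])
  have [measurable]: "x 1 2 \<in> borel_measurable M" by (rule x_measurable) auto
  have "summable (\<lambda>k. real k * ?q k)"
    by (rule summable_tail_2) (use int in \<open>auto simp: power_divide simp flip: power_mult\<close>)
  then show "summable (\<lambda>k. real (card {1..<k}) * ?q k)"
    by (rule summable_comparison_test_ev[rotated]) (auto intro!: always_eventually mult_right_mono)
qed auto

end

text \<open>The exponent is below 1/2, so that truncated entries are negligible against $\sqrt n$, but large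
  enough for $n^4 (n^{-4\cdot 7/16})^3 = n^{-5/4}$, a bound for the probability of three large
  entries in one row, to be summable.\<close>

definition cutoff :: "nat \<Rightarrow> real" where "cutoff n = real n powr (7 / 16)"

lemma cutoff_nonneg: "0 \<le> cutoff n" by (simp add: cutoff_def)

lemma three_distinct:
  assumes "card A \<ge> 3"
  obtains a b c where "a \<in> A" "b \<in> A" "c \<in> A" "a \<noteq> b" "a \<noteq> c" "b \<noteq> c"
proof -
  obtain B where B: "B \<subseteq> A" "card B = 3" by (rule obtain_subset_with_card_n[OF assms])
  from B(2)[unfolded card_3_iff] obtain a b c
    where "B = {a, b, c}" "a \<noteq> b" "a \<noteq> c" "b \<noteq> c" by (elim exE conjE)
  with B(1) that[of a b c] show ?thesis by simp
qed

locale quat_wigner4 = quat_wigner M x for M :: "'w measure" and x +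
  assumes int4: "integrable M (\<lambda>\<omega>. norm (x 1 2 \<omega>) ^ 4)"
begin

lemma x12_measurable [measurable]: "x 1 2 \<in> borel_measurable M"
  by (rule x_measurable) auto

lemma x12_sq_integrable: "integrable M (\<lambda>\<omega>. (norm (x 1 2 \<omega>))\<^sup>2)"
  by (rule square_integrable_imp_integrable) (use int4 in \<open>auto simp flip: power_mult\<close>)

lemma x12_integrable: "integrable M (x 1 2)"
  by (rule integrable_norm_cancel)
     (auto intro: square_integrable_imp_integrable[OF _ x12_sq_integrable])

definition mu4 :: real where "mu4 = expectation (\<lambda>\<omega>. norm (x 1 2 \<omega>) ^ 4)"

lemma mu4_nonneg: "0 \<le> mu4"
  unfolding mu4_def by (rule Bochner_Integration.integral_nonneg) simp

lemma prob_large: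
  assumes "n \<ge> 1"
  shows "prob {\<omega> \<in> space M. cutoff n < norm (x 1 2 \<omega>)} \<le> mu4 * real n powr (- (7 / 4))"
proof -
  have c: "cutoff n > 0" using assms by (simp add: cutoff_def)
  have "prob {\<omega> \<in> space M. cutoff n < norm (x 1 2 \<omega>)} \<le> prob {\<omega> \<in> space M. norm (x 1 2 \<omega>) ^ 4 \<ge> cutoff n ^ 4}"
    using c by (intro finite_measure_mono) (auto intro!: power_mono)
  also have "\<dots> \<le> mu4 / cutoff n ^ 4"
    unfolding mu4_def using c by (intro integral_Markov_inequality_measure[OF int4 sets.empty_sets]) auto
  also have "cutoff n ^ 4 = cutoff n powr real (4 :: nat)" using c by (rule powr_realpow[symmetric])
  also have "\<dots> = real n powr (7 / 4)" unfolding cutoff_def powr_powr by simp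
  finally show ?thesis by (simp only: powr_minus divide_inverse)
qed

text \<open>A union bound over a row and three further indices; the three entries lie on different
  edges and are independent. Two large entries per row are tolerable, since each of them is small
  against \<open>sqrt n\<close> by \<open>off_small\<close>.\<close>

lemma two_large_per_row:
  "AE \<omega> in M. eventually (\<lambda>n. \<forall>i\<in>{1..n}. card {k \<in> {1..n}. k \<noteq> i \<and> cutoff n < norm (x i k \<omega>)} \<le> 2) sequentially"
proof -
  define L where "L n e = {\<omega> \<in> space M. cutoff n < norm (x (fst e) (snd e) \<omega>)}" for n and e :: "nat \<times> nat"
  define Q where "Q n = {(i, a, b, c). {i, a, b, c} \<subseteq> {1..n} \<and> card {i, a, b, c} = 4}" for n :: nat
  define T where "T n = (\<lambda>(i, a, b, c). L n (edge i a) \<inter> L n (edge i b) \<inter> L n (edge i c))" for n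
  define U where "U n = (\<Union>p\<in>Q n. T n p)" for n
  have Qsub: "Q n \<subseteq> {1..n} \<times> {1..n} \<times> {1..n} \<times> {1..n}" for n by (auto simp: Q_def)
  then have finQ: "finite (Q n)" for n by (rule finite_subset) auto
  have cardQ: "card (Q n) \<le> n ^ 4" for n
    using card_mono[OF _ Qsub[of n]] by (simp add: card_cartesian_product power4_eq_xxxx mult.assoc)
  have d4: "i \<noteq> a \<and> i \<noteq> b \<and> i \<noteq> c \<and> a \<noteq> b \<and> a \<noteq> c \<and> b \<noteq> c" if "card {i, a, b, c} = 4" for i a b c :: nat
    using that by (auto simp: card_insert_if split: if_splits)
  have edge_up: "1 \<le> fst (edge i a)" "fst (edge i a) < snd (edge i a)" if "i \<noteq> a" "1 \<le> i" "1 \<le> a" for i a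
    using that by (auto simp: edge_def)
  have Lm: "L n (edge i a) \<in> sets M" if "i \<noteq> a" "1 \<le> i" "1 \<le> a" for n i a
  proof -
    have [measurable]: "x (fst (edge i a)) (snd (edge i a)) \<in> borel_measurable M"
      using edge_up[OF that] by (intro x_measurable) auto
    show ?thesis unfolding L_def by measurable
  qed
  have Tm: "T n p \<in> sets M" if "p \<in> Q n" for n p
  proof -
    obtain i a b c where p: "p = (i, a, b, c)" by (cases p) auto
    have q: "{i, a, b, c} \<subseteq> {1..n}" "card {i, a, b, c} = 4" using that p by (auto simp: Q_def)
    note d = d4[OF q(2)]
    have r: "1 \<le> i" "1 \<le> a" "1 \<le> b" "1 \<le> c" using q(1) by auto
    show ?thesis unfolding p T_def split_conv
      by (intro sets.Int Lm) (use d r in blast)+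
  qed
  have PT: "prob (T n p) \<le> (mu4 * real n powr (- (7 / 4))) ^ 3" if "p \<in> Q n" for n p
  proof -
    obtain i a b c where p: "p = (i, a, b, c)" by (cases p) auto
    have sub: "i \<in> {1..n}" "a \<in> {1..n}" "b \<in> {1..n}" "c \<in> {1..n}" and d: "card {i, a, b, c} = 4"
      using that p by (auto simp: Q_def)
    note d = d4[OF d]
    let ?J = "{edge i a, edge i b, edge i c}"
    have J: "edge i a \<noteq> edge i b" "edge i a \<noteq> edge i c" "edge i b \<noteq> edge i c"
      using d by (auto simp: edge_eq_iff)
    have Jsub: "?J \<subseteq> {(j, k). 1 \<le> j \<and> j \<le> k}"
      using sub by (auto simp: edge_def)
    have pe: "prob ((case e of (j, k) \<Rightarrow> x j k) -` {q. cutoff n < norm q} \<inter> space M) \<le> mu4 * real n powr (- (7 / 4))"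
      if "e \<in> ?J" for e
    proof -
      have "1 \<le> fst e" "fst e < snd e" using that d sub edge_up by auto
      then have "prob ((case e of (j, k) \<Rightarrow> x j k) -` {q. cutoff n < norm q} \<inter> space M)
          = prob {\<omega> \<in> space M. cutoff n < norm (x 1 2 \<omega>)}"
        using off_prob_norm[of "fst e" "snd e" "cutoff n"] by (simp add: norm_gt_vimage case_prod_beta)
      then show ?thesis using prob_large[of n] sub by simp
    qed
    have "T n p = (\<Inter>e\<in>?J. (case e of (j, k) \<Rightarrow> x j k) -` {q. cutoff n < norm q} \<inter> space M)"
      by (auto simp: p T_def L_def case_prod_beta)
    then have "prob (T n p) = (\<Prod>e\<in>?J. prob ((case e of (j, k) \<Rightarrow> x j k) -` {q. cutoff n < norm q} \<inter> space M))"
      using indep_varsD[OF x_indep, of ?J "\<lambda>_. {q. cutoff n < norm q}"] Jsub by simp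
    also have "\<dots> \<le> (\<Prod>e\<in>?J. mu4 * real n powr (- (7 / 4)))"
      by (intro prod_mono conjI measure_nonneg pe)
    finally show ?thesis using J by (simp add: power3_eq_cube mult.assoc)
  qed
  have [measurable]: "U n \<in> sets M" for n
    unfolding U_def using finQ Tm by (intro sets.finite_UN) auto
  have "summable (\<lambda>n. prob (U n))"
  proof (rule summable_comparison_test_ev)
    show "summable (\<lambda>n. mu4 ^ 3 * real n powr (- (5 / 4)))"
      by (intro summable_mult) (subst summable_real_powr_iff, simp)
    show "eventually (\<lambda>n. norm (prob (U n)) \<le> mu4 ^ 3 * real n powr (- (5 / 4))) sequentially"
      using eventually_ge_at_top[of 1]
    proof eventually_elim
      case (elim n)
      have "prob (U n) \<le> (\<Sum>p\<in>Q n. prob (T n p))"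
        unfolding U_def using finQ Tm by (intro finite_measure_subadditive_finite) auto
      also have "\<dots> \<le> (\<Sum>p\<in>Q n. (mu4 * real n powr (- (7 / 4))) ^ 3)"
        by (intro sum_mono PT)
      also have "\<dots> = real (card (Q n)) * (mu4 * real n powr (- (7 / 4))) ^ 3" by simp
      also have "\<dots> \<le> real (n ^ 4) * (mu4 * real n powr (- (7 / 4))) ^ 3"
        using cardQ[of n] mu4_nonneg by (intro mult_right_mono) (simp_all del: of_nat_power)
      also have "\<dots> = mu4 ^ 3 * (real n powr 4 * (real n powr (- (7 / 4))) powr 3)"
        using elim by (simp add: power_mult_distrib powr_numeral)
      also have "real n powr 4 * (real n powr (- (7 / 4))) powr 3 = real n powr (- (5 / 4))"
        unfolding powr_powr powr_add[symmetric] by simp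
      finally show ?case by simp
    qed
  qed
  then have "AE \<omega> in M. eventually (\<lambda>n. \<omega> \<in> space M - U n) sequentially"
    by (intro borel_cantelli_AE1) (auto simp: emeasure_eq_measure)
  then show ?thesis
  proof (rule AE_mp, intro AE_I2 impI)
    fix \<omega> assume "eventually (\<lambda>n. \<omega> \<in> space M - U n) sequentially"
    then show "eventually (\<lambda>n. \<forall>i\<in>{1..n}. card {k \<in> {1..n}. k \<noteq> i \<and> cutoff n < norm (x i k \<omega>)} \<le> 2) sequentially"
    proof eventually_elim
      case (elim n)
      show ?case
      proof (intro ballI, rule ccontr)
        fix i assume i: "i \<in> {1..n}" and "\<not> card {k \<in> {1..n}. k \<noteq> i \<and> cutoff n < norm (x i k \<omega>)} \<le> 2"
        then have "card {k \<in> {1..n}. k \<noteq> i \<and> cutoff n < norm (x i k \<omega>)} \<ge> 3" by simp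
        then obtain a b c where abc: "a \<in> {k \<in> {1..n}. k \<noteq> i \<and> cutoff n < norm (x i k \<omega>)}"
          "b \<in> {k \<in> {1..n}. k \<noteq> i \<and> cutoff n < norm (x i k \<omega>)}"
          "c \<in> {k \<in> {1..n}. k \<noteq> i \<and> cutoff n < norm (x i k \<omega>)}" and d: "a \<noteq> b" "a \<noteq> c" "b \<noteq> c"
          by (rule three_distinct)
        have L: "\<omega> \<in> L n (edge i k)" if "k \<in> {k \<in> {1..n}. k \<noteq> i \<and> cutoff n < norm (x i k \<omega>)}" for k
          using that i elim norm_x_sym[of i k \<omega>] by (auto simp: L_def edge_def min_def max_def)
        have "(i, a, b, c) \<in> Q n" using i abc d by (auto simp: Q_def card_insert_if)
        moreover have "\<omega> \<in> T n (i, a, b, c)" using abc L by (simp add: T_def)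
        ultimately show False using elim unfolding U_def by blast
      qed
    qed
  qed
qed

section \<open>Truncated and centred entries\<close>

definition trunc :: "nat \<Rightarrow> quat \<Rightarrow> quat" where
  "trunc n q = (if norm q \<le> cutoff n then q else 0)"

definition tmean :: "nat \<Rightarrow> quat" where
  "tmean n = expectation (\<lambda>\<omega>. trunc n (x 1 2 \<omega>))"

text \<open>The value 0 off the strict upper triangle makes boundedness and measurability hold at
  every pair, as the locale for bounded arrays demands.\<close>

definition Z :: "nat \<Rightarrow> nat \<times> nat \<Rightarrow> 'w \<Rightarrow> quat" where
  "Z n = (\<lambda>(j, k) \<omega>. if 1 \<le> j \<and> j < k then trunc n (x j k \<omega>) - tmean n else 0)"

lemma trunc_measurable [measurable]: "trunc n \<in> borel_measurable borel"
  unfolding trunc_def by measurable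

lemma norm_trunc: "norm (trunc n q) \<le> cutoff n"
  by (simp add: trunc_def cutoff_nonneg)

lemma trunc_integrable: "integrable M (\<lambda>\<omega>. trunc n (x 1 2 \<omega>))"
  by (rule integrable_const_bound[where B = "cutoff n"]) (auto simp: norm_trunc)

lemma trunc_sq_integrable: "integrable M (\<lambda>\<omega>. (norm (trunc n (x 1 2 \<omega>)))\<^sup>2)"
  by (rule integrable_const_bound[where B = "(cutoff n)\<^sup>2"]) (auto intro!: power_mono simp: norm_trunc)

lemma norm_tmean: "norm (tmean n) \<le> cutoff n"
proof -
  have "norm (tmean n) \<le> expectation (\<lambda>\<omega>. norm (trunc n (x 1 2 \<omega>)))"
    unfolding tmean_def by (rule integral_norm_bound)
  also have "\<dots> \<le> expectation (\<lambda>\<omega>. cutoff n)"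
    using trunc_integrable by (intro integral_mono) (auto simp: norm_trunc)
  finally show ?thesis by (simp add: prob_space)
qed

lemma expectation_centred_sq:
  "expectation (\<lambda>\<omega>. (norm (trunc n (x 1 2 \<omega>) - tmean n))\<^sup>2)
    = expectation (\<lambda>\<omega>. (norm (trunc n (x 1 2 \<omega>)))\<^sup>2) - (norm (tmean n))\<^sup>2"
proof -
  let ?y = "\<lambda>\<omega>. trunc n (x 1 2 \<omega>)"
  have i: "integrable M (\<lambda>\<omega>. inner (?y \<omega>) (tmean n))" using trunc_integrable by auto
  have "expectation (\<lambda>\<omega>. (norm (?y \<omega> - tmean n))\<^sup>2)
      = expectation (\<lambda>\<omega>. (norm (?y \<omega>))\<^sup>2 - 2 * inner (?y \<omega>) (tmean n) + (norm (tmean n))\<^sup>2)"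
    by (intro Bochner_Integration.integral_cong refl)
       (simp add: power2_norm_eq_inner inner_diff_left inner_diff_right inner_commute)
  also have "\<dots> = expectation (\<lambda>\<omega>. (norm (?y \<omega>))\<^sup>2) - 2 * expectation (\<lambda>\<omega>. inner (?y \<omega>) (tmean n)) + (norm (tmean n))\<^sup>2"
    using i trunc_sq_integrable by (simp add: prob_space)
  also have "expectation (\<lambda>\<omega>. inner (?y \<omega>) (tmean n)) = inner (tmean n) (tmean n)"
    using trunc_integrable by (simp add: tmean_def)
  finally show ?thesis by (simp add: power2_norm_eq_inner)
qed

lemma Z_second:
  assumes "1 \<le> j" "j < k"
  shows "expectation (\<lambda>\<omega>. (norm (Z n (j, k) \<omega>))\<^sup>2)
    = expectation (\<lambda>\<omega>. (norm (trunc n (x 1 2 \<omega>)))\<^sup>2) - (norm (tmean n))\<^sup>2"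
  using off_transfer[of "\<lambda>q. (norm (trunc n q - tmean n))\<^sup>2" j k] assms
  by (simp add: Z_def expectation_centred_sq)

lemma trunc_second_le:
  "expectation (\<lambda>\<omega>. (norm (trunc n (x 1 2 \<omega>)))\<^sup>2) \<le> expectation (\<lambda>\<omega>. (norm (x 1 2 \<omega>))\<^sup>2)"
  using trunc_sq_integrable x12_sq_integrable by (intro integral_mono) (auto simp: trunc_def)

text \<open>The disjunction covers two uses: \<open>s\<close> at least the root of the full second
  moment, for the upper bound, and \<open>s\<close> the exact standard deviation after truncation,
  for the lower one.\<close>

lemma rand_array_Z:
  assumes s: "s > 0" and le: "expectation (\<lambda>\<omega>. (norm (x 1 2 \<omega>))\<^sup>2) \<le> s\<^sup>2
    \<or> expectation (\<lambda>\<omega>. (norm (trunc n (x 1 2 \<omega>)))\<^sup>2) - (norm (tmean n))\<^sup>2 \<le> s\<^sup>2"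
  shows "rand_array M (Z n) (2 * cutoff n) s"
proof
  show m: "Z n e \<in> borel_measurable M" for e
  proof -
    obtain j k where e: "e = (j, k)" by (cases e)
    show ?thesis
    proof (cases "1 \<le> j \<and> j < k")
      case True
      then have [measurable]: "x j k \<in> borel_measurable M" by (intro x_measurable) auto
      show ?thesis using True by (simp add: e Z_def)
    qed (auto simp: e Z_def)
  qed
  show "norm (Z n e w) \<le> 2 * cutoff n" for e w
  proof -
    obtain j k where e: "e = (j, k)" by (cases e)
    have "norm (trunc n (x j k w) - tmean n) \<le> cutoff n + cutoff n"
      by (rule order.trans[OF norm_triangle_ineq4 add_mono[OF norm_trunc norm_tmean]])
    then show ?thesis using cutoff_nonneg[of n] by (simp add: e Z_def)
  qed
  have "indep_vars (\<lambda>_. borel) (\<lambda>(j, k). x j k) {(j, k). 1 \<le> j \<and> j < k}"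
    by (rule indep_vars_subset[OF x_indep]) auto
  then have "indep_vars (\<lambda>_. borel) (\<lambda>e \<omega>. trunc n ((case e of (j, k) \<Rightarrow> x j k) \<omega>) - tmean n) {(j, k). 1 \<le> j \<and> j < k}"
    by (rule indep_vars_compose2[where Y = "\<lambda>e q. trunc n q - tmean n"]) measurable
  then show "indep_vars (\<lambda>_. borel) (Z n) {(j, k). 1 \<le> j \<and> j < k}"
    by (rule indep_vars_cong[THEN iffD1, rotated -1]) (auto simp: Z_def)
  fix j k :: nat assume jk: "1 \<le> j" "j < k"
  have "expectation (\<lambda>\<omega>. trunc n (x j k \<omega>) - tmean n) = expectation (\<lambda>\<omega>. trunc n (x 1 2 \<omega>) - tmean n)"
    using off_transfer[of "\<lambda>q. trunc n q - tmean n" j k] jk by simp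
  also have "\<dots> = 0" using trunc_integrable by (simp add: prob_space tmean_def)
  finally show "expectation (Z n (j, k)) = 0" using jk by (simp add: Z_def)
  have "0 \<le> (norm (tmean n))\<^sup>2" by simp
  then show "expectation (\<lambda>w. (norm (Z n (j, k) w))\<^sup>2) \<le> s\<^sup>2"
    unfolding Z_second[OF jk] using le trunc_second_le[of n] by linarith
qed (rule s)

lemma rand_array_exact_Z:
  assumes "s > 0" "expectation (\<lambda>\<omega>. (norm (trunc n (x 1 2 \<omega>)))\<^sup>2) - (norm (tmean n))\<^sup>2 = s\<^sup>2"
  shows "rand_array_exact M (Z n) (2 * cutoff n) s"
proof -
  interpret rand_array M "Z n" "2 * cutoff n" s by (rule rand_array_Z) (use assms in auto)
  show ?thesis by unfold_locales (use Z_second assms in auto)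
qed

text \<open>Where an entry is discarded its norm exceeds the cutoff, so its square is at most its
  fourth power over the squared cutoff.\<close>

lemma trunc_second_ge:
  assumes n: "n \<ge> 1"
  shows "expectation (\<lambda>\<omega>. (norm (x 1 2 \<omega>))\<^sup>2) - mu4 / (cutoff n)\<^sup>2 \<le> expectation (\<lambda>\<omega>. (norm (trunc n (x 1 2 \<omega>)))\<^sup>2)"
proof -
  have c: "cutoff n > 0" using n by (simp add: cutoff_def)
  have "expectation (\<lambda>\<omega>. (norm (x 1 2 \<omega>))\<^sup>2) \<le> expectation (\<lambda>\<omega>. (norm (trunc n (x 1 2 \<omega>)))\<^sup>2 + norm (x 1 2 \<omega>) ^ 4 / (cutoff n)\<^sup>2)"
  proof (rule integral_mono[OF x12_sq_integrable])
    show "integrable M (\<lambda>\<omega>. (norm (trunc n (x 1 2 \<omega>)))\<^sup>2 + norm (x 1 2 \<omega>) ^ 4 / (cutoff n)\<^sup>2)"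
      using int4 trunc_sq_integrable by simp
    fix \<omega>
    let ?r = "norm (x 1 2 \<omega>)"
    show "?r\<^sup>2 \<le> (norm (trunc n (x 1 2 \<omega>)))\<^sup>2 + ?r ^ 4 / (cutoff n)\<^sup>2"
    proof (cases "?r \<le> cutoff n")
      case False
      then have "(cutoff n)\<^sup>2 \<le> ?r\<^sup>2" using c by (intro power_mono) auto
      then have "?r\<^sup>2 * (cutoff n)\<^sup>2 \<le> ?r\<^sup>2 * ?r\<^sup>2" by (intro mult_left_mono) auto
      then have "?r\<^sup>2 * (cutoff n)\<^sup>2 \<le> ?r ^ 4" by (simp flip: power_add)
      then show ?thesis using c by (simp add: trunc_def field_simps)
    qed (simp add: trunc_def)
  qed
  also have "\<dots> = expectation (\<lambda>\<omega>. (norm (trunc n (x 1 2 \<omega>)))\<^sup>2) + mu4 / (cutoff n)\<^sup>2"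
    using int4 trunc_sq_integrable by (simp add: mu4_def)
  finally show ?thesis by simp
qed

text \<open>As the full mean is 0, the truncated mean is minus that of the discarded part. The cube
  of the cutoff matters: subtracting the same mean everywhere changes a row sum by up to
  \<open>n\<close> times its norm, which must stay small against \<open>sqrt n\<close>.\<close>

lemma norm_tmean_le:
  assumes n: "n \<ge> 1" and mean: "expectation (x 1 2) = 0"
  shows "norm (tmean n) \<le> mu4 / cutoff n ^ 3"
proof -
  have c: "cutoff n > 0" using n by (simp add: cutoff_def)
  have "tmean n = expectation (\<lambda>\<omega>. trunc n (x 1 2 \<omega>) - x 1 2 \<omega>)"
    using trunc_integrable x12_integrable mean by (simp add: tmean_def)
  then have "norm (tmean n) \<le> expectation (\<lambda>\<omega>. norm (trunc n (x 1 2 \<omega>) - x 1 2 \<omega>))"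
    by (simp only: integral_norm_bound)
  also have "\<dots> \<le> expectation (\<lambda>\<omega>. norm (x 1 2 \<omega>) ^ 4 / cutoff n ^ 3)"
  proof (rule integral_mono)
    show "integrable M (\<lambda>\<omega>. norm (trunc n (x 1 2 \<omega>) - x 1 2 \<omega>))"
      using trunc_integrable x12_integrable by auto
    show "integrable M (\<lambda>\<omega>. norm (x 1 2 \<omega>) ^ 4 / cutoff n ^ 3)" using int4 by simp
    fix \<omega>
    let ?r = "norm (x 1 2 \<omega>)"
    show "norm (trunc n (x 1 2 \<omega>) - x 1 2 \<omega>) \<le> ?r ^ 4 / cutoff n ^ 3"
    proof (cases "?r \<le> cutoff n")
      case False
      then have "cutoff n ^ 3 \<le> ?r ^ 3" using c by (intro power_mono) auto
      then have "?r * cutoff n ^ 3 \<le> ?r * ?r ^ 3" by (intro mult_left_mono) auto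
      moreover have "?r * ?r ^ 3 = ?r ^ 4" using power_Suc[of ?r 3] by simp
      ultimately have "?r \<le> ?r ^ 4 / cutoff n ^ 3" using c by (simp only: pos_le_divide_eq zero_less_power)
      then show ?thesis using False by (simp add: trunc_def)
    qed (use c in \<open>simp add: trunc_def\<close>)
  qed
  also have "\<dots> = mu4 / cutoff n ^ 3" by (simp add: mu4_def)
  finally show ?thesis .
qed

text \<open>Per row, the difference consists of the diagonal entry, at most two large entries and
  the centring terms, all controlled by the Schur test.\<close>

lemma perturbation:
  assumes mean: "expectation (x 1 2) = 0" and diag: "integrable M (\<lambda>\<omega>. (norm (x 1 1 \<omega>))\<^sup>2)" and \<delta>: "\<delta> > 0"
  shows "AE \<omega> in M. eventually (\<lambda>n. \<forall>u. \<bar>ray (\<lambda>j k. x j k \<omega>) n u u - ray (harr (\<lambda>e. Z n e \<omega>)) n u u\<bar>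
    \<le> \<delta> * sqrt (real n) * nsq n u) sequentially"
proof -
  \<comment> \<open>One quarter of \<delta> goes to the diagonal entry, two to the large entries and
    one to the means.\<close>
  define d where "d = \<delta> / 4"
  have d: "d > 0" using \<delta> by (simp add: d_def)
  have "(\<lambda>n::nat. real n / (real n powr (7 / 16)) ^ 3 / sqrt (real n)) \<longlonglongrightarrow> 0" by real_asymp
  from tendsto_mult_right_zero[OF this, of mu4]
  have "eventually (\<lambda>n. mu4 * (real n / (real n powr (7 / 16)) ^ 3 / sqrt (real n)) < d) sequentially"
    using d by (rule order_tendstoD)
  then have evm: "eventually (\<lambda>n. real n * norm (tmean n) \<le> d * sqrt (real n)) sequentially"
    using eventually_ge_at_top[of 1]
  proof eventually_elim
    case (elim n)
    have "real n * norm (tmean n) \<le> real n * (mu4 / (real n powr (7 / 16)) ^ 3)"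
      using norm_tmean_le[OF elim(2) mean] by (intro mult_left_mono) (auto simp: cutoff_def)
    also have "\<dots> \<le> d * sqrt (real n)" using elim by (simp add: field_simps)
    finally show ?case .
  qed
  show ?thesis
    using diag_small[OF diag d] off_small[OF int4 d] two_large_per_row AE_space
  proof eventually_elim
    case (elim \<omega>)
    note sp = elim(4)
    from elim(1-3) evm show ?case
    proof eventually_elim
      case (elim n)
      define D where "D j k = x j k \<omega> - harr (\<lambda>e. Z n e \<omega>) j k" for j k
      have hx: "x k j \<omega> = quat_cnj (x j k \<omega>)" if "j \<in> {1..n}" "k \<in> {1..n}" for j k
        using x_herm[of j k] that sp by simp
      have Dsym: "norm (D k j) = norm (D j k)" if "j \<in> {1..n}" "k \<in> {1..n}" for j k
        unfolding D_def hx[OF that] harr_cnj[of _ k j] quat_cnj_diff[symmetric] by simp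
      have small: "norm (x j k \<omega>) \<le> d * sqrt (real n)" if "j \<in> {1..n}" "k \<in> {1..n}" "j \<noteq> k" for j k
      proof (cases "j < k")
        case True
        then show ?thesis using elim(2) that by auto
      next
        case False
        then have "norm (x k j \<omega>) \<le> d * sqrt (real n)" using elim(2) that by auto
        then show ?thesis using norm_x_sym[of k j] that sp by auto
      qed
      have upper: "norm (D j k) \<le> of_bool (cutoff n < norm (x j k \<omega>)) * norm (x j k \<omega>) + norm (tmean n)"
        if "j \<in> {1..n}" "k \<in> {1..n}" "j < k" for j k
      proof -
        have "D j k = (x j k \<omega> - trunc n (x j k \<omega>)) + tmean n"
          using that by (simp add: D_def harr.simps Z_def)
        also have "norm \<dots> \<le> norm (x j k \<omega> - trunc n (x j k \<omega>)) + norm (tmean n)" by (rule norm_triangle_ineq)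
        finally show ?thesis by (auto simp: trunc_def)
      qed
      have off: "norm (D j k) \<le> of_bool (cutoff n < norm (x j k \<omega>)) * norm (x j k \<omega>) + norm (tmean n)"
        if "j \<in> {1..n}" "k \<in> {1..n}" "j \<noteq> k" for j k
      proof (cases "j < k")
        case False
        then show ?thesis using upper[of k j] Dsym[of k j] norm_x_sym[of k j] that sp by auto
      qed (use upper that in blast)
      have row: "(\<Sum>k\<in>{1..n}. norm (D j k)) \<le> \<delta> * sqrt (real n)" if j: "j \<in> {1..n}" for j
      proof -
        let ?S = "{k \<in> {1..n}. k \<noteq> j \<and> cutoff n < norm (x j k \<omega>)}"
        have Djj: "norm (D j j) \<le> d * sqrt (real n)" using elim(1) j by (simp add: D_def harr.simps)
        have "(\<Sum>k\<in>{1..n}. norm (D j k)) = norm (D j j) + (\<Sum>k\<in>{1..n} - {j}. norm (D j k))"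
          using j by (simp add: sum.remove)
        also have "(\<Sum>k\<in>{1..n} - {j}. norm (D j k)) \<le>
            (\<Sum>k\<in>{1..n} - {j}. of_bool (cutoff n < norm (x j k \<omega>)) * norm (x j k \<omega>) + norm (tmean n))"
          using off j by (intro sum_mono) auto
        also have "\<dots> = (\<Sum>k\<in>{1..n} - {j}. of_bool (cutoff n < norm (x j k \<omega>)) * norm (x j k \<omega>))
            + real (card ({1..n} - {j})) * norm (tmean n)"
          by (simp add: sum.distrib)
        also have "(\<Sum>k\<in>{1..n} - {j}. of_bool (cutoff n < norm (x j k \<omega>)) * norm (x j k \<omega>)) = (\<Sum>k\<in>?S. norm (x j k \<omega>))"
          by (rule sum.mono_neutral_cong_right) auto
        also have "\<dots> \<le> (\<Sum>k\<in>?S. d * sqrt (real n))"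
          using small j by (intro sum_mono) auto
        also have "\<dots> \<le> 2 * (d * sqrt (real n))"
        proof -
          have "real (card ?S) \<le> 2" using elim(3) j by (metis (no_types, lifting) of_nat_le_iff of_nat_numeral)
          then show ?thesis using d by (simp add: mult_right_mono)
        qed
        also have "real (card ({1..n} - {j})) * norm (tmean n) \<le> real n * norm (tmean n)"
          using j by (intro mult_right_mono) auto
        also note elim(4)
        finally show ?thesis using Djj by (simp add: d_def)
      qed
      have "ray (\<lambda>j k. x j k \<omega>) n u u = ray (\<lambda>j k. harr (\<lambda>e. Z n e \<omega>) j k + D j k) n u u" for u
        by (simp add: D_def)
      then show ?case
        using schur_test[OF row Dsym] by (simp add: ray_add_mat)
    qed
  qed
qed

end

section \<open>Sufficiency\<close>

lemma max_eigenvalue_scaled: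
  fixes e :: real
  assumes X: "herm X n" and n: "n \<ge> 1"
  defines "\<mu> \<equiv> max_eigenvalue (scaled_corner (\<lambda>j k. e *\<^sub>R X j k) n)"
  shows "e * ray X n u u \<le> \<mu> * sqrt (real n) * nsq n u"
    and "(\<And>u. e * ray X n u u \<le> c * sqrt (real n) * nsq n u) \<Longrightarrow> \<mu> \<le> c"
proof -
  let ?Y = "\<lambda>j k. (1 / sqrt (real n)) *\<^sub>R (e *\<^sub>R X j k)"
  have q: "sqrt (real n) > 0" using n by simp
  have Y: "herm ?Y n"
    unfolding herm_def
  proof (intro ballI)
    fix j k assume "j \<in> {1..n}" "k \<in> {1..n}"
    then have "X k j = quat_cnj (X j k)" using X unfolding herm_def by blast
    then show "?Y k j = quat_cnj (?Y j k)" by (simp add: quat_cnj_scaleR)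
  qed
  have ry: "ray ?Y n u u = e * ray X n u u / sqrt (real n)" for u
    by (simp add: ray_scaleR_mat)
  have \<mu>: "\<mu> = max_eigenvalue (quat_corner ?Y n)" by (simp add: \<mu>_def scaled_corner_eq)
  show "e * ray X n u u \<le> \<mu> * sqrt (real n) * nsq n u"
    using max_eigenvalue_quat_corner(1)[OF Y n, of u] q unfolding ry \<mu>[symmetric] by (simp add: field_simps)
  assume c: "\<And>u. e * ray X n u u \<le> c * sqrt (real n) * nsq n u"
  obtain w where w: "nsq n w = 1" "ray ?Y n w w = \<mu>"
    using max_eigenvalue_quat_corner(2)[OF Y n] unfolding \<mu>[symmetric] by blast
  show "\<mu> \<le> c" using c[of w] w q unfolding ry by (simp add: field_simps)
qed

lemma min_eigenvalue_scaled:
  assumes "herm X n" "n \<ge> 1"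
  shows "min_eigenvalue (scaled_corner X n) = - max_eigenvalue (scaled_corner (\<lambda>j k. (-1::real) *\<^sub>R X j k) n)"
proof -
  have "herm (\<lambda>j k. (1 / sqrt (real n)) *\<^sub>R X j k) n"
    unfolding herm_def
  proof (intro ballI)
    fix j k assume "j \<in> {1..n}" "k \<in> {1..n}"
    then have "X k j = quat_cnj (X j k)" using assms(1) unfolding herm_def by blast
    then show "(1 / sqrt (real n)) *\<^sub>R X k j = quat_cnj ((1 / sqrt (real n)) *\<^sub>R X j k)"
      by (simp add: quat_cnj_scaleR)
  qed
  from min_eigenvalue_quat_corner[OF this assms(2)] show ?thesis
    unfolding scaled_corner_eq by simp
qed

text \<open>Extension by 0 embeds the form of a corner into that of any larger corner, so a good
  test vector remains good as \<open>n\<close> grows.\<close>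

lemma ray_extend:
  fixes u :: "nat \<Rightarrow> quat"
  assumes "N \<le> n"
  defines "v \<equiv> \<lambda>j. if j \<le> N then u j else 0"
  shows "nsq n v = nsq N u" "ray X n v v = ray X N u u"
proof -
  have sub: "{1..N} \<subseteq> {1..n}" using assms(1) by auto
  have "nsq n v = (\<Sum>j\<in>{1..N}. (norm (v j))\<^sup>2)"
    unfolding nsq_def using sub by (intro sum.mono_neutral_right) (auto simp: v_def)
  then show "nsq n v = nsq N u" by (simp add: nsq_def v_def)
  have mv: "mvec X n v j = mvec X N u j" for j
  proof -
    have "mvec X n v j = (\<Sum>k\<in>{1..N}. X j k \<diamond> v k)"
      unfolding mvec_def using sub by (intro sum.mono_neutral_right) (auto simp: v_def qmul.zero_right)
    then show ?thesis by (simp add: mvec_def v_def)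
  qed
  have "ray X n v v = (\<Sum>j\<in>{1..N}. inner (v j) (mvec X n v j))"
    unfolding ray_def using sub by (intro sum.mono_neutral_right) (auto simp: v_def)
  then have "ray X n v v = (\<Sum>j\<in>{1..N}. inner (v j) (mvec X N u j))" unfolding mv .
  then show "ray X n v v = ray X N u u" by (simp add: ray_def v_def)
qed

lemma power_bracket:
  fixes n i0 :: nat
  assumes "i0 ^ 64 \<le> n"
  obtains i where "i \<ge> i0" "i ^ 64 \<le> n" "n < (i + 1) ^ 64"
proof -
  define j where "j = (LEAST j. n < j ^ 64)"
  have "n + 1 \<le> (n + 1) ^ 64" by (rule self_le_power) auto
  then have "n < (n + 1) ^ 64" by linarith
  then have j: "n < j ^ 64" unfolding j_def by (rule LeastI)
  then have "j \<noteq> 0" by (auto intro!: gr0I)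
  then obtain i where i: "j = i + 1" by (metis add.commute not0_implies_Suc plus_1_eq_Suc)
  have a: "i ^ 64 \<le> n"
  proof (rule ccontr)
    assume "\<not> i ^ 64 \<le> n"
    then have "j \<le> i" unfolding j_def by (intro Least_le) simp
    then show False using i by simp
  qed
  have b: "i \<ge> i0"
  proof (rule ccontr)
    assume "\<not> i \<ge> i0"
    then have "(i + 1) ^ 64 \<le> i0 ^ 64" by (intro power_mono) auto
    from less_le_trans[OF j[unfolded i] le_trans[OF this assms]] show False by simp
  qed
  show ?thesis by (rule that[OF b a j[unfolded i]])
qed

text \<open>The deterministic part. Between consecutive 64th powers the test vector of the smaller
  corner is kept; the quotient then loses only the ratio of the two normalising roots.\<close>

lemma max_eigenvalue_tendsto:
  fixes X :: "nat \<Rightarrow> nat \<Rightarrow> quat" and e :: real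
  assumes X: "\<And>n. herm X n" and \<sigma>: "\<sigma> \<ge> 0" and e: "\<bar>e\<bar> = 1"
    and up: "\<And>\<epsilon>. \<epsilon> > 0 \<Longrightarrow> eventually (\<lambda>n. \<forall>u. \<bar>ray X n u u\<bar> \<le> (2 * \<sigma> + \<epsilon>) * sqrt (real n) * nsq n u) sequentially"
    and low: "\<And>\<gamma>. \<sigma> > 0 \<Longrightarrow> \<gamma> < 2 * \<sigma> \<Longrightarrow> eventually (\<lambda>i. \<exists>u. nsq (i ^ 64) u > 0 \<and>
      \<gamma> * sqrt (real (i ^ 64)) * nsq (i ^ 64) u < e * ray X (i ^ 64) u u) sequentially"
  shows "(\<lambda>n. max_eigenvalue (scaled_corner (\<lambda>j k. e *\<^sub>R X j k) n)) \<longlonglongrightarrow> 2 * \<sigma>"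
proof (rule order_tendstoI)
  let ?\<mu> = "\<lambda>n. max_eigenvalue (scaled_corner (\<lambda>j k. e *\<^sub>R X j k) n)"
  fix b assume b: "2 * \<sigma> < b"
  define \<epsilon> where "\<epsilon> = (b - 2 * \<sigma>) / 2"
  have "\<epsilon> > 0" using b by (simp add: \<epsilon>_def)
  from up[OF this] eventually_ge_at_top[of 1] show "eventually (\<lambda>n. ?\<mu> n < b) sequentially"
  proof eventually_elim
    case (elim n)
    have "e * ray X n u u \<le> (2 * \<sigma> + \<epsilon>) * sqrt (real n) * nsq n u" for u
    proof -
      have "e * ray X n u u \<le> \<bar>e\<bar> * \<bar>ray X n u u\<bar>" by (simp flip: abs_mult)
      then show ?thesis using elim(1)[rule_format, of u] e by simp
    qed
    then have "?\<mu> n \<le> 2 * \<sigma> + \<epsilon>" by (rule max_eigenvalue_scaled(2)[OF X elim(2)])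
    moreover have "2 * \<sigma> + \<epsilon> < b" using b by (simp add: \<epsilon>_def field_simps)
    ultimately show ?case by (rule le_less_trans)
  qed
next
  let ?\<mu> = "\<lambda>n. max_eigenvalue (scaled_corner (\<lambda>j k. e *\<^sub>R X j k) n)"
  fix b assume b: "b < 2 * \<sigma>"
  show "eventually (\<lambda>n. b < ?\<mu> n) sequentially"
  proof (cases "\<sigma> = 0")
    case True
    \<comment> \<open>For \<sigma> = 0 the two-sided bound \<open>up\<close> itself gives the lower
      estimate, by evaluating the form at a unit vector.\<close>
    define \<epsilon> where "\<epsilon> = - b / 2"
    have \<epsilon>: "\<epsilon> > 0" using b True by (simp add: \<epsilon>_def)
    from up[OF this] eventually_ge_at_top[of 1] show ?thesis
    proof eventually_elim
      case (elim n)
      define u where "u j = (if j = 1 then qone else 0)" for j :: nat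
      have nu: "nsq n u = 1" using elim(2) by (simp add: nsq_def u_def if_distrib if_distribR cong: if_cong)
      have "\<bar>e * ray X n u u\<bar> \<le> \<epsilon> * sqrt (real n)" using elim(1)[rule_format, of u] e nu True by (simp add: abs_mult)
      then have "- \<epsilon> * sqrt (real n) \<le> e * ray X n u u" by linarith
      also have "\<dots> \<le> ?\<mu> n * sqrt (real n)" using max_eigenvalue_scaled(1)[OF X elim(2), of e u] nu by simp
      finally have "- \<epsilon> \<le> ?\<mu> n" by (rule mult_right_le_imp_le) (use elim(2) in simp)
      then show ?case using \<epsilon> by (simp add: \<epsilon>_def)
    qed
  next
    case False
    then have \<sigma>': "\<sigma> > 0" using \<sigma> by simp
    \<comment> \<open>Strictly between \<open>b\<close> and \<open>2 * \<sigma>\<close>, and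
      positive because of the maximum with 0, so that the sign of the eigenvalue is known when
      \<open>sqrt n\<close> is replaced by a larger number.\<close>
    define \<gamma> where "\<gamma> = (max b 0 + 2 * \<sigma>) / 2"
    have \<gamma>: "\<gamma> < 2 * \<sigma>" "b < \<gamma>" "0 < \<gamma>" using b \<sigma>' by (auto simp: \<gamma>_def max_def)
    \<comment> \<open>The square root of the ratio of consecutive 64th powers.\<close>
    have "(\<lambda>i. (real i / (real i + 1)) ^ 32) \<longlonglongrightarrow> 1" by real_asymp
    from tendsto_mult_left[OF this, of \<gamma>] have "(\<lambda>i. \<gamma> * (real i / (real i + 1)) ^ 32) \<longlonglongrightarrow> \<gamma>" by simp
    then have "eventually (\<lambda>i. b < \<gamma> * (real i / (real i + 1)) ^ 32) sequentially"
      using \<gamma>(2) by (rule order_tendstoD)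
    with low[OF \<sigma>' \<gamma>(1)] have "eventually (\<lambda>i. (\<exists>u. nsq (i ^ 64) u > 0 \<and>
      \<gamma> * sqrt (real (i ^ 64)) * nsq (i ^ 64) u < e * ray X (i ^ 64) u u) \<and> b < \<gamma> * (real i / (real i + 1)) ^ 32) sequentially"
      by (rule eventually_conj)
    then obtain i0 where i0: "\<And>i. i \<ge> i0 \<Longrightarrow> (\<exists>u. nsq (i ^ 64) u > 0 \<and>
      \<gamma> * sqrt (real (i ^ 64)) * nsq (i ^ 64) u < e * ray X (i ^ 64) u u) \<and> b < \<gamma> * (real i / (real i + 1)) ^ 32"
      unfolding eventually_sequentially by blast
    show ?thesis using eventually_ge_at_top[of "max 1 (i0 ^ 64)"]
    proof eventually_elim
      case (elim n)
      then have n: "n \<ge> 1" "i0 ^ 64 \<le> n" by auto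
      obtain i where i: "i \<ge> i0" "i ^ 64 \<le> n" "n < (i + 1) ^ 64" using power_bracket[OF n(2)] .
      define N where "N = i ^ 64"
      obtain u where u: "nsq N u > 0" "\<gamma> * sqrt (real N) * nsq N u < e * ray X N u u"
        using i0[OF i(1)] unfolding N_def by blast
      let ?v = "\<lambda>j. if j \<le> N then u j else 0"
      have "N \<le> n" using i(2) by (simp add: N_def)
      note ext = ray_extend[OF this, where u = u]
      have "\<gamma> * sqrt (real N) * nsq N u < ?\<mu> n * sqrt (real n) * nsq N u"
        using u(2) max_eigenvalue_scaled(1)[OF X n(1), of e ?v] unfolding ext by linarith
      then have 1: "\<gamma> * sqrt (real N) < ?\<mu> n * sqrt (real n)" using u(1) by simp
      have sN: "sqrt (real N) = real i ^ 32"
        unfolding N_def of_nat_power by (rule real_sqrt_unique) (simp_all flip: power_mult)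
      have "real n \<le> (real i + 1) ^ 64"
        using i(3) by (metis less_imp_le of_nat_1 of_nat_add of_nat_mono of_nat_power)
      then have "sqrt (real n) \<le> sqrt ((real i + 1) ^ 64)" by (rule real_sqrt_le_mono)
      also have "\<dots> = (real i + 1) ^ 32" by (rule real_sqrt_unique) (simp_all flip: power_mult)
      finally have sn: "sqrt (real n) \<le> (real i + 1) ^ 32" .
      have "0 \<le> \<gamma> * sqrt (real N)" using \<gamma> by simp
      with 1 have "0 < ?\<mu> n * sqrt (real n)" by (rule order.strict_trans1[rotated])
      from zero_less_mult_pos2[OF this] have \<mu>0: "0 \<le> ?\<mu> n" using n(1) by simp
      have "\<gamma> * real i ^ 32 < ?\<mu> n * (real i + 1) ^ 32"
        using 1 mult_left_mono[OF sn \<mu>0] unfolding sN by linarith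
      then have "\<gamma> * (real i / (real i + 1)) ^ 32 < ?\<mu> n" by (simp add: power_divide field_simps)
      with i0[OF i(1)] show ?case by linarith
    qed
  qed
qed

context quat_wigner4
begin

lemma upper_bound_x:
  assumes mean: "expectation (x 1 2) = 0" and diag: "integrable M (\<lambda>\<omega>. (norm (x 1 1 \<omega>))\<^sup>2)"
    and \<sigma>: "\<sigma> \<ge> 0" "expectation (\<lambda>\<omega>. (norm (x 1 2 \<omega>))\<^sup>2) = \<sigma>\<^sup>2" and \<epsilon>: "\<epsilon> > 0"
  shows "AE \<omega> in M. eventually (\<lambda>n. \<forall>u. \<bar>ray (\<lambda>j k. x j k \<omega>) n u u\<bar>
    \<le> (2 * \<sigma> + \<epsilon>) * sqrt (real n) * nsq n u) sequentially"
proof -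
  \<comment> \<open>Positive even for \<sigma> = 0. Doubling costs \<open>\<epsilon> / 4\<close>;
    the spectral bound takes another \<open>\<epsilon> / 4\<close> and the perturbation
    \<open>\<epsilon> / 2\<close>.\<close>
  define s where "s = \<sigma> + \<epsilon> / 8"
  have s: "s > 0" using \<sigma> \<epsilon> by (simp add: s_def)
  have "\<sigma>\<^sup>2 \<le> s\<^sup>2" using \<sigma> \<epsilon> by (intro power_mono) (auto simp: s_def)
  then have ra: "rand_array M (Z n) (2 * real n powr (7 / 16)) s" for n
    using rand_array_Z[OF s, of n] \<sigma>(2) by (simp add: cutoff_def)
  have e: "\<epsilon> / 4 > 0" "\<epsilon> / 2 > 0" using \<epsilon> by auto
  show ?thesis
    using upper_as[of Z s, OF ra e(1)] perturbation[OF mean diag e(2)]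
  proof eventually_elim
    case (elim \<omega>)
    from elim show ?case
    proof eventually_elim
      case (elim n)
      show ?case
      proof
        fix u
        have "\<bar>ray (\<lambda>j k. x j k \<omega>) n u u\<bar> \<le> \<bar>ray (harr (\<lambda>e. Z n e \<omega>)) n u u\<bar>
            + \<bar>ray (\<lambda>j k. x j k \<omega>) n u u - ray (harr (\<lambda>e. Z n e \<omega>)) n u u\<bar>" by linarith
        also have "\<dots> \<le> (2 * s + \<epsilon> / 4) * sqrt (real n) * nsq n u + \<epsilon> / 2 * sqrt (real n) * nsq n u"
          using elim by (intro add_mono) auto
        also have "\<dots> = (2 * \<sigma> + \<epsilon>) * sqrt (real n) * nsq n u" by (simp add: s_def algebra_simps)
        finally show "\<bar>ray (\<lambda>j k. x j k \<omega>) n u u\<bar> \<le> (2 * \<sigma> + \<epsilon>) * sqrt (real n) * nsq n u" .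
      qed
    qed
  qed
qed

lemma lower_bound_x:
  assumes mean: "expectation (x 1 2) = 0" and diag: "integrable M (\<lambda>\<omega>. (norm (x 1 1 \<omega>))\<^sup>2)"
    and \<sigma>: "\<sigma> > 0" "expectation (\<lambda>\<omega>. (norm (x 1 2 \<omega>))\<^sup>2) = \<sigma>\<^sup>2" and \<gamma>: "\<gamma> < 2 * \<sigma>" and e: "e = 1 \<or> e = (-1 :: real)"
  shows "AE \<omega> in M. eventually (\<lambda>i. \<exists>u. nsq (i ^ 64) u > 0 \<and>
    \<gamma> * sqrt (real (i ^ 64)) * nsq (i ^ 64) u < e * ray (\<lambda>j k. x j k \<omega>) (i ^ 64) u u) sequentially"
proof -
  \<comment> \<open>The exact variance after truncation. It depends on \<open>n\<close> and only
    tends to \<open>\<sigma>\<^sup>2\<close>, so the moment limits are taken with a varying standard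
    deviation.\<close>
  define v where "v n = expectation (\<lambda>\<omega>. (norm (trunc n (x 1 2 \<omega>)))\<^sup>2) - (norm (tmean n))\<^sup>2" for n
  define sn where "sn n = sqrt (v n)" for n
  have v_le: "v n \<le> \<sigma>\<^sup>2" for n
    using trunc_second_le[of n] \<sigma>(2) zero_le_power2[of "norm (tmean n)"] unfolding v_def by linarith
  have v_ge: "eventually (\<lambda>n. \<sigma>\<^sup>2 - mu4 / (cutoff n)\<^sup>2 - (mu4 / cutoff n ^ 3)\<^sup>2 \<le> v n) sequentially"
    using eventually_ge_at_top[of 1]
  proof eventually_elim
    case (elim n)
    have "(norm (tmean n))\<^sup>2 \<le> (mu4 / cutoff n ^ 3)\<^sup>2"
      using norm_tmean_le[OF elim mean] by (intro power_mono) auto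
    then show ?case using trunc_second_ge[OF elim] \<sigma>(2) unfolding v_def by linarith
  qed
  have "filterlim cutoff at_top sequentially" unfolding cutoff_def by real_asymp
  then have "(\<lambda>n. 1 / cutoff n) \<longlonglongrightarrow> 0"
    using tendsto_divide_0[OF tendsto_const filterlim_at_top_imp_at_infinity] by blast
  then have "(\<lambda>n. \<sigma>\<^sup>2 - mu4 * (1 / cutoff n)\<^sup>2 - (mu4 * (1 / cutoff n) ^ 3)\<^sup>2) \<longlonglongrightarrow> \<sigma>\<^sup>2 - mu4 * 0\<^sup>2 - (mu4 * 0 ^ 3)\<^sup>2"
    by (intro tendsto_intros)
  then have lim: "(\<lambda>n. \<sigma>\<^sup>2 - mu4 / (cutoff n)\<^sup>2 - (mu4 / cutoff n ^ 3)\<^sup>2) \<longlonglongrightarrow> \<sigma>\<^sup>2"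
    by (simp add: power_divide)
  have "v \<longlonglongrightarrow> \<sigma>\<^sup>2"
    by (rule tendsto_sandwich[OF v_ge _ lim tendsto_const]) (simp add: v_le)
  then have "sn \<longlonglongrightarrow> sqrt (\<sigma>\<^sup>2)" unfolding sn_def by (rule tendsto_real_sqrt)
  then have sn: "sn \<longlonglongrightarrow> \<sigma>" using \<sigma>(1) by simp
  have "eventually (\<lambda>n. \<sigma> / 2 < sn n) sequentially" using sn \<sigma>(1) by (intro order_tendstoD) auto
  then obtain n0 where n0: "\<And>n. n \<ge> n0 \<Longrightarrow> \<sigma> / 2 < sn n" by (auto simp: eventually_sequentially)
  have sn_le: "sn n \<le> \<sigma>" for n
    unfolding sn_def using v_le \<sigma>(1) by (intro real_le_lsqrt) auto
  have ra: "rand_array_exact M (Z n) (2 * real n powr (7 / 16)) (sn n)" if "n \<ge> n0" for n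
  proof -
    have pos: "sn n > 0" using n0[OF that] \<sigma>(1) by linarith
    then have "v n \<ge> 0" unfolding sn_def by simp
    then have "v n = (sn n)\<^sup>2" by (simp add: sn_def)
    then show ?thesis using rand_array_exact_Z[OF pos, of n] by (simp add: v_def cutoff_def)
  qed
  have "AE \<omega> in M. (\<lambda>i. Rq (qpow (harr (\<lambda>e. Z (i ^ 64) e \<omega>)) (i ^ 64) k 1 1) / sqrt (real (i ^ 64)) ^ k)
      \<longlonglongrightarrow> \<sigma> ^ k * jw {} k 0" for k
  proof (cases "k = 0")
    case False
    show ?thesis
      by (rule lower_moments_as[OF ra _ _ sn \<sigma>(1)]) (use n0 sn_le False less_imp_le in auto)
  qed simp
  then have mom: "AE \<omega> in M. \<forall>k. (\<lambda>i. Rq (qpow (harr (\<lambda>e. Z (i ^ 64) e \<omega>)) (i ^ 64) k 1 1) / sqrt (real (i ^ 64)) ^ k)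
      \<longlonglongrightarrow> \<sigma> ^ k * jw {} k 0" by (simp add: AE_all_countable)
  \<comment> \<open>\<open>\<gamma> + \<delta>\<close> is midway between \<gamma> and
    \<open>2 * \<sigma>\<close>; the reserve \<delta> pays for the perturbation.\<close>
  define \<delta> where "\<delta> = (2 * \<sigma> - \<gamma>) / 2"
  have \<delta>: "\<delta> > 0" "\<gamma> + \<delta> < 2 * \<sigma>" using \<gamma> by (auto simp: \<delta>_def field_simps)
  have sub: "filterlim (\<lambda>i::nat. i ^ 64) at_top sequentially"
    by (intro filterlim_subseq strict_monoI power_strict_mono) auto
  show ?thesis
    using mom perturbation[OF mean diag \<delta>(1)]
  proof eventually_elim
    case (elim \<omega>)
    have N: "eventually (\<lambda>i::nat. i ^ 64 \<ge> 1) sequentially"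
      using eventually_ge_at_top[of "1::nat"] by eventually_elim simp
    have "eventually (\<lambda>i. \<exists>u. nsq (i ^ 64) u > 0 \<and>
      (\<gamma> + \<delta>) * sqrt (real (i ^ 64)) * nsq (i ^ 64) u < e * ray (harr (\<lambda>e. Z (i ^ 64) e \<omega>)) (i ^ 64) u u) sequentially"
      by (rule krylov_limit[OF herm_harr N _ \<sigma>(1) \<delta>(2) e]) (use elim(1) in blast)
    moreover have "eventually (\<lambda>i. \<forall>u. \<bar>ray (\<lambda>j k. x j k \<omega>) (i ^ 64) u u - ray (harr (\<lambda>e. Z (i ^ 64) e \<omega>)) (i ^ 64) u u\<bar>
      \<le> \<delta> * sqrt (real (i ^ 64)) * nsq (i ^ 64) u) sequentially"
      using eventually_compose_filterlim[OF elim(2) sub] .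
    ultimately show ?case
    proof eventually_elim
      case (elim i)
      then obtain u where u: "nsq (i ^ 64) u > 0"
        "(\<gamma> + \<delta>) * sqrt (real (i ^ 64)) * nsq (i ^ 64) u < e * ray (harr (\<lambda>e. Z (i ^ 64) e \<omega>)) (i ^ 64) u u" by blast
      have "e * ray (harr (\<lambda>e. Z (i ^ 64) e \<omega>)) (i ^ 64) u u - e * ray (\<lambda>j k. x j k \<omega>) (i ^ 64) u u
          \<le> \<delta> * sqrt (real (i ^ 64)) * nsq (i ^ 64) u"
        using elim(2)[rule_format, of u] e by auto
      then have "\<gamma> * sqrt (real (i ^ 64)) * nsq (i ^ 64) u < e * ray (\<lambda>j k. x j k \<omega>) (i ^ 64) u u"
        using u(2) unfolding distrib_right by linarith
      then show ?case using u(1) by blast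
    qed
  qed
qed

lemma eigenvalues_tendsto:
  assumes mean: "expectation (x 1 2) = 0" and diag: "integrable M (\<lambda>\<omega>. (norm (x 1 1 \<omega>))\<^sup>2)"
    and \<sigma>: "\<sigma> \<ge> 0" "expectation (\<lambda>\<omega>. (norm (x 1 2 \<omega>))\<^sup>2) = \<sigma>\<^sup>2"
  shows "AE \<omega> in M. (\<lambda>n. max_eigenvalue (scaled_corner (\<lambda>j k. x j k \<omega>) n)) \<longlonglongrightarrow> 2 * \<sigma> \<and>
    (\<lambda>n. min_eigenvalue (scaled_corner (\<lambda>j k. x j k \<omega>) n)) \<longlonglongrightarrow> - 2 * \<sigma>"
proof -
  \<comment> \<open>Tolerances run through \<open>1 / Suc m\<close>, so that one null set serves all
    of them; arbitrary \<epsilon> and \<gamma> follow by monotonicity.\<close>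
  have "AE \<omega> in M. \<forall>m. eventually (\<lambda>n. \<forall>u. \<bar>ray (\<lambda>j k. x j k \<omega>) n u u\<bar>
    \<le> (2 * \<sigma> + 1 / real (Suc m)) * sqrt (real n) * nsq n u) sequentially"
    unfolding AE_all_countable by (intro allI upper_bound_x[OF mean diag \<sigma>]) simp
  moreover have "AE \<omega> in M. \<forall>m. \<sigma> > 0 \<longrightarrow> eventually (\<lambda>i. \<exists>u. nsq (i ^ 64) u > 0 \<and>
    (2 * \<sigma> - 1 / real (Suc m)) * sqrt (real (i ^ 64)) * nsq (i ^ 64) u < e * ray (\<lambda>j k. x j k \<omega>) (i ^ 64) u u) sequentially"
    if e: "e = 1 \<or> e = -1" for e
  proof (cases "\<sigma> > 0")
    case True
    show ?thesis unfolding AE_all_countable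
      using lower_bound_x[OF mean diag True \<sigma>(2) _ e] by simp
  qed simp
  from this[of 1] this[of "-1"] have "AE \<omega> in M. \<forall>m. \<sigma> > 0 \<longrightarrow> eventually (\<lambda>i. \<exists>u. nsq (i ^ 64) u > 0 \<and>
    (2 * \<sigma> - 1 / real (Suc m)) * sqrt (real (i ^ 64)) * nsq (i ^ 64) u < 1 * ray (\<lambda>j k. x j k \<omega>) (i ^ 64) u u) sequentially"
    "AE \<omega> in M. \<forall>m. \<sigma> > 0 \<longrightarrow> eventually (\<lambda>i. \<exists>u. nsq (i ^ 64) u > 0 \<and>
    (2 * \<sigma> - 1 / real (Suc m)) * sqrt (real (i ^ 64)) * nsq (i ^ 64) u < -1 * ray (\<lambda>j k. x j k \<omega>) (i ^ 64) u u) sequentially"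
    by blast+
  ultimately show ?thesis using AE_space
  proof eventually_elim
    case (elim \<omega>)
    let ?X = "\<lambda>j k. x j k \<omega>"
    have X: "herm ?X n" for n using elim(4) by (rule herm_x)
    have ex: "\<exists>m. 1 / real (Suc m) < \<epsilon>" if "\<epsilon> > 0" for \<epsilon> :: real
      using reals_Archimedean[OF that] by (simp add: inverse_eq_divide)
    have up: "eventually (\<lambda>n. \<forall>u. \<bar>ray ?X n u u\<bar> \<le> (2 * \<sigma> + \<epsilon>) * sqrt (real n) * nsq n u) sequentially"
      if \<epsilon>: "\<epsilon> > 0" for \<epsilon>
    proof -
      obtain m where m: "1 / real (Suc m) < \<epsilon>" using ex[OF \<epsilon>] by blast
      from elim(1)[rule_format, of m] show ?thesis
      proof eventually_elim
        case (elim n)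
        show ?case
        proof
          fix u
          have "(2 * \<sigma> + 1 / real (Suc m)) * (sqrt (real n) * nsq n u) \<le> (2 * \<sigma> + \<epsilon>) * (sqrt (real n) * nsq n u)"
            using m by (intro mult_right_mono mult_nonneg_nonneg nsq_nonneg) auto
          then show "\<bar>ray ?X n u u\<bar> \<le> (2 * \<sigma> + \<epsilon>) * sqrt (real n) * nsq n u"
            using elim[rule_format, of u] by (simp only: mult.assoc)
        qed
      qed
    qed
    have low: "eventually (\<lambda>i. \<exists>u. nsq (i ^ 64) u > 0 \<and>
      \<gamma> * sqrt (real (i ^ 64)) * nsq (i ^ 64) u < e * ray ?X (i ^ 64) u u) sequentially"
      if \<sigma>': "\<sigma> > 0" and \<gamma>: "\<gamma> < 2 * \<sigma>" and e: "e = 1 \<or> e = -1" for \<gamma> e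
    proof -
      have "2 * \<sigma> - \<gamma> > 0" using \<gamma> by simp
      then obtain m where m: "1 / real (Suc m) < 2 * \<sigma> - \<gamma>" using ex by blast
      have "eventually (\<lambda>i. \<exists>u. nsq (i ^ 64) u > 0 \<and>
        (2 * \<sigma> - 1 / real (Suc m)) * sqrt (real (i ^ 64)) * nsq (i ^ 64) u < e * ray ?X (i ^ 64) u u) sequentially"
        using elim(2,3) \<sigma>' e by blast
      then show ?thesis
      proof eventually_elim
        case (elim i)
        then obtain u where u: "nsq (i ^ 64) u > 0"
          "(2 * \<sigma> - 1 / real (Suc m)) * sqrt (real (i ^ 64)) * nsq (i ^ 64) u < e * ray ?X (i ^ 64) u u" by blast
        have "\<gamma> * (sqrt (real (i ^ 64)) * nsq (i ^ 64) u) \<le> (2 * \<sigma> - 1 / real (Suc m)) * (sqrt (real (i ^ 64)) * nsq (i ^ 64) u)"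
          using m by (intro mult_right_mono mult_nonneg_nonneg nsq_nonneg) auto
        then have "\<gamma> * sqrt (real (i ^ 64)) * nsq (i ^ 64) u < e * ray ?X (i ^ 64) u u"
          using u(2) by (simp only: mult.assoc)
        then show ?case using u(1) by blast
      qed
    qed
    have mx: "(\<lambda>n. max_eigenvalue (scaled_corner (\<lambda>j k. e *\<^sub>R ?X j k) n)) \<longlonglongrightarrow> 2 * \<sigma>"
      if e: "e = 1 \<or> e = (-1 :: real)" for e
      by (rule max_eigenvalue_tendsto[OF X \<sigma>(1)]) (use e up low[OF _ _ e] in auto)
    have "(\<lambda>n. - max_eigenvalue (scaled_corner (\<lambda>j k. (-1) *\<^sub>R ?X j k) n)) \<longlonglongrightarrow> - (2 * \<sigma>)"
      by (intro tendsto_minus mx) simp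
    moreover have "eventually (\<lambda>n. - max_eigenvalue (scaled_corner (\<lambda>j k. (-1) *\<^sub>R ?X j k) n)
        = min_eigenvalue (scaled_corner ?X n)) sequentially"
      using eventually_ge_at_top[of 1] by eventually_elim (simp only: min_eigenvalue_scaled[OF X])
    ultimately have "(\<lambda>n. min_eigenvalue (scaled_corner ?X n)) \<longlonglongrightarrow> - (2 * \<sigma>)"
      by (rule Lim_transform_eventually)
    then show ?case using mx[of 1] by simp
  qed
qed

end

section \<open>Necessity\<close>

lemma (in prob_space) expectation_sum_sq_indep:
  fixes Y :: "'i \<Rightarrow> 'a \<Rightarrow> real"
  assumes J: "finite J" and ind: "indep_vars (\<lambda>_. borel) Y J"
    and sq: "\<And>e. e \<in> J \<Longrightarrow> integrable M (\<lambda>w. (Y e w)\<^sup>2)" and mean: "\<And>e. e \<in> J \<Longrightarrow> expectation (Y e) = 0"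
  shows "integrable M (\<lambda>w. (\<Sum>e\<in>J. Y e w)\<^sup>2)"
    and "expectation (\<lambda>w. (\<Sum>e\<in>J. Y e w)\<^sup>2) = (\<Sum>e\<in>J. expectation (\<lambda>w. (Y e w)\<^sup>2))"
proof -
  have m: "Y e \<in> borel_measurable M" if "e \<in> J" for e using ind that by (simp add: indep_vars_def)
  have int: "integrable M (Y e)" if "e \<in> J" for e
    by (rule square_integrable_imp_integrable[OF m sq]) (use that in auto)
  have prod2: "integrable M (\<lambda>w. Y e w * Y f w)" "expectation (\<lambda>w. Y e w * Y f w) = 0"
    if "e \<in> J" "f \<in> J" "e \<noteq> f" for e f
  proof -
    have i: "indep_vars (\<lambda>_. borel) Y {e, f}" by (rule indep_vars_subset[OF ind]) (use that in auto)
    have "(\<lambda>w. \<Prod>i\<in>{e, f}. Y i w) = (\<lambda>w. Y e w * Y f w)" using that by auto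
    then show "integrable M (\<lambda>w. Y e w * Y f w)" "expectation (\<lambda>w. Y e w * Y f w) = 0"
      using indep_vars_integrable[OF _ i] indep_vars_lebesgue_integral[OF _ i] int mean that by auto
  qed
  have ii: "integrable M (\<lambda>w. Y e w * Y f w)" if "e \<in> J" "f \<in> J" for e f
    using prod2(1)[OF that] sq[OF that(1)] by (cases "e = f") (auto simp: power2_eq_square)
  have ex: "(\<Sum>e\<in>J. Y e w)\<^sup>2 = (\<Sum>e\<in>J. \<Sum>f\<in>J. Y e w * Y f w)" for w
    by (simp add: power2_eq_square sum_product)
  show "integrable M (\<lambda>w. (\<Sum>e\<in>J. Y e w)\<^sup>2)"
    unfolding ex using ii by (intro Bochner_Integration.integrable_sum) auto
  have "expectation (\<lambda>w. (\<Sum>e\<in>J. Y e w)\<^sup>2) = (\<Sum>e\<in>J. \<Sum>f\<in>J. expectation (\<lambda>w. Y e w * Y f w))"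
    unfolding ex using ii
    by (subst Bochner_Integration.integral_sum, auto intro!: sum.cong Bochner_Integration.integral_sum Bochner_Integration.integrable_sum)
  also have "\<dots> = (\<Sum>e\<in>J. \<Sum>f\<in>J. if f = e then expectation (\<lambda>w. (Y e w)\<^sup>2) else 0)"
    by (intro sum.cong refl) (auto simp: prod2(2) power2_eq_square)
  also have "\<dots> = (\<Sum>e\<in>J. expectation (\<lambda>w. (Y e w)\<^sup>2))" using J by simp
  finally show "expectation (\<lambda>w. (\<Sum>e\<in>J. Y e w)\<^sup>2) = (\<Sum>e\<in>J. expectation (\<lambda>w. (Y e w)\<^sup>2))" .
qed

context quat_wigner
begin

section \<open>Moments forced by a bounded spectrum\<close>

abbreviation ray_bounded :: "real \<Rightarrow> 'w \<Rightarrow> bool" where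
  "ray_bounded C \<omega> \<equiv> eventually (\<lambda>n. \<forall>u. \<bar>ray (\<lambda>j k. x j k \<omega>) n u u\<bar> \<le> C * sqrt (real n) * nsq n u) sequentially"

lemma ray_bounded_of_tendsto:
  assumes lim: "AE \<omega> in M. (\<lambda>n. max_eigenvalue (scaled_corner (\<lambda>j k. x j k \<omega>) n)) \<longlonglongrightarrow> \<xi>1 \<and>
      (\<lambda>n. min_eigenvalue (scaled_corner (\<lambda>j k. x j k \<omega>) n)) \<longlonglongrightarrow> \<xi>2"
  shows "AE \<omega> in M. ray_bounded (\<bar>\<xi>1\<bar> + \<bar>\<xi>2\<bar> + 1) \<omega>"
  using lim AE_space
proof eventually_elim
  case (elim \<omega>)
  let ?X = "\<lambda>j k. x j k \<omega>" and ?C = "\<bar>\<xi>1\<bar> + \<bar>\<xi>2\<bar> + 1"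
  have X: "herm ?X n" for n using elim(2) by (rule herm_x)
  have "eventually (\<lambda>n. max_eigenvalue (scaled_corner ?X n) < ?C) sequentially"
    using elim(1) by (intro order_tendstoD(2)[of _ \<xi>1]) auto
  moreover have "eventually (\<lambda>n. - ?C < min_eigenvalue (scaled_corner ?X n)) sequentially"
    using elim(1) by (intro order_tendstoD(1)[of _ \<xi>2]) auto
  ultimately show ?case using eventually_ge_at_top[of 1]
  proof eventually_elim
    case (elim n)
    have le: "e * ray ?X n u u \<le> ?C * sqrt (real n) * nsq n u"
      if "max_eigenvalue (scaled_corner (\<lambda>j k. e *\<^sub>R ?X j k) n) < ?C" for e u
    proof -
      have "e * ray ?X n u u \<le> max_eigenvalue (scaled_corner (\<lambda>j k. e *\<^sub>R ?X j k) n) * (sqrt (real n) * nsq n u)"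
        using max_eigenvalue_scaled(1)[OF X elim(3), of e u] by (simp add: mult.assoc)
      also have "\<dots> \<le> ?C * (sqrt (real n) * nsq n u)"
        using that by (intro mult_right_mono mult_nonneg_nonneg nsq_nonneg) auto
      finally show ?thesis by (simp add: mult.assoc)
    qed
    have "max_eigenvalue (scaled_corner (\<lambda>j k. (1 :: real) *\<^sub>R ?X j k) n) < ?C"
      using elim(1) by simp
    note 1 = le[OF this]
    have "max_eigenvalue (scaled_corner (\<lambda>j k. (-1 :: real) *\<^sub>R ?X j k) n) < ?C"
      using elim(2) unfolding min_eigenvalue_scaled[OF X elim(3)] by linarith
    note 2 = le[OF this]
    show ?case
    proof
      fix u
      show "\<bar>ray ?X n u u\<bar> \<le> ?C * sqrt (real n) * nsq n u"
        using 1[of u] 2[of u] by (intro abs_leI) auto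
    qed
  qed
qed

lemma x_indep_norm:
  "indep_vars (\<lambda>_. borel) (\<lambda>e \<omega>. norm (x (fst e) (snd e) \<omega>)) {(j, k). 1 \<le> j \<and> j \<le> k}"
proof -
  have "indep_vars (\<lambda>_. borel) (\<lambda>e \<omega>. norm ((case e of (j, k) \<Rightarrow> x j k) \<omega>)) {(j, k). 1 \<le> j \<and> j \<le> k}"
    by (rule indep_vars_compose2[OF x_indep, where Y = "\<lambda>e q. norm q"]) measurable
  then show ?thesis by (simp add: case_prod_beta)
qed

text \<open>The form at the \<open>n\<close>-th unit vector is the \<open>n\<close>-th diagonal
  entry. One independent entry per \<open>n\<close> makes the tail probabilities of the squared norm
  summable.\<close>

lemma diag_sq_integrable:
  assumes C: "C > 0" and bd: "AE \<omega> in M. ray_bounded C \<omega>"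
  shows "integrable M (\<lambda>\<omega>. (norm (x 1 1 \<omega>))\<^sup>2)"
proof -
  define E where "E n = (if n \<ge> 1 then {(n, n)} else {})" for n :: nat
  have "summable (\<lambda>n. \<Sum>e\<in>E n. prob {\<omega> \<in> space M. C * sqrt (real n) < norm (x (fst e) (snd e) \<omega>)})"
  proof (rule borel_cantelli_indep[OF x_indep_norm])
    show "disjoint_family E" by (auto simp: disjoint_family_on_def E_def)
    show "AE \<omega> in M. eventually (\<lambda>n. \<forall>e\<in>E n. norm (x (fst e) (snd e) \<omega>) \<le> C * sqrt (real n)) sequentially"
      using bd AE_space
    proof eventually_elim
      case (elim \<omega>)
      note sp = elim(2)
      from elim(1) show ?case
      proof eventually_elim
        case (elim n)
        show ?case
        proof
          fix e assume "e \<in> E n"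
          then have n: "n \<ge> 1" "e = (n, n)" by (auto simp: E_def split: if_splits)
          define u where "u j = (if j = n then qone else 0)" for j :: nat
          have nu: "nsq n u = 1" using n by (simp add: nsq_def u_def if_distrib if_distribR cong: if_cong)
          have mv: "mvec (\<lambda>j k. x j k \<omega>) n u j = x j n \<omega>" for j
          proof -
            have "mvec (\<lambda>j k. x j k \<omega>) n u j = (\<Sum>k\<in>{1..n}. if k = n then x j k \<omega> else 0)"
              unfolding mvec_def by (intro sum.cong refl) (simp add: u_def qmul.zero_right)
            then show ?thesis using n by simp
          qed
          have "ray (\<lambda>j k. x j k \<omega>) n u u = (\<Sum>j\<in>{1..n}. if j = n then inner qone (x j n \<omega>) else 0)"
            unfolding ray_def mv by (intro sum.cong refl) (simp add: u_def)
          then have r: "ray (\<lambda>j k. x j k \<omega>) n u u = Rq (x n n \<omega>)" using n by (simp add: Rq_def)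
          \<comment> \<open>A self-conjugate quaternion is real, so the form sees its full
            norm.\<close>
          have "x n n \<omega> = Rq (x n n \<omega>) *\<^sub>R qone"
            by (rule self_cnj) (rule x_herm[OF n(1) n(1) sp, symmetric])
          then have "norm (x n n \<omega>) = norm (Rq (x n n \<omega>) *\<^sub>R qone)" by (rule arg_cong)
          then have "norm (x n n \<omega>) = \<bar>Rq (x n n \<omega>)\<bar>" by simp
          then show "norm (x (fst e) (snd e) \<omega>) \<le> C * sqrt (real n)"
            using elim[rule_format, of u] nu r n by simp
        qed
      qed
    qed
  qed (auto simp: E_def split: if_splits)
  moreover have eq: "(\<Sum>e\<in>E n. prob {\<omega> \<in> space M. C * sqrt (real n) < norm (x (fst e) (snd e) \<omega>)})
      = prob {\<omega> \<in> space M. real n < (norm (x 1 1 \<omega>))\<^sup>2 / C\<^sup>2}" if "n \<ge> 1" for n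
  proof -
    have "(\<Sum>e\<in>E n. prob {\<omega> \<in> space M. C * sqrt (real n) < norm (x (fst e) (snd e) \<omega>)})
        = prob {\<omega> \<in> space M. C * sqrt (real n) < norm (x n n \<omega>)}" using that by (simp add: E_def)
    also have "\<dots> = prob {\<omega> \<in> space M. C * sqrt (real n) < norm (x 1 1 \<omega>)}"
      by (rule diag_prob_norm[OF that])
    finally show ?thesis unfolding norm_gt_sqrt_iff[OF C] .
  qed
  ultimately have "summable (\<lambda>n. prob {\<omega> \<in> space M. real n < (norm (x 1 1 \<omega>))\<^sup>2 / C\<^sup>2})"
    by (subst summable_cong[OF eventually_mono[OF eventually_ge_at_top[of 1] eq[symmetric]]])
  moreover have [measurable]: "x 1 1 \<in> borel_measurable M" by (rule x_measurable) auto
  ultimately have "integrable M (\<lambda>\<omega>. (norm (x 1 1 \<omega>))\<^sup>2 / C\<^sup>2)"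
    by (intro integrable_of_summable_tail_1) auto
  from integrable_mult_right[OF this, of "C\<^sup>2"] show ?thesis using C by simp
qed

text \<open>Two vectors with one nonzero coordinate each extract the norm of a single entry. Column
  \<open>n\<close> contributes \<open>n - 1\<close> independent entries, and this extra factor
  raises the summability to a second moment of the squared norm.\<close>

lemma off_fourth_integrable:
  assumes C: "C > 0" and bd: "AE \<omega> in M. ray_bounded C \<omega>"
  shows "integrable M (\<lambda>\<omega>. norm (x 1 2 \<omega>) ^ 4)"
proof -
  define E where "E n = (\<lambda>j. (j, n)) ` {1..<n}" for n :: nat
  have "summable (\<lambda>n. \<Sum>e\<in>E n. prob {\<omega> \<in> space M. C * sqrt (real n) < norm (x (fst e) (snd e) \<omega>)})"
  proof (rule borel_cantelli_indep[OF x_indep_norm])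
    show "disjoint_family E" by (auto simp: disjoint_family_on_def E_def)
    show "AE \<omega> in M. eventually (\<lambda>n. \<forall>e\<in>E n. norm (x (fst e) (snd e) \<omega>) \<le> C * sqrt (real n)) sequentially"
      using bd AE_space
    proof eventually_elim
      case (elim \<omega>)
      note sp = elim(2)
      from elim(1) show ?case
      proof eventually_elim
        case (elim n)
        show ?case
        proof
          fix e assume "e \<in> E n"
          then obtain j where j: "e = (j, n)" "1 \<le> j" "j < n" by (auto simp: E_def)
          let ?q = "x j n \<omega>"
          \<comment> \<open>The coordinate \<open>sgn ?q\<close> aligns the direction, so that the
            form yields the norm; it is 0 for a vanishing entry, whence \<open>nsq n u\<close> is
            only at most 1.\<close>
          define u where "u i = (if i = j then sgn ?q else 0)" for i :: nat
          define w where "w i = (if i = n then qone else 0)" for i :: nat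
          have "nsq n u = (\<Sum>i\<in>{1..n}. if i = j then (norm (sgn ?q))\<^sup>2 else 0)"
            unfolding nsq_def by (intro sum.cong refl) (simp add: u_def)
          then have nu: "nsq n u \<le> 1" using j by (simp add: norm_sgn)
          have "nsq n w = (\<Sum>i\<in>{1..n}. if i = n then 1 else 0)"
            unfolding nsq_def by (intro sum.cong refl) (simp add: w_def)
          then have nw: "nsq n w = 1" using j by simp
          have mv: "mvec (\<lambda>j k. x j k \<omega>) n w i = x i n \<omega>" for i
          proof -
            have "mvec (\<lambda>j k. x j k \<omega>) n w i = (\<Sum>k\<in>{1..n}. if k = n then x i k \<omega> else 0)"
              unfolding mvec_def by (intro sum.cong refl) (simp add: w_def qmul.zero_right)
            then show ?thesis using j by simp
          qed
          have "ray (\<lambda>j k. x j k \<omega>) n u w = (\<Sum>i\<in>{1..n}. if i = j then inner (sgn ?q) (x i n \<omega>) else 0)"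
            unfolding ray_def mv by (intro sum.cong refl) (simp add: u_def)
          then have "ray (\<lambda>j k. x j k \<omega>) n u w = inner (sgn ?q) ?q" using j by simp
          also have "\<dots> = norm ?q"
            by (cases "?q = 0") (simp_all add: sgn_div_norm power2_eq_square flip: power2_norm_eq_inner)
          finally have r: "ray (\<lambda>j k. x j k \<omega>) n u w = norm ?q" .
          have "\<bar>ray (\<lambda>j k. x j k \<omega>) n u w\<bar> \<le> C * sqrt (real n) * (nsq n u + nsq n w) / 2"
            using herm_x[OF sp] elim by (intro ray_bilinear_bound) auto
          also have "\<dots> \<le> C * sqrt (real n) * 2 / 2"
            using nu nw C by (intro divide_right_mono mult_left_mono) auto
          finally show "norm (x (fst e) (snd e) \<omega>) \<le> C * sqrt (real n)" using r j by simp
        qed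
      qed
    qed
  qed (auto simp: E_def)
  moreover let ?p = "\<lambda>n. prob {\<omega> \<in> space M. real n < (norm (x 1 2 \<omega>))\<^sup>2 / C\<^sup>2}"
  have "(\<Sum>e\<in>E n. prob {\<omega> \<in> space M. C * sqrt (real n) < norm (x (fst e) (snd e) \<omega>)}) = real (n - 1) * ?p n" for n
  proof -
    have "(\<Sum>e\<in>E n. prob {\<omega> \<in> space M. C * sqrt (real n) < norm (x (fst e) (snd e) \<omega>)})
        = (\<Sum>j\<in>{1..<n}. prob {\<omega> \<in> space M. C * sqrt (real n) < norm (x j n \<omega>)})"
      unfolding E_def by (subst sum.reindex) (auto simp: inj_on_def)
    also have "\<dots> = (\<Sum>j\<in>{1..<n}. prob {\<omega> \<in> space M. C * sqrt (real n) < norm (x 1 2 \<omega>)})"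
      by (intro sum.cong refl off_prob_norm) auto
    finally show ?thesis unfolding norm_gt_sqrt_iff[OF C] by simp
  qed
  ultimately have sm: "summable (\<lambda>n. real (n - 1) * ?p n)" by simp
  \<comment> \<open>For \<open>n \<ge> 2\<close> the factor \<open>n\<close> is at most twice
    \<open>n - 1\<close>.\<close>
  have "summable (\<lambda>n. real n * ?p n)"
  proof (rule summable_comparison_test_ev[OF _ summable_mult[OF sm, of 2]])
    show "eventually (\<lambda>n. norm (real n * ?p n) \<le> 2 * (real (n - 1) * ?p n)) sequentially"
      using eventually_ge_at_top[of 2]
    proof eventually_elim
      case (elim n)
      have "real n * ?p n \<le> (2 * real (n - 1)) * ?p n"
        using elim by (intro mult_right_mono) (auto simp: of_nat_diff)
      then show ?case by simp
    qed
  qed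
  moreover have [measurable]: "x 1 2 \<in> borel_measurable M" by (rule x_measurable) auto
  ultimately have "integrable M (\<lambda>\<omega>. ((norm (x 1 2 \<omega>))\<^sup>2 / C\<^sup>2)\<^sup>2)"
    by (intro integrable_of_summable_tail_2) auto
  from integrable_mult_right[OF this, of "C ^ 4"] show ?thesis
    using C by (simp add: power_divide flip: power_mult)
qed

end

context quat_wigner4
begin

text \<open>The bilinear form of the two block vectors $(a,\dots,a,0,\dots,0)$ and $(0,\dots,0,1,\dots,1)$ of
  length $2m$ is about $m^2 \|a\|^2$ if the mean is $a$.\<close>

lemma mean_zero:
  assumes C: "C > 0" and bd: "AE \<omega> in M. ray_bounded C \<omega>"
  shows "expectation (x 1 2) = 0"
proof (rule ccontr)
  define a where "a = expectation (x 1 2)"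
  assume "expectation (x 1 2) \<noteq> 0"
  then have a: "(norm a)\<^sup>2 > 0" by (simp add: a_def)
  define Y where "Y e \<omega> = inner a (x (fst e) (snd e) \<omega> - a)" for e \<omega>
  \<comment> \<open>This off-diagonal block lies strictly above the diagonal, so its
    \<open>m\<^sup>2\<close> entries are independent and identically distributed.\<close>
  define J where "J m = {1..m} \<times> {m + 1..2 * m}" for m :: nat
  define S where "S m \<omega> = (\<Sum>e\<in>J m. Y e \<omega>)" for m \<omega>
  define V where "V = expectation (\<lambda>\<omega>. (inner a (x 1 2 \<omega> - a))\<^sup>2)"
  have Jup: "1 \<le> fst e" "fst e < snd e" if "e \<in> J m" for e m using that by (auto simp: J_def)
  have Yind: "indep_vars (\<lambda>_. borel) Y (J m)" for m
  proof -
    have "indep_vars (\<lambda>_. borel) (\<lambda>e \<omega>. inner a ((case e of (j, k) \<Rightarrow> x j k) \<omega> - a)) (J m)"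
      by (rule indep_vars_compose2[OF indep_vars_subset[OF x_indep], where Y = "\<lambda>e q. inner a (q - a)"])
         (auto dest: Jup simp: J_def)
    then show ?thesis by (simp add: Y_def[abs_def] case_prod_beta)
  qed
  have bnd: "(inner a (x 1 2 \<omega> - a))\<^sup>2 \<le> (norm a)\<^sup>2 * (2 * (norm (x 1 2 \<omega>))\<^sup>2 + 2 * (norm a)\<^sup>2)" for \<omega>
  proof -
    have "(inner a (x 1 2 \<omega> - a))\<^sup>2 \<le> (norm a)\<^sup>2 * (norm (x 1 2 \<omega> - a))\<^sup>2"
      using power_mono[OF Cauchy_Schwarz_ineq2[of a "x 1 2 \<omega> - a"], of 2] by (simp add: power_mult_distrib)
    also have "(norm (x 1 2 \<omega> - a))\<^sup>2 \<le> (norm (x 1 2 \<omega>) + norm a)\<^sup>2"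
      by (intro power_mono norm_triangle_ineq4) auto
    also have "\<dots> \<le> 2 * (norm (x 1 2 \<omega>))\<^sup>2 + 2 * (norm a)\<^sup>2"
      using sum_squares_bound[of "norm (x 1 2 \<omega>)" "norm a"] by (simp add: power2_sum)
    finally show ?thesis by (simp add: mult_left_mono)
  qed
  have int12: "integrable M (\<lambda>\<omega>. (inner a (x 1 2 \<omega> - a))\<^sup>2)"
  proof (rule Bochner_Integration.integrable_bound)
    show "integrable M (\<lambda>\<omega>. (norm a)\<^sup>2 * (2 * (norm (x 1 2 \<omega>))\<^sup>2 + 2 * (norm a)\<^sup>2))"
      using x12_sq_integrable by simp
    show "AE \<omega> in M. norm ((inner a (x 1 2 \<omega> - a))\<^sup>2) \<le> norm ((norm a)\<^sup>2 * (2 * (norm (x 1 2 \<omega>))\<^sup>2 + 2 * (norm a)\<^sup>2))"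
      using bnd by (intro AE_I2) (simp add: abs_of_nonneg)
  qed measurable
  have mean12: "expectation (\<lambda>\<omega>. inner a (x 1 2 \<omega> - a)) = 0"
    using x12_integrable by (simp add: inner_diff_right prob_space a_def)
  have Ym: "Y e \<in> borel_measurable M" and Ysq: "integrable M (\<lambda>\<omega>. (Y e \<omega>)\<^sup>2)"
    and YV: "expectation (\<lambda>\<omega>. (Y e \<omega>)\<^sup>2) = V" and Y0: "expectation (Y e) = 0" if "e \<in> J m" for e m
  proof -
    note up = Jup[OF that]
    have xm [measurable]: "x (fst e) (snd e) \<in> borel_measurable M" using up by (intro x_measurable) auto
    show "Y e \<in> borel_measurable M" unfolding Y_def by measurable
    show "expectation (\<lambda>\<omega>. (Y e \<omega>)\<^sup>2) = V"
      unfolding Y_def V_def using off_transfer[of "\<lambda>q. (inner a (q - a))\<^sup>2", OF _ up] by simp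
    show "expectation (Y e) = 0"
      unfolding Y_def using off_transfer[of "\<lambda>q. inner a (q - a)", OF _ up] mean12 by simp
    have "integrable (distr M borel (x (fst e) (snd e))) (\<lambda>q. (inner a (q - a))\<^sup>2)"
      unfolding x_off[OF up] using int12 by (simp add: integrable_distr_eq)
    then show "integrable M (\<lambda>\<omega>. (Y e \<omega>)\<^sup>2)"
      unfolding Y_def by (simp add: integrable_distr_eq)
  qed
  have Ssq: "integrable M (\<lambda>\<omega>. (S m \<omega>)\<^sup>2)" "expectation (\<lambda>\<omega>. (S m \<omega>)\<^sup>2) = (real m)\<^sup>2 * V" for m
  proof -
    have fin: "finite (J m)" by (simp add: J_def)
    note E = expectation_sum_sq_indep[OF fin Yind]
    show "integrable M (\<lambda>\<omega>. (S m \<omega>)\<^sup>2)" unfolding S_def by (rule E(1)) (auto intro: Ysq Y0)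
    have "expectation (\<lambda>\<omega>. (S m \<omega>)\<^sup>2) = (\<Sum>e\<in>J m. expectation (\<lambda>\<omega>. (Y e \<omega>)\<^sup>2))"
      unfolding S_def by (rule E(2)) (auto intro: Ysq Y0)
    also have "\<dots> = (\<Sum>e\<in>J m. V)" by (intro sum.cong refl YV)
    finally show "expectation (\<lambda>\<omega>. (S m \<omega>)\<^sup>2) = (real m)\<^sup>2 * V"
      by (simp add: J_def card_cartesian_product power2_eq_square)
  qed
  \<comment> \<open>Cross terms vanish by independence, so the mean square of the averaged block sum
    is \<open>V / m\<^sup>2\<close>, summable over \<open>m\<close>.\<close>
  have "AE \<omega> in M. (\<lambda>m. (S m \<omega> / (real m)\<^sup>2)\<^sup>2) \<longlonglongrightarrow> 0"
  proof (rule AE_tendsto_0_of_summable[of 1])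
    show "summable (\<lambda>m. V * (1 / (real m)\<^sup>2))"
      using inverse_power_summable[of 2, where 'a = real] by (intro summable_mult) (simp add: inverse_eq_divide)
    show "integrable M (\<lambda>\<omega>. (S m \<omega> / (real m)\<^sup>2)\<^sup>2)" for m
      using Ssq(1)[of m] by (simp add: power_divide)
    show "expectation (\<lambda>\<omega>. (S m \<omega> / (real m)\<^sup>2)\<^sup>2) \<le> V * (1 / (real m)\<^sup>2)" if "m \<ge> 1" for m
    proof -
      have "(real m)\<^sup>2 * V / ((real m)\<^sup>2)\<^sup>2 = V * (1 / (real m)\<^sup>2)"
        using that by (simp add: power2_eq_square)
      then show ?thesis using Ssq(2)[of m] by (simp only: power_divide) simp
    qed
  qed simp
  then have "AE \<omega> in M. False" using bd AE_space
  proof eventually_elim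
    case (elim \<omega>)
    let ?X = "\<lambda>j k. x j k \<omega>"
    have "(\<lambda>m. \<bar>S m \<omega> / (real m)\<^sup>2\<bar>) \<longlonglongrightarrow> 0"
      using tendsto_real_sqrt[OF elim(1)] by simp
    then have lim: "(\<lambda>m. S m \<omega> / (real m)\<^sup>2) \<longlonglongrightarrow> 0" by (simp only: tendsto_rabs_zero_iff)
    \<comment> \<open>The bounded spectrum allows the block form at most \<open>D\<close> times the
      power 3/2 of \<open>m\<close>, whereas a nonzero mean makes it of order
      \<open>m\<^sup>2\<close>.\<close>
    define D where "D = C * sqrt 2 * ((norm a)\<^sup>2 + 1) / 2"
    have sub: "filterlim (\<lambda>m::nat. 2 * m) at_top sequentially"
      by (intro filterlim_subseq strict_monoI) auto
    have "eventually (\<lambda>m. S m \<omega> / (real m)\<^sup>2 \<le> D * (1 / sqrt (real m)) - (norm a)\<^sup>2) sequentially"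
      using eventually_compose_filterlim[OF elim(2) sub] eventually_ge_at_top[of 1]
    proof eventually_elim
      case (elim m)
      define u where "u j = (if j \<le> m then a else 0)" for j
      define w where "w j = (if m < j then qone else 0)" for j
      have split: "{1..2 * m} = {1..m} \<union> {m + 1..2 * m}" by auto
      have nu: "nsq (2 * m) u = real m * (norm a)\<^sup>2"
      proof -
        have "nsq (2 * m) u = (\<Sum>j\<in>{1..m}. (norm (u j))\<^sup>2)"
          unfolding nsq_def by (intro sum.mono_neutral_right) (auto simp: u_def)
        then show ?thesis by (simp add: u_def)
      qed
      have nw: "nsq (2 * m) w = real m"
      proof -
        have "nsq (2 * m) w = (\<Sum>j\<in>{m + 1..2 * m}. (norm (w j))\<^sup>2)"
          unfolding nsq_def by (intro sum.mono_neutral_right) (auto simp: w_def)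
        then show ?thesis by (simp add: w_def)
      qed
      have mv: "mvec ?X (2 * m) w j = (\<Sum>k\<in>{m + 1..2 * m}. x j k \<omega>)" for j
      proof -
        have "mvec ?X (2 * m) w j = (\<Sum>k\<in>{m + 1..2 * m}. x j k \<omega> \<diamond> w k)"
          unfolding mvec_def by (intro sum.mono_neutral_right) (auto simp: w_def qmul.zero_right)
        then show ?thesis by (simp add: w_def)
      qed
      have "ray ?X (2 * m) u w = (\<Sum>j\<in>{1..m}. inner (u j) (mvec ?X (2 * m) w j))"
        unfolding ray_def by (intro sum.mono_neutral_right) (auto simp: u_def)
      also have "\<dots> = (\<Sum>j\<in>{1..m}. \<Sum>k\<in>{m + 1..2 * m}. inner a (x j k \<omega>))"
        by (simp add: u_def mv inner_sum_right)
      also have "\<dots> = (\<Sum>e\<in>J m. Y e \<omega> + (norm a)\<^sup>2)"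
        unfolding J_def by (simp add: sum.cartesian_product Y_def case_prod_beta inner_diff_right power2_norm_eq_inner)
      also have "\<dots> = S m \<omega> + (real m)\<^sup>2 * (norm a)\<^sup>2"
        by (simp add: sum.distrib S_def) (simp add: J_def card_cartesian_product power2_eq_square)
      finally have r: "ray ?X (2 * m) u w = S m \<omega> + (real m)\<^sup>2 * (norm a)\<^sup>2" .
      have "\<bar>ray ?X (2 * m) u w\<bar> \<le> C * sqrt (real (2 * m)) * (nsq (2 * m) u + nsq (2 * m) w) / 2"
        using herm_x[OF \<open>\<omega> \<in> space M\<close>] elim(1) by (intro ray_bilinear_bound) auto
      also have "\<dots> = D * (sqrt (real m) * real m)"
        unfolding nu nw by (simp add: D_def real_sqrt_mult algebra_simps add_divide_distrib)
      finally have "S m \<omega> + (real m)\<^sup>2 * (norm a)\<^sup>2 \<le> D * (sqrt (real m) * real m)" using r by linarith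
      then have "(S m \<omega> + (real m)\<^sup>2 * (norm a)\<^sup>2) / (real m)\<^sup>2 \<le> D * (sqrt (real m) * real m) / (real m)\<^sup>2"
        by (rule divide_right_mono) simp
      moreover have "(S m \<omega> + (real m)\<^sup>2 * (norm a)\<^sup>2) / (real m)\<^sup>2 = S m \<omega> / (real m)\<^sup>2 + (norm a)\<^sup>2"
        using elim(2) by (simp add: add_divide_distrib)
      moreover have "D * (sqrt (real m) * real m) / (real m)\<^sup>2 = D * (1 / sqrt (real m))"
      proof -
        have "sqrt (real m) * real m / (real m)\<^sup>2 = 1 / sqrt (real m)"
          using elim(2) by (simp add: power2_eq_square real_div_sqrt field_simps)
        then show ?thesis by (metis times_divide_eq_right)
      qed
      ultimately show ?case by linarith
    qed
    moreover have "(\<lambda>m. D * (1 / sqrt (real m)) - (norm a)\<^sup>2) \<longlonglongrightarrow> D * 0 - (norm a)\<^sup>2"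
    proof (intro tendsto_intros)
      show "(\<lambda>m. 1 / sqrt (real m)) \<longlonglongrightarrow> 0" by real_asymp
    qed
    ultimately have "0 \<le> D * 0 - (norm a)\<^sup>2"
      using lim by (intro tendsto_le[OF trivial_limit_sequentially])
    then show False using a by simp
  qed
  then show False by simp
qed

end

lemma (in quat_wigner) diag_norm_sq_expectation:
  assumes "\<And>\<omega>. \<omega> \<in> space M \<Longrightarrow> x 1 1 \<omega> = (f \<omega>, 0, 0, 0)"
  shows "expectation (\<lambda>\<omega>. (norm (x 1 1 \<omega>))\<^sup>2) = expectation (\<lambda>\<omega>. (f \<omega>)\<^sup>2)"
  by (intro Bochner_Integration.integral_cong refl) (simp add: assms norm_Pair)

theorem theorem2p2:
  fixes M :: "'w measure"
    and x :: "nat \<Rightarrow> nat \<Rightarrow> 'w \<Rightarrow> quat"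
    and a b c d :: "nat \<Rightarrow> nat \<Rightarrow> 'w \<Rightarrow> real"
    and \<xi>\<^sub>1 \<xi>\<^sub>2 :: real
  assumes "prob_space M"
    and "\<And>j k \<omega>. x j k \<omega> = (a j k \<omega>, b j k \<omega>, c j k \<omega>, d j k \<omega>)"
    and "\<And>j k \<omega>. 1 \<le> j \<Longrightarrow> 1 \<le> k \<Longrightarrow> \<omega> \<in> space M \<Longrightarrow> x k j \<omega> = quat_cnj (x j k \<omega>)"
    and "\<And>j \<omega>. 1 \<le> j \<Longrightarrow> \<omega> \<in> space M \<Longrightarrow> x j j \<omega> = (a j j \<omega>, 0, 0, 0)"
    and "prob_space.indep_vars M (\<lambda>_. borel) (\<lambda>(j, k). x j k) {(j, k). 1 \<le> j \<and> j \<le> k}"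
    and "\<And>j. 1 \<le> j \<Longrightarrow> distr M borel (x j j) = distr M borel (x 1 1)"
    and "\<And>j k. 1 \<le> j \<Longrightarrow> j < k \<Longrightarrow> distr M borel (x j k) = distr M borel (x 1 2)"
  shows "(AE \<omega> in M.
            (\<lambda>n. max_eigenvalue (scaled_corner (\<lambda>j k. x j k \<omega>) n)) \<longlonglongrightarrow> \<xi>\<^sub>1 \<and>
            (\<lambda>n. min_eigenvalue (scaled_corner (\<lambda>j k. x j k \<omega>) n)) \<longlonglongrightarrow> \<xi>\<^sub>2)
     \<longleftrightarrow>
         (integrable M (\<lambda>\<omega>. (quat_norm (x 1 1 \<omega>))\<^sup>2) \<and>
            (\<integral>\<omega>. (quat_norm (x 1 1 \<omega>))\<^sup>2 \<partial>M) = (\<integral>\<omega>. (a 1 1 \<omega>)\<^sup>2 \<partial>M)) \<and>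
         (integrable M (a 1 2) \<and> (\<integral>\<omega>. a 1 2 \<omega> \<partial>M) = 0 \<and>
          integrable M (b 1 2) \<and> (\<integral>\<omega>. b 1 2 \<omega> \<partial>M) = 0 \<and>
          integrable M (c 1 2) \<and> (\<integral>\<omega>. c 1 2 \<omega> \<partial>M) = 0 \<and>
          integrable M (d 1 2) \<and> (\<integral>\<omega>. d 1 2 \<omega> \<partial>M) = 0) \<and>
         (\<exists>\<sigma>\<ge>0. integrable M (\<lambda>\<omega>. (quat_norm (x 1 2 \<omega>))\<^sup>2) \<and>
            (\<integral>\<omega>. (quat_norm (x 1 2 \<omega>))\<^sup>2 \<partial>M) = \<sigma>\<^sup>2 \<and> \<xi>\<^sub>1 = 2 * \<sigma> \<and> \<xi>\<^sub>2 = - 2 * \<sigma>) \<and>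
         integrable M (\<lambda>\<omega>. (quat_norm (x 1 2 \<omega>)) ^ 4)"
proof -
  interpret prob_space M by fact
  interpret quat_wigner M x
    by unfold_locales (rule assms; assumption)+
  have comp: "a j k = (\<lambda>\<omega>. fst (x j k \<omega>))" "b j k = (\<lambda>\<omega>. fst (snd (x j k \<omega>)))"
    "c j k = (\<lambda>\<omega>. fst (snd (snd (x j k \<omega>))))" "d j k = (\<lambda>\<omega>. snd (snd (snd (x j k \<omega>))))" for j k
    by (simp_all add: assms(2))
  have diag: "expectation (\<lambda>\<omega>. (norm (x 1 1 \<omega>))\<^sup>2) = expectation (\<lambda>\<omega>. (a 1 1 \<omega>)\<^sup>2)"
    by (rule diag_norm_sq_expectation) (simp add: assms(4))
  have bl: "bounded_linear (fst :: quat \<Rightarrow> real)" "bounded_linear (\<lambda>q :: quat. fst (snd q))"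
    "bounded_linear (\<lambda>q :: quat. fst (snd (snd q)))" "bounded_linear (\<lambda>q :: quat. snd (snd (snd q)))"
    by (intro bounded_linear_fst bounded_linear_snd bounded_linear_compose[OF bounded_linear_fst]
        bounded_linear_compose[OF bounded_linear_snd] bounded_linear_ident)+
  show ?thesis (is "?lim \<longleftrightarrow> ?cond")
  proof
    assume lim: ?lim
    define C where "C = \<bar>\<xi>\<^sub>1\<bar> + \<bar>\<xi>\<^sub>2\<bar> + 1"
    have C: "C > 0" by (simp add: C_def)
    have bd: "AE \<omega> in M. ray_bounded C \<omega>"
      unfolding C_def by (rule ray_bounded_of_tendsto[OF lim])
    note diag_int = diag_sq_integrable[OF C bd]
    \<comment> \<open>The fourth moment comes first: it gives the integrability behind the argument
      for the mean.\<close>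
    interpret quat_wigner4 M x
      using off_fourth_integrable[OF C bd] by unfold_locales
    have zero: "expectation (x 1 2) = 0" by (rule mean_zero[OF C bd])
    have coord: "integrable M (\<lambda>\<omega>. f (x 1 2 \<omega>)) \<and> expectation (\<lambda>\<omega>. f (x 1 2 \<omega>)) = 0"
      if f: "bounded_linear f" for f :: "quat \<Rightarrow> real"
      using integrable_bounded_linear[OF f x12_integrable] integral_bounded_linear[OF f x12_integrable]
      by (simp add: zero linear_0[OF bounded_linear.linear[OF f]])
    define \<sigma> where "\<sigma> = sqrt (expectation (\<lambda>\<omega>. (norm (x 1 2 \<omega>))\<^sup>2))"
    have \<sigma>: "\<sigma> \<ge> 0" "expectation (\<lambda>\<omega>. (norm (x 1 2 \<omega>))\<^sup>2) = \<sigma>\<^sup>2" by (simp_all add: \<sigma>_def)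
    \<comment> \<open>With the moment conditions established, the sufficiency part determines the
      limits; uniqueness of limits gives an almost sure equality of constants.\<close>
    have "AE \<omega> in M. \<xi>\<^sub>1 = 2 * \<sigma> \<and> \<xi>\<^sub>2 = - 2 * \<sigma>"
      using lim eigenvalues_tendsto[OF zero diag_int \<sigma>]
      by eventually_elim (blast intro: LIMSEQ_unique)
    then have "\<xi>\<^sub>1 = 2 * \<sigma>" "\<xi>\<^sub>2 = - 2 * \<sigma>" by (simp_all only: AE_const)
    then show ?cond
      unfolding quat_norm_eq comp[of 1 2]
      using diag_int diag \<sigma> x12_sq_integrable int4 coord[OF bl(1)] coord[OF bl(2)] coord[OF bl(3)] coord[OF bl(4)]
      by blast
  next
    assume cond: ?cond
    then obtain \<sigma> where \<sigma>: "\<sigma> \<ge> 0" "expectation (\<lambda>\<omega>. (norm (x 1 2 \<omega>))\<^sup>2) = \<sigma>\<^sup>2"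
        and \<xi>: "\<xi>\<^sub>1 = 2 * \<sigma>" "\<xi>\<^sub>2 = - 2 * \<sigma>"
      unfolding quat_norm_eq by blast
    interpret quat_wigner4 M x
      using cond unfolding quat_norm_eq by unfold_locales blast
    \<comment> \<open>A quaternion mean vanishes if its four coordinates do, and each coordinate
      commutes with the expectation as a bounded linear map.\<close>
    have "f (expectation (x 1 2)) = expectation (\<lambda>\<omega>. f (x 1 2 \<omega>))"
      if f: "bounded_linear f" for f :: "quat \<Rightarrow> real"
      by (rule integral_bounded_linear[OF f x12_integrable, symmetric])
    note this[OF bl(1)] this[OF bl(2)] this[OF bl(3)] this[OF bl(4)]
    then have "expectation (x 1 2) = 0"
      using cond unfolding comp[of 1 2] by (simp add: prod_eq_iff)
    moreover have "integrable M (\<lambda>\<omega>. (norm (x 1 1 \<omega>))\<^sup>2)"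
      using cond unfolding quat_norm_eq by blast
    ultimately show ?lim unfolding \<xi> by (rule eigenvalues_tendsto[OF _ _ \<sigma>])
  qed
qed

end
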